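(* Let $k\geq 0$ and let $\Gamma$ be a discrete group that is virtually $\mathbb{Z}^k$. Then for every $n>0$, the space $\overline{\mathrm{Irr}}^+_n(\Gamma)$ is homeomorphic to a CW complex of dimension at most $k$.
   Context: A group is virtually $\mathbb{Z}^k$ if it has a finite index subgroup isomorphic to $\mathbb{Z}^k$. For a finitely generated group $\Gamma$, $\mathrm{Hom}(\Gamma,U(n))$ is the space of homomorphisms with the subspace topology from $U(n)^\Gamma$, and $U(n)$ acts on it by conjugation. A representation $\rho$ is reducible if $\rho\cong\phi\oplus\psi$ (block sum, up to unitary conjugation) with $\phi,\psi$ of positive dimension, and irreducible otherwise. Write $\mathrm{Sum}(\Gamma,U(n))$ and $\mathrm{Irr}(\Gamma,U(n))$ for the subspaces of reducible and irreducible representations, $\overline{\mathrm{Hom}}_n(\Gamma)=\mathrm{Hom}(\Gamma,U(n))/U(n)$, $\overline{\mathrm{Sum}}_n(\Gamma)=\mathrm{Sum}(\Gamma,U(n))/U(n)$, $\overline{\mathrm{Irr}}_n(\Gamma)=\mathrm{Irr}(\Gamma,U(n))/U(n)$. Define $\overline{\mathrm{Irr}}^+_n(\Gamma)=\overline{\mathrm{Hom}}_n(\Gamma)/\overline{\mathrm{Sum}}_n(\Gamma)$ (the reducibles collapsed to a basepoint; a disjoint basepoint is added if there are no reducibles); it is the one-point compactification of $\overline{\mathrm{Irr}}_n(\Gamma)$. *)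

theory Defs
  imports "HOL-Analysis.Analysis" "HOL-Algebra.Product_Groups"
begin

definition Zpow_group :: "nat \<Rightarrow> (nat \<Rightarrow> int) monoid" where
  "Zpow_group k = product_group {..<k} (\<lambda>_. integer_group)"

definition virtually_Zpow :: "('g, 'b) monoid_scheme \<Rightarrow> nat \<Rightarrow> bool" where
  "virtually_Zpow G k \<longleftrightarrow>
     (\<exists>H. subgroup H G \<and> finite (rcosets\<^bsub>G\<^esub> H) \<and>
          (G\<lparr>carrier := H\<rparr>) \<cong> Zpow_group k)"

definition conj_transpose :: "complex^'n^'n \<Rightarrow> complex^'n^'n" where
  "conj_transpose A = (\<chi> i j. cnj (A $ j $ i))"

definition unitary_group :: "(complex^'n^'n) set" where
  "unitary_group = {A. A ** conj_transpose A = mat 1}"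

definition Hom_U :: "('g, 'b) monoid_scheme \<Rightarrow> ('g \<Rightarrow> complex^'n^'n) set" where
  "Hom_U G = {\<rho> \<in> carrier G \<rightarrow>\<^sub>E unitary_group.
      \<forall>x\<in>carrier G. \<forall>y\<in>carrier G. \<rho> (x \<otimes>\<^bsub>G\<^esub> y) = \<rho> x ** \<rho> y}"

definition Hom_top :: "('g, 'b) monoid_scheme \<Rightarrow> ('g \<Rightarrow> complex^'n^'n) topology" where
  "Hom_top G = subtopology (product_topology (\<lambda>_. euclidean) (carrier G)) (Hom_U G)"

definition conj_rep ::
  "('g, 'b) monoid_scheme \<Rightarrow> complex^'n^'n \<Rightarrow> ('g \<Rightarrow> complex^'n^'n) \<Rightarrow> ('g \<Rightarrow> complex^'n^'n)" where
  "conj_rep G U \<rho> = (\<lambda>\<gamma>\<in>carrier G. U ** \<rho> \<gamma> ** conj_transpose U)"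

definition rep_orbit :: "('g, 'b) monoid_scheme \<Rightarrow> ('g \<Rightarrow> complex^'n^'n) \<Rightarrow> ('g \<Rightarrow> complex^'n^'n) set" where
  "rep_orbit G \<rho> = (\<lambda>U. conj_rep G U \<rho>) ` unitary_group"

text \<open>Reducible: unitarily conjugate to a block sum of two representations of positive
  dimension.  The blocks are indexed by a proper nonempty subset S of the index type
  (equivalent to the usual first-m-coordinates convention, since permutation matrices are unitary).\<close>
definition reducible_rep :: "('g, 'b) monoid_scheme \<Rightarrow> ('g \<Rightarrow> complex^'n^'n) \<Rightarrow> bool" where
  "reducible_rep G \<rho> \<longleftrightarrow>
     (\<exists>U\<in>unitary_group. \<exists>S::'n set. S \<noteq> {} \<and> S \<noteq> UNIV \<and>
        (\<forall>\<gamma>\<in>carrier G. \<forall>i j. (i \<in> S \<longleftrightarrow> j \<notin> S) \<longrightarrow> conj_rep G U \<rho> \<gamma> $ i $ j = 0))"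

definition irr_plus_proj ::
  "('g, 'b) monoid_scheme \<Rightarrow> ('g \<Rightarrow> complex^'n^'n) \<Rightarrow> ('g \<Rightarrow> complex^'n^'n) set option" where
  "irr_plus_proj G \<rho> = (if reducible_rep G \<rho> then None else Some (rep_orbit G \<rho>))"

text \<open>Irr^+_n(G) = (Hom/U(n)) / (Sum/U(n)), with a disjoint base point if there are no reducibles:
  the quotient topology of Hom(G,U(n)) \<squnion> {pt} under the map sending pt and all reducibles
  to the base point None.\<close>
definition irr_plus_open ::
  "('g, 'b) monoid_scheme \<Rightarrow> ('g \<Rightarrow> complex^'n^'n) set option set \<Rightarrow> bool" where
  "irr_plus_open G V \<longleftrightarrow> V \<subseteq> insert None (irr_plus_proj G ` Hom_U G) \<and>
      openin (Hom_top G) {\<rho> \<in> topspace (Hom_top G). irr_plus_proj G \<rho> \<in> V}"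

definition Irr_plus_top :: "('g, 'b) monoid_scheme \<Rightarrow> ('g \<Rightarrow> complex^'n^'n) set option topology" where
  "Irr_plus_top G = topology (irr_plus_open G)"

lemma istopology_Irr_plus:
  fixes G :: "('g, 'b) monoid_scheme"
  shows "istopology (irr_plus_open G :: ('g \<Rightarrow> complex^'n^'n) set option set \<Rightarrow> bool)"
  unfolding istopology_def
proof (intro conjI allI impI)
  fix S T :: "('g \<Rightarrow> complex^'n^'n) set option set" assume S: "irr_plus_open G S" and T: "irr_plus_open G T"
  have "{\<rho> \<in> topspace (Hom_top G). irr_plus_proj G \<rho> \<in> S \<inter> T} =
        {\<rho> \<in> topspace (Hom_top G). irr_plus_proj G \<rho> \<in> S} \<inter> {\<rho> \<in> topspace (Hom_top G). irr_plus_proj G \<rho> \<in> T}"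
    by auto
  then show "irr_plus_open G (S \<inter> T)"
    using S T unfolding irr_plus_open_def by auto
next
  fix K :: "('g \<Rightarrow> complex^'n^'n) set option set set" assume K: "\<forall>V\<in>K. irr_plus_open G V"
  have "{\<rho> \<in> topspace (Hom_top G). irr_plus_proj G \<rho> \<in> \<Union>K} =
        (\<Union>V\<in>K. {\<rho> \<in> topspace (Hom_top G). irr_plus_proj G \<rho> \<in> V})"
    by auto
  then show "irr_plus_open G (\<Union>K)"
    using K unfolding irr_plus_open_def by auto
qed

lemma openin_Irr_plus_top:
  fixes G :: "('g, 'b) monoid_scheme"
  shows "openin (Irr_plus_top G :: ('g \<Rightarrow> complex^'n^'n) set option topology) = irr_plus_open G"
  unfolding Irr_plus_top_def by (rule topology_inverse'[OF istopology_Irr_plus])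

definition closed_disc :: "nat \<Rightarrow> (nat \<Rightarrow> real) topology" where
  "closed_disc m = subtopology (Euclidean_space m) {x. (\<Sum>i<m. x i ^ 2) \<le> 1}"

definition open_disc :: "nat \<Rightarrow> (nat \<Rightarrow> real) topology" where
  "open_disc m = subtopology (Euclidean_space m) {x. (\<Sum>i<m. x i ^ 2) < 1}"

definition disc_boundary :: "nat \<Rightarrow> (nat \<Rightarrow> real) set" where
  "disc_boundary m = {x \<in> topspace (Euclidean_space m). (\<Sum>i<m. x i ^ 2) = 1}"

definition CW_complex_dim_le :: "'a topology \<Rightarrow> nat \<Rightarrow> bool" where
  "CW_complex_dim_le T d \<longleftrightarrow> Hausdorff_space T \<and>
     (\<exists>(cells :: 'a set set) (dim :: 'a set \<Rightarrow> nat) (chr :: 'a set \<Rightarrow> (nat \<Rightarrow> real) \<Rightarrow> 'a).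
        \<Union>cells = topspace T \<and>
        pairwise disjnt cells \<and> {} \<notin> cells \<and>
        (\<forall>e\<in>cells. dim e \<le> d) \<and>
        (\<forall>e\<in>cells. continuous_map (closed_disc (dim e)) T (chr e)) \<and>
        (\<forall>e\<in>cells. homeomorphic_map (open_disc (dim e)) (subtopology T e) (chr e)) \<and>
        (\<forall>e\<in>cells. \<exists>F. finite F \<and> F \<subseteq> cells \<and> (\<forall>e'\<in>F. dim e' < dim e) \<and>
                        chr e ` disc_boundary (dim e) \<subseteq> \<Union>F) \<and>
        (\<forall>A. A \<subseteq> topspace T \<longrightarrow>
              (closedin T A \<longleftrightarrow> (\<forall>e\<in>cells. closedin T (A \<inter> (Abstract_Topology.closure_of T e))))))"

end

theory Submission
  imports Defs "HOL-Library.Function_Algebras"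
begin

text \<open>
  Let \<open>N\<close> be a normal subgroup of finite index contained in the given copy of \<open>\<int>\<^sup>k\<close>, and let \<open>V\<close> be the
  space of homomorphisms \<open>N \<rightarrow> \<real>\<close>. On \<open>N\<close>, an irreducible representation is a sum of characters
  \<open>exp (2 \<pi> \<i> x)\<close> with \<open>x\<close> in a single orbit of \<open>V\<close> under \<open>G\<close> and translation by integral
  homomorphisms. The hyperplanes \<open>x s - x t \<in> \<int>\<close>, for \<open>s\<close> and \<open>t\<close> in a finite conjugation-invariant
  generating set of \<open>N\<close> containing \<open>\<one>\<close>, cut \<open>V\<close> into relatively open polytopes. This decomposition is invariant, and an affine symmetry that moves a point of a polytope into the same polytope fixes that
  point. The stabilizer of \<open>x\<close> modulo integral homomorphisms acts trivially on the direction space of the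
  polytope of \<open>x\<close>, so that (by averaging over \<open>G / N\<close>) the representation can be twisted along the closed
  polytope; it stays irreducible in the relative interior. These families of twists are the characteristic
  maps of the cells, the base point being one more vertex. For a fixed weight there are only finitely many
  irreducible representations, by averaging an intertwiner and Schur's lemma, so there are finitely
  many cells. Their dimensions are at most \<open>dim V \<le> k\<close>.
\<close>

section \<open>Unitary matrices and simultaneous diagonalization\<close>

text \<open>The main obstacle is a symmetry that maps a face to itself without fixing it: the image
  of that face would be a quotient of a disc. Hyperplanes \<open>x s \<in> \<int>\<close> alone do
  not exclude this in general, as the swap of coordinates on the unit square shows. The differences
  \<open>x s - x t\<close> also record the order of the fractional parts, which a symmetry merely
  permutes, and an order-preserving permutation of finitely many values moves none of them.

  A displacement of the weight need not be G-invariant, so twisting is not tensoring with a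
  character of G. Instead evaluation, as a map from N to the dual of V, is extended to a crossed
  homomorphism of G; the obstruction lies in the second cohomology of the finite group G/N with real
  coefficients and vanishes, and averaging makes this explicit. The twist is multiplicative because
  nonzero matrix entries connect only weights whose displacements correspond exactly, not just
  modulo integral homomorphisms.

  Twists that become reducible on the boundary of a face all go to the single base point, so their
  decomposition never has to be controlled.\<close>

lemma conj_transpose_nth [simp]: "conj_transpose A $ i $ j = cnj (A $ j $ i)"
  by (simp add: conj_transpose_def)

lemma conj_transpose_conj_transpose [simp]: "conj_transpose (conj_transpose A) = A"
  by (simp add: vec_eq_iff)

lemma conj_transpose_mult: "conj_transpose (A ** B) = conj_transpose B ** conj_transpose A"
  by (simp add: vec_eq_iff matrix_matrix_mult_def mult.commute)

lemma conj_transpose_mat1 [simp]: "conj_transpose (mat 1) = mat 1"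
  by (simp add: vec_eq_iff mat_def)

lemma unitary_groupD:
  fixes U :: "complex^'n^'n"
  assumes "U \<in> unitary_group"
  shows "U ** conj_transpose U = mat 1" "conj_transpose U ** U = mat 1"
  using assms matrix_left_right_inverse[of U "conj_transpose U"] by (auto simp: unitary_group_def)

lemma mat1_unitary [simp]: "mat 1 \<in> unitary_group"
  by (simp add: unitary_group_def)

lemma conj_transpose_unitary [simp]:
  fixes U :: "complex^'n^'n"
  shows "U \<in> unitary_group \<Longrightarrow> conj_transpose U \<in> unitary_group"
  by (simp add: unitary_group_def unitary_groupD(2))

lemma mult_unitary:
  fixes U :: "complex^'n^'n"
  assumes U: "U \<in> unitary_group" and V: "V \<in> unitary_group"
  shows "U ** V \<in> unitary_group"
proof -
  have "(U ** V) ** conj_transpose (U ** V) = U ** (V ** conj_transpose V) ** conj_transpose U"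
    by (simp add: conj_transpose_mult matrix_mul_assoc)
  then show ?thesis
    by (simp add: unitary_group_def unitary_groupD(1)[OF U] unitary_groupD(1)[OF V])
qed

lemma unitary_row_norm:
  assumes "U \<in> unitary_group"
  shows "(\<Sum>j\<in>UNIV. (cmod (U $ i $ j))\<^sup>2) = 1"
proof -
  have "(U ** conj_transpose U) $ i $ i = 1"
    using unitary_groupD[OF assms] by (simp add: mat_def)
  then have "(\<Sum>j\<in>UNIV. U $ i $ j * cnj (U $ i $ j)) = 1"
    by (simp add: matrix_matrix_mult_def)
  then have "complex_of_real (\<Sum>j\<in>UNIV. (cmod (U $ i $ j))\<^sup>2) = 1"
    by (simp only: complex_norm_square of_real_sum)
  then show ?thesis
    using of_real_eq_1_iff by blast
qed

text \<open>Unitary matrices lie on one sphere: this bounds the group for compactness, and later it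
  turns a small distance into a positive inner product.\<close>

lemma norm_unitary_sq:
  fixes U :: "complex^'n^'n"
  assumes "U \<in> unitary_group"
  shows "(norm U)\<^sup>2 = CARD('n)"
proof -
  have "(norm U)\<^sup>2 = (\<Sum>i\<in>UNIV. \<Sum>j\<in>UNIV. (cmod (U $ i $ j))\<^sup>2)"
    by (simp add: norm_vec_def L2_set_def real_sqrt_pow2 sum_nonneg)
  then show ?thesis
    by (simp add: unitary_row_norm[OF assms])
qed

lemma continuous_on_matrix_mult [continuous_intros]:
  fixes f g :: "'a::topological_space \<Rightarrow> complex^'n^'n"
  assumes "continuous_on S f" "continuous_on S g"
  shows "continuous_on S (\<lambda>x. f x ** g x)"
  unfolding matrix_matrix_mult_def
  by (intro continuous_intros assms)

lemma continuous_on_conj_transpose [continuous_intros]: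
  fixes f :: "'a::topological_space \<Rightarrow> complex^'n^'n"
  assumes "continuous_on S f"
  shows "continuous_on S (\<lambda>x. conj_transpose (f x))"
  unfolding conj_transpose_def
  by (intro continuous_intros assms)

lemma closed_unitary: "closed (unitary_group :: (complex^'n^'n) set)"
  unfolding unitary_group_def
  by (intro closed_Collect_eq continuous_intros)

lemma compact_unitary: "compact (unitary_group :: (complex^'n^'n) set)"
proof -
  have "norm U = sqrt CARD('n)" if "U \<in> unitary_group" for U :: "complex^'n^'n"
    using norm_unitary_sq[OF that] by (metis norm_ge_zero real_sqrt_unique)
  then have "bounded (unitary_group :: (complex^'n^'n) set)"
    unfolding bounded_iff by (metis order_refl)
  then show ?thesis
    using closed_unitary compact_eq_bounded_closed by blast
qed

lemma inner_complex_vec: "inner u v = Re (\<Sum>i\<in>UNIV. cnj (u $ i) * v $ i)"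
  for u v :: "complex^'n"
  by (simp add: inner_vec_def inner_complex_def)

lemma sum_cnj_matrix_vector:
  fixes A :: "complex^'n^'n"
  shows "(\<Sum>i\<in>UNIV. cnj (u $ i) * (A *v v) $ i) = (\<Sum>i\<in>UNIV. cnj ((conj_transpose A *v u) $ i) * v $ i)"
proof -
  have "(\<Sum>i\<in>UNIV. cnj (u $ i) * (A *v v) $ i) = (\<Sum>i\<in>UNIV. \<Sum>j\<in>UNIV. cnj (u $ i) * A $ i $ j * v $ j)"
    by (simp add: matrix_vector_mult_def sum_distrib_left mult.assoc)
  also have "\<dots> = (\<Sum>j\<in>UNIV. \<Sum>i\<in>UNIV. cnj (u $ i) * A $ i $ j * v $ j)"
    by (rule sum.swap)
  also have "\<dots> = (\<Sum>j\<in>UNIV. cnj ((conj_transpose A *v u) $ j) * v $ j)"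
    by (simp add: matrix_vector_mult_def sum_distrib_right sum_distrib_left mult_ac)
  finally show ?thesis .
qed

lemma inner_matrix_vector:
  fixes A :: "complex^'n^'n"
  shows "inner u (A *v v) = inner (conj_transpose A *v u) v"
  by (simp only: inner_complex_vec sum_cnj_matrix_vector)

section \<open>Common eigenvectors of commuting families closed under adjoints\<close>

definition csubspace :: "(complex^'n) set \<Rightarrow> bool" where
  "csubspace W \<longleftrightarrow> 0 \<in> W \<and> (\<forall>u\<in>W. \<forall>v\<in>W. u + v \<in> W) \<and> (\<forall>c. \<forall>u\<in>W. c *s u \<in> W)"

lemma scaleR_eq_smult: "r *\<^sub>R u = complex_of_real r *s u" for u :: "complex^'n"
  by (simp add: vec_eq_iff vector_scalar_mult_def) (simp add: scaleR_conv_of_real)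

lemma csubspace_imp_subspace: "csubspace W \<Longrightarrow> subspace W"
  unfolding csubspace_def subspace_def scaleR_eq_smult by blast

lemma matrix_vector_smult: "A *v (c *s u) = c *s (A *v u)" for A :: "complex^'n^'n"
  by (simp add: vec_eq_iff matrix_vector_mult_def sum_distrib_left mult_ac)

lemma linear_matrix_vector_complex: "linear (\<lambda>v. A *v v)" for A :: "complex^'n^'n"
  by (rule linearI) (simp_all add: matrix_vector_right_distrib scaleR_eq_smult matrix_vector_smult)

text \<open>The maximum of the quadratic form on the unit sphere of the invariant subspace is an
  eigenvalue.\<close>
lemma hermitian_eigenvector:
  fixes A :: "complex^'n^'n"
  assumes W: "csubspace W" and ne: "W \<noteq> {0}" and herm: "conj_transpose A = A"
    and inv: "\<And>w. w \<in> W \<Longrightarrow> A *v w \<in> W"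
  shows "\<exists>c w. w \<in> W \<and> w \<noteq> 0 \<and> A *v w = c *s w"
proof -
  have sub: "subspace W"
    using W by (rule csubspace_imp_subspace)
  let ?f = "\<lambda>w. inner w (A *v w)"
  have lin: "linear (\<lambda>v. A *v v)"
    by (rule linear_matrix_vector_complex)
  have cont: "continuous_on T ?f" for T
    by (intro continuous_intros linear_continuous_on linear_conv_bounded_linear[THEN iffD1] lin)
  obtain w0 where w0: "w0 \<in> W" "w0 \<noteq> 0"
    using ne W by (auto simp: csubspace_def)
  have "compact (W \<inter> sphere 0 1)"
    by (intro closed_Int_compact closed_subspace sub) simp
  moreover have "w0 /\<^sub>R norm w0 \<in> W \<inter> sphere 0 1"
    using w0 sub by (simp add: subspace_mul)
  ultimately have "\<exists>w\<in>W \<inter> sphere 0 1. \<forall>u\<in>W \<inter> sphere 0 1. ?f u \<le> ?f w"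
    by (intro continuous_attains_sup cont) auto
  then obtain w where w: "w \<in> W" "norm w = 1" and
    max: "\<And>u. u \<in> W \<Longrightarrow> norm u = 1 \<Longrightarrow> ?f u \<le> ?f w"
    by auto
  define l where "l = ?f w"
  have bound: "?f u \<le> l * (norm u)\<^sup>2" if "u \<in> W" for u
  proof (cases "u = 0")
    case False
    have "?f (u /\<^sub>R norm u) \<le> l"
      unfolding l_def using that False sub by (intro max) (auto simp: subspace_mul)
    moreover have "?f (u /\<^sub>R norm u) = ?f u / (norm u)\<^sup>2"
      by (simp add: linear_cmul[OF lin] power2_eq_square divide_inverse)
    ultimately have "?f u / (norm u)\<^sup>2 \<le> l"
      by simp
    then show ?thesis
      using False by (simp add: pos_divide_le_eq)
  qed simp
  define z where "z = A *v w - l *\<^sub>R w"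
  have z: "z \<in> W"
    unfolding z_def using w sub inv by (intro subspace_diff subspace_mul) auto
  define C where "C = l * (norm z)\<^sup>2 - ?f z"
  \<comment> \<open>First variation at the maximum: moving from w to w + e z changes the two sides
    by 2 e |z|^2 to first order and by multiples of e^2 otherwise. For z nonzero the value e = |z|^2
    / C then gives a contradiction.\<close>
  have key: "2 * e * (norm z)\<^sup>2 \<le> e\<^sup>2 * C" for e :: real
  proof -
    have "w + e *\<^sub>R z \<in> W"
      using w z sub by (simp add: subspace_add subspace_mul)
    from bound[OF this]
    have 1: "?f (w + e *\<^sub>R z) \<le> l * (norm (w + e *\<^sub>R z))\<^sup>2" .
    have sym: "inner w (A *v z) = inner z (A *v w)"
      by (metis herm inner_commute inner_matrix_vector)
    have 2: "?f (w + e *\<^sub>R z) = l + 2 * e * inner z (A *v w) + e\<^sup>2 * ?f z"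
      by (simp add: linear_add[OF lin] linear_cmul[OF lin] inner_add_left inner_add_right sym l_def
        power2_eq_square algebra_simps)
    have 3: "(norm (w + e *\<^sub>R z))\<^sup>2 = 1 + 2 * e * inner z w + e\<^sup>2 * (norm z)\<^sup>2"
      using w(2) by (simp add: power2_norm_eq_inner[of "w + _"] inner_add_left inner_add_right
        inner_commute[of w z] power2_eq_square[of e] power2_norm_eq_inner[of z] norm_eq_1 algebra_simps)
    have 4: "(norm z)\<^sup>2 = inner z (A *v w) - l * inner z w"
      unfolding power2_norm_eq_inner
      by (subst (2) z_def) (simp add: inner_diff_right)
    show ?thesis
      using 1 unfolding 2 3 C_def 4 by (simp add: algebra_simps)
  qed
  have "(norm z)\<^sup>2 = 0"
  proof (rule ccontr)
    assume "(norm z)\<^sup>2 \<noteq> 0"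
    then have p: "(norm z)\<^sup>2 > 0"
      by simp
    have C: "C > 0"
      using key[of 1] p by (simp only: power2_eq_square)
    have "2 * ((norm z)\<^sup>2 / C) * (norm z)\<^sup>2 \<le> ((norm z)\<^sup>2 / C)\<^sup>2 * C"
      by (rule key)
    then have "2 * (norm z)\<^sup>2 * (norm z)\<^sup>2 \<le> (norm z)\<^sup>2 * (norm z)\<^sup>2"
      using C by (simp add: power2_eq_square field_simps)
    moreover have "(norm z)\<^sup>2 * (norm z)\<^sup>2 > 0"
      using p by simp
    ultimately show False
      by linarith
  qed
  then have "A *v w = l *\<^sub>R w"
    by (simp add: z_def)
  then show ?thesis
    using w by (intro exI[of _ "complex_of_real l"] exI[of _ w]) (auto simp: scaleR_eq_smult)
qed

lemma hermitian_eigenspace: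
  fixes A :: "complex^'n^'n"
  assumes W: "csubspace W" and ne: "W \<noteq> {0}" and herm: "conj_transpose A = A"
    and inv: "\<And>w. w \<in> W \<Longrightarrow> A *v w \<in> W"
  obtains c where "csubspace {w\<in>W. A *v w = c *s w}" "{w\<in>W. A *v w = c *s w} \<noteq> {0}"
proof -
  obtain c w where *: "w \<in> W" "w \<noteq> 0" "A *v w = c *s w"
    using hermitian_eigenvector[OF assms] by blast
  have "csubspace {w\<in>W. A *v w = c *s w}"
    using W unfolding csubspace_def
    by (auto simp: matrix_vector_right_distrib matrix_vector_smult vec_eq_iff algebra_simps)
  then show ?thesis
    using * that by blast
qed

text \<open>On a nonzero invariant subspace of minimal dimension every member of the family is a
  scalar. Each matrix is a combination of two Hermitian ones, and these inherit commutation and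
  invariance because the family contains adjoints.\<close>

lemma common_eigenvector:
  fixes \<A> :: "(complex^'n^'n) set"
  assumes W: "csubspace W" "W \<noteq> {0}"
    and inv: "\<And>A w. A \<in> \<A> \<Longrightarrow> w \<in> W \<Longrightarrow> A *v w \<in> W"
    and comm: "\<And>A B. A \<in> \<A> \<Longrightarrow> B \<in> \<A> \<Longrightarrow> A ** B = B ** A"
    and adj: "\<And>A. A \<in> \<A> \<Longrightarrow> conj_transpose A \<in> \<A>"
  shows "\<exists>w\<in>W. w \<noteq> 0 \<and> (\<forall>A\<in>\<A>. \<exists>c. A *v w = c *s w)"
proof -
  define good where "good X \<longleftrightarrow> csubspace X \<and> X \<noteq> {0} \<and> X \<subseteq> W \<and> (\<forall>A\<in>\<A>. \<forall>w\<in>X. A *v w \<in> X)" for X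
  have "good W"
    using W inv by (auto simp: good_def)
  then obtain X where X: "good X" and min: "\<And>Y. good Y \<Longrightarrow> dim X \<le> dim Y"
    using ex_has_least_nat[of good W dim] by blast
  have X': "csubspace X" "X \<noteq> {0}" "X \<subseteq> W" "\<And>A w. A \<in> \<A> \<Longrightarrow> w \<in> X \<Longrightarrow> A *v w \<in> X"
    using X by (auto simp: good_def)
  \<comment> \<open>Commutation makes the eigenspace of H inside X invariant under the family, so
    minimality forces it to be all of X.\<close>
  have scal: "\<exists>c. \<forall>w\<in>X. H *v w = c *s w"
    if herm: "conj_transpose H = H" and HX: "\<And>w. w \<in> X \<Longrightarrow> H *v w \<in> X"
      and com: "\<And>A. A \<in> \<A> \<Longrightarrow> A ** H = H ** A" for H
  proof -
    obtain c where c: "csubspace {w\<in>X. H *v w = c *s w}" "{w\<in>X. H *v w = c *s w} \<noteq> {0}"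
      using hermitian_eigenspace[OF X'(1,2) herm HX] by blast
    have "H *v (A *v w) = c *s (A *v w)" if "A \<in> \<A>" "H *v w = c *s w" for A w
      using com[OF that(1)] that(2) by (metis matrix_vector_mul_assoc matrix_vector_smult)
    then have "good {w\<in>X. H *v w = c *s w}"
      using c X' by (auto simp: good_def)
    then have "dim X \<le> dim {w\<in>X. H *v w = c *s w}"
      by (rule min)
    then have "{w\<in>X. H *v w = c *s w} = X"
      by (intro subspace_dim_equal csubspace_imp_subspace c X') auto
    then show ?thesis
      by blast
  qed
  have sc: "\<exists>c. \<forall>w\<in>X. A *v w = c *s w" if A: "A \<in> \<A>" for A
  proof -
    let ?A = "conj_transpose A"
    let ?K = "\<chi> i j. \<i> * (A $ i $ j - ?A $ i $ j)"
    have 1: "(A + ?A) *v w = A *v w + ?A *v w" for w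
      by (simp add: matrix_vector_mult_add_rdistrib)
    have 2: "?K *v w = \<i> *s (A *v w) + (-\<i>) *s (?A *v w)" for w
      by (simp add: vec_eq_iff matrix_vector_mult_def sum_distrib_left sum_subtractf algebra_simps)
    have 3: "B ** (A + ?A) = B ** A + B ** ?A" "(A + ?A) ** B = A ** B + ?A ** B" for B
      by (simp_all add: matrix_add_ldistrib vec_eq_iff matrix_matrix_mult_def sum.distrib algebra_simps)
    have 4: "B ** ?K = (\<chi> i j. \<i> * ((B ** A) $ i $ j - (B ** ?A) $ i $ j))"
       "?K ** B = (\<chi> i j. \<i> * ((A ** B) $ i $ j - (?A ** B) $ i $ j))" for B
      by (simp_all add: vec_eq_iff matrix_matrix_mult_def sum_distrib_left sum_subtractf algebra_simps)
    have "\<exists>c. \<forall>w\<in>X. (A + ?A) *v w = c *s w"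
    proof (rule scal)
      show "conj_transpose (A + ?A) = A + ?A"
        by (simp add: vec_eq_iff)
      show "(A + ?A) *v w \<in> X" if "w \<in> X" for w
        unfolding 1 using X'(1) X'(4)[OF A that] X'(4)[OF adj[OF A] that] by (simp add: csubspace_def)
      show "B ** (A + ?A) = (A + ?A) ** B" if "B \<in> \<A>" for B
        unfolding 3 using comm[OF that A] comm[OF that adj[OF A]] by simp
    qed
    then obtain c where c: "\<And>w. w \<in> X \<Longrightarrow> A *v w + ?A *v w = c *s w"
      unfolding 1 by blast
    have "\<exists>c. \<forall>w\<in>X. ?K *v w = c *s w"
    proof (rule scal)
      show "conj_transpose ?K = ?K"
        by (simp add: vec_eq_iff algebra_simps)
      show "?K *v w \<in> X" if "w \<in> X" for w
        unfolding 2 using X'(1) X'(4)[OF A that] X'(4)[OF adj[OF A] that] unfolding csubspace_def by blast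
      show "B ** ?K = ?K ** B" if "B \<in> \<A>" for B
        unfolding 4 using comm[OF that A] comm[OF that adj[OF A]] by simp
    qed
    then obtain d where d: "\<And>w. w \<in> X \<Longrightarrow> \<i> *s (A *v w) + (-\<i>) *s (?A *v w) = d *s w"
      unfolding 2 by blast
    have "A *v w = ((c - \<i> * d) / 2) *s w" if "w \<in> X" for w
    proof -
      have "(A *v w) $ i = ((c - \<i> * d) / 2) * w $ i" for i
      proof -
        have a: "(A *v w) $ i + (?A *v w) $ i = c * w $ i"
          using c[OF that] by (metis vector_add_component vector_smult_component)
        have b: "\<i> * ((A *v w) $ i - (?A *v w) $ i) = d * w $ i"
          using arg_cong[OF d[OF that], of "\<lambda>v. v $ i"] by (simp add: algebra_simps)
        have "\<i> * (\<i> * ((A *v w) $ i - (?A *v w) $ i)) = \<i> * (d * w $ i)"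
          by (simp only: b)
        then have "- ((A *v w) $ i - (?A *v w) $ i) = \<i> * (d * w $ i)"
          by (simp flip: mult.assoc)
        then show ?thesis
          using a by (simp add: field_simps)
      qed
      then show ?thesis
        by (simp add: vec_eq_iff)
    qed
    then show ?thesis
      by blast
  qed
  obtain w where "w \<in> X" "w \<noteq> 0"
    using X'(1,2) by (auto simp: csubspace_def)
  then show ?thesis
    using sc X'(3) by blast
qed

text \<open>Take an orthonormal system of common eigenvectors that is as large as possible. Its
  orthogonal complement is invariant, again by closure under adjoints, so a nonzero complement would
  contribute one more vector.\<close>

lemma simultaneous_diagonalization:
  fixes \<A> :: "(complex^'n^'n) set"
  assumes comm: "\<And>A B. A \<in> \<A> \<Longrightarrow> B \<in> \<A> \<Longrightarrow> A ** B = B ** A"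
    and adj: "\<And>A. A \<in> \<A> \<Longrightarrow> conj_transpose A \<in> \<A>"
  obtains U where "U \<in> unitary_group"
    "\<And>A i j. A \<in> \<A> \<Longrightarrow> i \<noteq> j \<Longrightarrow> (U ** A ** conj_transpose U) $ i $ j = 0"
proof -
  define cip :: "complex^'n \<Rightarrow> complex^'n \<Rightarrow> complex" where "cip u v = (\<Sum>i\<in>UNIV. cnj (u $ i) * v $ i)" for u v
  have cip_add: "cip u (v + w) = cip u v + cip u w" for u v w
    by (simp add: cip_def algebra_simps sum.distrib)
  have cip_smult: "cip u (c *s v) = c * cip u v" for u c v
    by (simp add: cip_def algebra_simps sum_distrib_left)
  have cip_smult_left: "cip (c *s u) v = cnj c * cip u v" for u c v
    by (simp add: cip_def algebra_simps sum_distrib_left)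
  have cip_cnj: "cnj (cip u v) = cip v u" for u v
    by (simp add: cip_def mult.commute)
  have cip_adj: "cip u (A *v v) = cip (conj_transpose A *v u) v" for u v A
    unfolding cip_def by (rule sum_cnj_matrix_vector)
  have cip_self: "cip u u = complex_of_real ((norm u)\<^sup>2)" for u
    by (simp add: cip_def norm_vec_def L2_set_def real_sqrt_pow2 sum_nonneg complex_norm_square mult.commute
        del: of_real_power)
  define frame where "frame I e \<longleftrightarrow> (\<forall>i\<in>I. \<forall>j\<in>I. cip (e i) (e j) = (if i = j then 1 else 0)) \<and>
     (\<forall>i\<in>I. \<forall>A\<in>\<A>. \<exists>c. A *v e i = c *s e i)" for I :: "'n set" and e
  have "\<exists>e. frame {} e"
    by (simp add: frame_def)
  then obtain I where I: "\<exists>e. frame I e" and max: "\<And>J. \<exists>e. frame J e \<Longrightarrow> card J \<le> card I"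
    using ex_has_greatest_nat[of "\<lambda>I. \<exists>e. frame I e" "{}" card "Suc CARD('n)"]
      le_imp_less_Suc[OF card_mono[OF finite_class.finite_UNIV subset_UNIV]] by blast
  obtain e where e: "frame I e"
    using I by blast
  have "I = UNIV"
  proof (rule ccontr)
    assume "I \<noteq> UNIV"
    then obtain k where k: "k \<notin> I"
      by blast
    define W where "W = {v. \<forall>i\<in>I. cip (e i) v = 0}"
    have cip0: "cip u 0 = 0" for u
      by (simp add: cip_def)
    have W: "csubspace W"
      unfolding csubspace_def W_def by (auto simp: cip_add cip_smult cip0)
    \<comment> \<open>The kernel of this map is W. Its k-th coordinate is always 0, so it is not
      surjective, hence not injective, and W is nonzero.\<close>
    let ?F = "\<lambda>v. (\<chi> i. if i \<in> I then cip (e i) v else 0) :: complex^'n"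
    have linF: "linear ?F"
      by (rule linearI) (auto simp: vec_eq_iff cip_add scaleR_eq_smult cip_smult)
    have "\<not> surj ?F"
    proof
      assume "surj ?F"
      then obtain v where "axis k 1 = ?F v"
        unfolding surj_def by blast
      then have "axis k 1 $ k = ?F v $ k"
        by (rule arg_cong)
      then show False
        using k by (simp add: axis_def)
    qed
    then have "\<not> inj ?F"
      using linear_injective_imp_surjective[OF linF] by blast
    then obtain v where v: "v \<noteq> 0" "?F v = 0"
      using linear_injective_0[OF linF] by blast
    have "cip (e i) v = 0" if "i \<in> I" for i
      using arg_cong[OF v(2), of "\<lambda>x. x $ i"] that by simp
    then have "W \<noteq> {0}"
      using v by (auto simp: W_def)
    moreover have "A *v w \<in> W" if A: "A \<in> \<A>" and w: "w \<in> W" for A w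
    proof -
      have "cip (e i) (A *v w) = 0" if i: "i \<in> I" for i
      proof -
        obtain c where "conj_transpose A *v e i = c *s e i"
          using e i adj[OF A] unfolding frame_def by blast
        then show ?thesis
          using w i by (simp add: cip_adj cip_smult_left W_def)
      qed
      then show ?thesis
        by (simp add: W_def)
    qed
    ultimately obtain w where w: "w \<in> W" "w \<noteq> 0" "\<And>A. A \<in> \<A> \<Longrightarrow> \<exists>c. A *v w = c *s w"
      using common_eigenvector[of W \<A>] W comm adj by blast
    define u where "u = complex_of_real (1 / norm w) *s w"
    have uu: "cip u u = 1"
      using w(2) cip_self[of w] unfolding u_def cip_smult cip_smult_left by (simp add: power2_eq_square)
    have eu: "cip (e i) u = 0" if "i \<in> I" for i
      using w(1) that by (simp add: u_def cip_smult W_def)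
    have ue: "cip u (e i) = 0" if "i \<in> I" for i
      using eu[OF that] cip_cnj[of "e i" u] by simp
    have eig: "\<exists>c. A *v u = c *s u" if "A \<in> \<A>" for A
      using w(3)[OF that] by (auto simp: u_def matrix_vector_smult vec_eq_iff)
    have "frame (insert k I) (e(k := u))"
      unfolding frame_def
    proof (intro conjI ballI)
      fix i j assume "i \<in> insert k I" "j \<in> insert k I"
      then show "cip ((e(k := u)) i) ((e(k := u)) j) = (if i = j then 1 else 0)"
        using e k uu eu ue by (auto simp: frame_def)
    next
      fix i A assume "i \<in> insert k I" "A \<in> \<A>"
      then show "\<exists>c. A *v (e(k := u)) i = c *s (e(k := u)) i"
        using e eig by (auto simp: frame_def)
    qed
    then have "card (insert k I) \<le> card I"
      using max by blast
    then show False
      using k by simp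
  qed
  \<comment> \<open>The conjugate makes the vectors \<open>e j\<close> the columns of
    \<open>conj_transpose U\<close>.\<close>
  define U where "U = (\<chi> i j. cnj (e i $ j))"
  have UA: "(U ** A ** conj_transpose U) $ i $ j = cip (e i) (A *v e j)" for A i j
  proof -
    have "(U ** A ** conj_transpose U) $ i $ j = (\<Sum>k\<in>UNIV. \<Sum>l\<in>UNIV. U $ i $ l * A $ l $ k * e j $ k)"
      by (simp add: matrix_matrix_mult_def U_def sum_distrib_right)
    also have "\<dots> = (\<Sum>l\<in>UNIV. \<Sum>k\<in>UNIV. U $ i $ l * A $ l $ k * e j $ k)"
      by (rule sum.swap)
    finally show ?thesis
      by (simp add: cip_def matrix_vector_mult_def U_def sum_distrib_left mult.assoc)
  qed
  show ?thesis
  proof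
    have "(U ** conj_transpose U) $ i $ j = (mat 1) $ i $ j" for i j
      using UA[of "mat 1" i j] e \<open>I = UNIV\<close> by (simp add: frame_def) (simp add: mat_def)
    then show "U \<in> unitary_group"
      by (simp add: unitary_group_def vec_eq_iff)
    fix A and i j :: 'n assume A: "A \<in> \<A>" and "i \<noteq> j"
    obtain c where "A *v e j = c *s e j"
      using e \<open>I = UNIV\<close> A unfolding frame_def by blast
    then show "(U ** A ** conj_transpose U) $ i $ j = 0"
      using e \<open>I = UNIV\<close> \<open>i \<noteq> j\<close> by (simp add: UA cip_smult frame_def)
  qed
qed

section \<open>Schur's lemma\<close>

lemma matrix_eq_iff: "A = B \<longleftrightarrow> (\<forall>i j. A $ i $ j = B $ i $ j)"
  by (simp add: vec_eq_iff)

lemma matrix_mult_nth: "(A ** B) $ i $ j = (\<Sum>k\<in>UNIV. A $ i $ k * B $ k $ j)"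
  by (simp add: matrix_matrix_mult_def)

section \<open>Homomorphisms to the unitary group under conjugation\<close>

lemma Hom_U_unitary: "\<rho> \<in> Hom_U G \<Longrightarrow> x \<in> carrier G \<Longrightarrow> \<rho> x \<in> unitary_group"
  by (auto simp: Hom_U_def)

lemma Hom_U_mult:
  "\<rho> \<in> Hom_U G \<Longrightarrow> x \<in> carrier G \<Longrightarrow> y \<in> carrier G \<Longrightarrow> \<rho> (x \<otimes>\<^bsub>G\<^esub> y) = \<rho> x ** \<rho> y"
  by (auto simp: Hom_U_def)

lemma Hom_U_extensional: "\<rho> \<in> Hom_U G \<Longrightarrow> \<rho> \<in> extensional (carrier G)"
  by (auto simp: Hom_U_def PiE_def)

lemma unitary_cancel:
  fixes U :: "complex^'n^'n"
  assumes "U \<in> unitary_group"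
  shows "conj_transpose U ** (U ** A) = A" "U ** (conj_transpose U ** A) = A"
    "A ** U ** conj_transpose U = A" "A ** conj_transpose U ** U = A"
proof -
  show "conj_transpose U ** (U ** A) = A" "U ** (conj_transpose U ** A) = A"
    by (simp_all add: matrix_mul_assoc unitary_groupD[OF assms])
  show "A ** U ** conj_transpose U = A" "A ** conj_transpose U ** U = A"
    unfolding matrix_mul_assoc[symmetric] unitary_groupD[OF assms] by simp_all
qed

lemma Hom_U_one:
  assumes "group G" "\<rho> \<in> Hom_U G"
  shows "\<rho> \<one>\<^bsub>G\<^esub> = (mat 1 :: complex^'n^'n)"
proof -
  interpret group G by fact
  have "\<rho> \<one>\<^bsub>G\<^esub> = \<rho> \<one>\<^bsub>G\<^esub> ** \<rho> \<one>\<^bsub>G\<^esub>"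
    using Hom_U_mult[OF assms(2), of "\<one>\<^bsub>G\<^esub>" "\<one>\<^bsub>G\<^esub>"] by simp
  then have "\<rho> \<one>\<^bsub>G\<^esub> ** conj_transpose (\<rho> \<one>\<^bsub>G\<^esub>) = \<rho> \<one>\<^bsub>G\<^esub> ** \<rho> \<one>\<^bsub>G\<^esub> ** conj_transpose (\<rho> \<one>\<^bsub>G\<^esub>)"
    by simp
  moreover have "\<rho> \<one>\<^bsub>G\<^esub> \<in> unitary_group"
    using assms by (auto intro: Hom_U_unitary)
  ultimately show ?thesis
    by (metis unitary_cancel(3) unitary_groupD(1))
qed

lemma Hom_U_inv:
  assumes "group G" "\<rho> \<in> Hom_U G" "x \<in> carrier G"
  shows "\<rho> (inv\<^bsub>G\<^esub> x) = conj_transpose (\<rho> x :: complex^'n^'n)"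
proof -
  interpret group G by fact
  have "\<rho> (inv\<^bsub>G\<^esub> x) ** \<rho> x = mat 1"
    using assms Hom_U_mult[OF assms(2), of "inv\<^bsub>G\<^esub> x" x] Hom_U_one[OF assms(1,2)] by simp
  then show ?thesis
    by (metis assms(2,3) Hom_U_unitary unitary_cancel(3) matrix_mul_lid)
qed

lemma conj_rep_apply: "x \<in> carrier G \<Longrightarrow> conj_rep G U \<rho> x = U ** \<rho> x ** conj_transpose U"
  by (simp add: conj_rep_def)

lemma conj_rep_Hom_U:
  fixes \<rho> :: "'g \<Rightarrow> complex^'n^'n"
  assumes "group G" and \<rho>: "\<rho> \<in> Hom_U G" and U: "U \<in> unitary_group"
  shows "conj_rep G U \<rho> \<in> Hom_U G"
proof -
  interpret group G by fact
  have "U ** (\<rho> x ** \<rho> y) ** conj_transpose U = U ** \<rho> x ** conj_transpose U ** (U ** \<rho> y ** conj_transpose U)" for x y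
    using unitary_cancel(4)[OF U] by (simp add: matrix_mul_assoc)
  then show ?thesis
    using U Hom_U_unitary[OF \<rho>] Hom_U_mult[OF \<rho>]
    by (auto simp: Hom_U_def conj_rep_def intro!: mult_unitary)
qed

lemma conj_rep_conj_rep:
  "conj_rep G V (conj_rep G U \<rho>) = conj_rep G (V ** U) \<rho>"
  by (simp add: conj_rep_def fun_eq_iff conj_transpose_mult matrix_mul_assoc)

lemma conj_rep_mat1: "\<rho> \<in> Hom_U G \<Longrightarrow> conj_rep G (mat 1) \<rho> = \<rho>"
  using Hom_U_extensional[of \<rho> G] by (auto simp: conj_rep_def extensional_def fun_eq_iff)

lemma rep_orbit_conj_rep:
  fixes \<rho> :: "'g \<Rightarrow> complex^'n^'n"
  assumes U: "U \<in> unitary_group"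
  shows "rep_orbit G (conj_rep G U \<rho>) = rep_orbit G \<rho>"
proof -
  have "conj_rep G V \<rho> \<in> rep_orbit G (conj_rep G U \<rho>)" if "V \<in> unitary_group" for V
    using U that unitary_cancel(4)[OF U, of V]
    by (auto simp: rep_orbit_def conj_rep_conj_rep image_iff
        intro!: bexI[of _ "V ** conj_transpose U"] mult_unitary)
  then show ?thesis
    using U mult_unitary by (auto simp: rep_orbit_def conj_rep_conj_rep)
qed

lemma rep_orbit_eqD:
  fixes \<rho> \<rho>' :: "'g \<Rightarrow> complex^'n^'n"
  assumes "rep_orbit G \<rho> = rep_orbit G \<rho>'" "\<rho>' \<in> Hom_U G"
  obtains U where "U \<in> unitary_group" "\<rho>' = conj_rep G U \<rho>"
proof -
  have "\<rho>' \<in> rep_orbit G \<rho>'"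
    unfolding rep_orbit_def using conj_rep_mat1[OF assms(2)] by (metis image_eqI mat1_unitary)
  then have "\<rho>' \<in> rep_orbit G \<rho>"
    by (simp only: assms(1))
  then show ?thesis
    unfolding rep_orbit_def by (rule imageE) (use that in blast)
qed

lemma reducible_rep_conj_rep:
  fixes \<rho> :: "'g \<Rightarrow> complex^'n^'n"
  assumes U: "U \<in> unitary_group"
  shows "reducible_rep G (conj_rep G U \<rho>) \<longleftrightarrow> reducible_rep G \<rho>"
proof
  assume "reducible_rep G (conj_rep G U \<rho>)"
  then show "reducible_rep G \<rho>"
    unfolding reducible_rep_def conj_rep_conj_rep using mult_unitary[OF _ U] by blast
next
  assume "reducible_rep G \<rho>"
  then obtain V S where V: "V \<in> unitary_group" "S \<noteq> {}" "S \<noteq> UNIV"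
    "\<forall>\<gamma>\<in>carrier G. \<forall>i j. (i \<in> S \<longleftrightarrow> j \<notin> S) \<longrightarrow> conj_rep G V \<rho> \<gamma> $ i $ j = 0"
    unfolding reducible_rep_def by blast
  then show "reducible_rep G (conj_rep G U \<rho>)"
    unfolding reducible_rep_def conj_rep_conj_rep
    using U unitary_cancel(4)[OF U, of V]
    by (intro bexI[of _ "V ** conj_transpose U"] exI[of _ S]) (auto intro: mult_unitary)
qed

lemma reducible_repI_blocks:
  assumes "\<rho> \<in> Hom_U G" "S \<noteq> {}" "S \<noteq> UNIV"
    and "\<And>\<gamma> i j. \<gamma> \<in> carrier G \<Longrightarrow> i \<in> S \<longleftrightarrow> j \<notin> S \<Longrightarrow> \<rho> \<gamma> $ i $ j = 0"
  shows "reducible_rep G \<rho>"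
  unfolding reducible_rep_def
proof (intro bexI[of _ "mat 1"] exI[of _ S] conjI ballI allI impI)
  fix \<gamma> i j assume "\<gamma> \<in> carrier G" "i \<in> S \<longleftrightarrow> j \<notin> S"
  then show "conj_rep G (mat 1) \<rho> \<gamma> $ i $ j = 0"
    unfolding conj_rep_mat1[OF assms(1)] by (rule assms(4))
qed (use assms in simp_all)

lemma conj_unitary_eq_iff:
  fixes U :: "complex^'n^'n"
  assumes U: "U \<in> unitary_group"
  shows "U ** A ** conj_transpose U = B \<longleftrightarrow> A = conj_transpose U ** B ** U"
proof -
  have "conj_transpose U ** (U ** A ** conj_transpose U) ** U = A"
    by (simp add: matrix_mul_assoc unitary_groupD[OF U]) (simp add: unitary_groupD[OF U] flip: matrix_mul_assoc)
  moreover have "U ** (conj_transpose U ** B ** U) ** conj_transpose U = B"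
    by (simp add: matrix_mul_assoc unitary_groupD[OF U]) (simp add: unitary_groupD[OF U] flip: matrix_mul_assoc)
  ultimately show ?thesis
    by auto
qed

lemma mat_mult_commute: "mat c ** A = A ** mat c" for A :: "complex^'n^'n"
proof -
  have "(\<Sum>k\<in>UNIV. (if i = k then c else 0) * A $ k $ j) = c * A $ i $ j" for i j
    by (subst sum.remove[of _ i]) auto
  moreover have "(\<Sum>k\<in>UNIV. A $ i $ k * (if k = j then c else 0)) = c * A $ i $ j" for i j
    by (subst sum.remove[of _ j]) auto
  ultimately show ?thesis
    by (simp add: matrix_eq_iff matrix_mult_nth mat_def)
qed

lemma diagonal_mult:
  fixes D A :: "complex^'n^'n"
  assumes "\<And>i j. i \<noteq> j \<Longrightarrow> D $ i $ j = 0"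
  shows "(D ** A) $ i $ j = D $ i $ i * A $ i $ j" "(A ** D) $ i $ j = A $ i $ j * D $ j $ j"
proof -
  show "(D ** A) $ i $ j = D $ i $ i * A $ i $ j"
    unfolding matrix_mult_nth using assms by (subst sum.remove[of _ i]) auto
  show "(A ** D) $ i $ j = A $ i $ j * D $ j $ j"
    unfolding matrix_mult_nth using assms by (subst sum.remove[of _ j]) auto
qed

text \<open>In a basis diagonalizing B, commutation kills every matrix entry that links two
  different eigenvalues of B. One eigenspace is therefore a block, and irreducibility makes it
  everything.\<close>

lemma schur_hermitian:
  fixes \<rho> :: "'g \<Rightarrow> complex^'n^'n"
  assumes irr: "\<not> reducible_rep G \<rho>" and herm: "conj_transpose B = B"
    and comm: "\<And>\<gamma>. \<gamma> \<in> carrier G \<Longrightarrow> B ** \<rho> \<gamma> = \<rho> \<gamma> ** B"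
  shows "\<exists>c. B = mat c"
proof -
  obtain U where U: "U \<in> unitary_group" and diag: "\<And>i j. i \<noteq> j \<Longrightarrow> (U ** B ** conj_transpose U) $ i $ j = 0"
    using simultaneous_diagonalization[of "{B}"] herm by (metis singleton_iff)
  define D where "D = U ** B ** conj_transpose U"
  note diag = diag[folded D_def]
  \<comment> \<open>Any index will do; its eigenvalue selects the block S, which is nonempty because
    it contains this index.\<close>
  let ?i = "undefined :: 'n"
  define S where "S = {i. D $ i $ i = D $ ?i $ ?i}"
  have "conj_rep G U \<rho> \<gamma> $ i $ j = 0" if \<gamma>: "\<gamma> \<in> carrier G" and ij: "i \<in> S \<longleftrightarrow> j \<notin> S" for \<gamma> i j
  proof -
    have "D ** conj_rep G U \<rho> \<gamma> = U ** (B ** \<rho> \<gamma>) ** conj_transpose U"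
      unfolding D_def conj_rep_apply[OF \<gamma>] using unitary_cancel(4)[OF U] by (simp add: matrix_mul_assoc)
    also have "\<dots> = conj_rep G U \<rho> \<gamma> ** D"
      unfolding D_def conj_rep_apply[OF \<gamma>] comm[OF \<gamma>] using unitary_cancel(4)[OF U] by (simp add: matrix_mul_assoc)
    finally have "D $ i $ i * conj_rep G U \<rho> \<gamma> $ i $ j = conj_rep G U \<rho> \<gamma> $ i $ j * D $ j $ j"
      by (metis diagonal_mult diag)
    moreover have "D $ i $ i \<noteq> D $ j $ j"
      using ij by (auto simp: S_def)
    ultimately show ?thesis
      by simp
  qed
  moreover have "S \<noteq> {}"
    by (auto simp: S_def)
  ultimately have "S = UNIV"
    using irr U unfolding reducible_rep_def by blast
  then have "D = mat (D $ ?i $ ?i)"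
    using diag by (auto simp: matrix_eq_iff mat_def S_def)
  then have "B = mat (D $ ?i $ ?i) ** (conj_transpose U ** U)"
    using conj_unitary_eq_iff[OF U, of B D] D_def
    by (metis mat_mult_commute matrix_mul_assoc)
  then show ?thesis
    using unitary_groupD(2)[OF U] by auto
qed

text \<open>The orthogonal projection onto a block is Hermitian, commutes with the representation
  and is not scalar. Only Hermitian B need to be tested, which matches what
  \<open>schur_hermitian\<close> provides.\<close>

lemma irreducibleI:
  fixes \<rho> :: "'g \<Rightarrow> complex^'n^'n"
  assumes "\<And>B. conj_transpose B = B \<Longrightarrow> (\<And>\<gamma>. \<gamma> \<in> carrier G \<Longrightarrow> B ** \<rho> \<gamma> = \<rho> \<gamma> ** B) \<Longrightarrow> \<exists>c. B = mat c"
  shows "\<not> reducible_rep G \<rho>"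
proof
  assume "reducible_rep G \<rho>"
  then obtain U S where U: "U \<in> unitary_group" and S: "S \<noteq> {}" "S \<noteq> UNIV" and
    zero: "\<And>\<gamma> i j. \<gamma>\<in>carrier G \<Longrightarrow> (i \<in> S \<longleftrightarrow> j \<notin> S) \<Longrightarrow> conj_rep G U \<rho> \<gamma> $ i $ j = 0"
    unfolding reducible_rep_def by blast
  define D :: "complex^'n^'n" where "D = (\<chi> i j. if i = j \<and> i \<in> S then 1 else 0)"
  define B where "B = conj_transpose U ** D ** U"
  have D: "conj_transpose D = D"
    by (simp add: D_def matrix_eq_iff)
  have UB: "U ** B ** conj_transpose U = D"
    using conj_unitary_eq_iff[OF U] B_def by blast
  have "\<exists>c. B = mat c"
  proof (rule assms)
    show "conj_transpose B = B"
      by (simp add: B_def conj_transpose_mult D matrix_mul_assoc)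
    fix \<gamma> assume \<gamma>: "\<gamma> \<in> carrier G"
    define R where "R = conj_rep G U \<rho> \<gamma>"
    have R: "\<rho> \<gamma> = conj_transpose U ** R ** U"
      using conj_unitary_eq_iff[OF U] conj_rep_apply[OF \<gamma>] R_def by metis
    have DR: "D ** R = R ** D"
      unfolding matrix_eq_iff
    proof (intro allI)
      fix i j
      have "\<And>i j. i \<noteq> j \<Longrightarrow> D $ i $ j = 0"
        by (simp add: D_def)
      then show "(D ** R) $ i $ j = (R ** D) $ i $ j"
        using zero[OF \<gamma>, of i j] by (simp add: diagonal_mult R_def) (auto simp: D_def)
    qed
    have "B ** \<rho> \<gamma> = conj_transpose U ** (D ** R) ** U"
      unfolding B_def R using unitary_cancel(3)[OF U] by (simp add: matrix_mul_assoc)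
    also have "\<dots> = \<rho> \<gamma> ** B"
      unfolding B_def R DR using unitary_cancel(3)[OF U] by (simp add: matrix_mul_assoc)
    finally show "B ** \<rho> \<gamma> = \<rho> \<gamma> ** B" .
  qed
  then obtain c where c: "B = mat c"
    by blast
  have "D = mat c ** (U ** conj_transpose U)"
    using UB unfolding c by (simp add: matrix_mul_assoc mat_mult_commute)
  then have "D = mat c"
    using unitary_groupD(1)[OF U] by simp
  then have "D $ i $ i = c" for i
    by (simp add: mat_def)
  then have "(if i \<in> S then 1 else 0) = c" for i
    by (simp add: D_def)
  then show False
    using S by (metis UNIV_eq_I equals0I zero_neq_one)
qed

text \<open>Taking adjoints of the intertwining relation shows that A* A commutes with \<rho>', so
  it is a scalar by Schur. A nonzero intertwiner is thus a positive multiple of a unitary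
  matrix.\<close>

lemma schur_conjugate:
  fixes \<rho> \<rho>' :: "'g \<Rightarrow> complex^'n^'n"
  assumes irr: "\<not> reducible_rep G \<rho>'" and \<rho>: "\<rho> \<in> Hom_U G" and \<rho>': "\<rho>' \<in> Hom_U G"
    and A: "A \<noteq> 0" and comm: "\<And>\<gamma>. \<gamma> \<in> carrier G \<Longrightarrow> \<rho> \<gamma> ** A = A ** \<rho>' \<gamma>"
  shows "\<exists>U\<in>unitary_group. \<rho> = conj_rep G U \<rho>'"
proof -
  have comm': "\<rho>' \<gamma> ** conj_transpose A = conj_transpose A ** \<rho> \<gamma>" if \<gamma>: "\<gamma> \<in> carrier G" for \<gamma>
  proof -
    have u: "\<rho> \<gamma> \<in> unitary_group" "\<rho>' \<gamma> \<in> unitary_group"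
      using Hom_U_unitary[OF \<rho> \<gamma>] Hom_U_unitary[OF \<rho>' \<gamma>] .
    have "conj_transpose (A ** \<rho>' \<gamma>) = conj_transpose (\<rho> \<gamma> ** A)"
      using comm[OF \<gamma>] by simp
    then have "conj_transpose (\<rho>' \<gamma>) ** conj_transpose A = conj_transpose A ** conj_transpose (\<rho> \<gamma>)"
      by (simp add: conj_transpose_mult)
    then show ?thesis
      using unitary_cancel[OF u(1)] unitary_cancel[OF u(2)] by (metis matrix_mul_assoc)
  qed
  have "\<exists>c. conj_transpose A ** A = mat c"
  proof (rule schur_hermitian[OF irr])
    show "conj_transpose (conj_transpose A ** A) = conj_transpose A ** A"
      by (simp add: conj_transpose_mult)
    show "conj_transpose A ** A ** \<rho>' \<gamma> = \<rho>' \<gamma> ** (conj_transpose A ** A)" if "\<gamma> \<in> carrier G" for \<gamma>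
      using comm[OF that] comm'[OF that] by (metis matrix_mul_assoc)
  qed
  then obtain c where c: "conj_transpose A ** A = mat c"
    by blast
  \<comment> \<open>The diagonal entries of A* A are the squared column norms, so all columns have
    the same norm; it is positive because some entry of A is nonzero.\<close>
  have c_eq: "c = complex_of_real (\<Sum>k\<in>UNIV. (cmod (A $ k $ i))\<^sup>2)" for i
  proof -
    have "c = (conj_transpose A ** A) $ i $ i"
      by (simp add: c mat_def)
    also have "\<dots> = (\<Sum>k\<in>UNIV. A $ k $ i * cnj (A $ k $ i))"
      by (simp add: matrix_mult_nth mult.commute)
    finally show ?thesis
      by (simp only: complex_norm_square of_real_sum)
  qed
  obtain i j where ij: "A $ i $ j \<noteq> 0"
    using A by (auto simp: vec_eq_iff)
  define r where "r = (\<Sum>k\<in>UNIV. (cmod (A $ k $ j))\<^sup>2)"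
  have r: "c = complex_of_real r" "r > 0"
    using c_eq[of j] ij unfolding r_def by (auto intro!: sum_pos2[of _ i])
  define s where "s = 1 / sqrt r"
  have s: "s * s * r = 1"
    using r(2) by (simp add: s_def)
  define U where "U = (\<chi> i j. complex_of_real s * A $ i $ j)"
  have "(conj_transpose U ** U) $ i $ j = (mat 1) $ i $ j" for i j
  proof -
    have "(conj_transpose U ** U) $ i $ j = complex_of_real (s * s) * (conj_transpose A ** A) $ i $ j"
      by (simp add: U_def matrix_mult_nth sum_distrib_left mult_ac)
    also have "\<dots> = (if i = j then complex_of_real (s * s * r) else 0)"
      by (simp add: c mat_def r)
    finally show ?thesis
      by (simp add: s mat_def)
  qed
  then have "conj_transpose U ** U = mat 1"
    by (simp add: matrix_eq_iff)
  then have U: "U \<in> unitary_group"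
    using matrix_left_right_inverse[of U "conj_transpose U"] by (simp add: unitary_group_def)
  have "\<rho> \<gamma> = U ** \<rho>' \<gamma> ** conj_transpose U" if \<gamma>: "\<gamma> \<in> carrier G" for \<gamma>
  proof -
    have "(\<rho> \<gamma> ** U) $ i $ j = (U ** \<rho>' \<gamma>) $ i $ j" for i j
    proof -
      have "(\<rho> \<gamma> ** U) $ i $ j = complex_of_real s * (\<rho> \<gamma> ** A) $ i $ j"
        by (simp add: U_def matrix_mult_nth sum_distrib_left mult_ac)
      also have "\<dots> = complex_of_real s * (A ** \<rho>' \<gamma>) $ i $ j"
        by (simp add: comm[OF \<gamma>])
      also have "\<dots> = (U ** \<rho>' \<gamma>) $ i $ j"
        by (simp add: U_def matrix_mult_nth sum_distrib_left mult_ac)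
      finally show ?thesis .
    qed
    then have "\<rho> \<gamma> ** U = U ** \<rho>' \<gamma>"
      by (simp add: matrix_eq_iff)
    then show ?thesis
      by (metis unitary_cancel(3)[OF U])
  qed
  then have "\<rho> = conj_rep G U \<rho>'"
    using Hom_U_extensional[OF \<rho>] by (auto simp: conj_rep_def extensional_def fun_eq_iff)
  then show ?thesis
    using U by blast
qed

section \<open>Lattices of finite index\<close>

context group
begin

text \<open>Euclidean descent: an element on which the homomorphism \<open>q\<close> takes its least positive value
  generates \<open>N\<close> together with the kernel of \<open>q\<close>.\<close>
lemma subgroup_cyclic_over_kernel:
  fixes q :: "'a \<Rightarrow> int"
  assumes N: "subgroup N G" and q: "\<And>a b. a \<in> N \<Longrightarrow> b \<in> N \<Longrightarrow> q (a \<otimes> b) = q a + q b"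
  obtains a0 where "a0 \<in> N" "\<And>K. subgroup K G \<Longrightarrow> a0 \<in> K \<Longrightarrow> {a\<in>N. q a = 0} \<subseteq> K \<Longrightarrow> N \<subseteq> K"
proof (cases "\<exists>a\<in>N. q a \<noteq> 0")
  case False
  then show ?thesis
    using that[of \<one>] subgroup.one_closed[OF N] by blast
next
  case True
  interpret N: subgroup N G by (rule N)
  define P where "P n \<longleftrightarrow> (\<exists>a\<in>N. q a > 0 \<and> nat (q a) = n)" for n
  have q1: "q \<one> = 0"
    using q[of \<one> \<one>] by simp
  have qinv: "q (inv a) = - q a" if "a \<in> N" for a
    using q[of "inv a" a] that q1 by simp
  have "\<exists>n. P n"
  proof -
    obtain a where "a \<in> N" "q a \<noteq> 0"
      using True by blast
    then show ?thesis
      unfolding P_def using qinv[of a] by (metis N.m_inv_closed linorder_neqE_linordered_idom neg_0_less_iff_less)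
  qed
  then have "P (LEAST n. P n)"
    by (rule LeastI_ex)
  then obtain a0 where a0: "a0 \<in> N" "q a0 > 0" "nat (q a0) = (LEAST n. P n)"
    unfolding P_def by blast
  have least: "q a0 \<le> q a" if "a \<in> N" "q a > 0" for a
  proof -
    have "P (nat (q a))"
      unfolding P_def using that by blast
    then have "nat (q a0) \<le> nat (q a)"
      unfolding a0(3) by (rule Least_le)
    then show ?thesis
      using that by linarith
  qed
  show ?thesis
  proof (rule that[OF a0(1)])
    fix K assume K: "subgroup K G" and a0K: "a0 \<in> K" and ker: "{a\<in>N. q a = 0} \<subseteq> K"
    interpret K: subgroup K G by (rule K)
    have "a \<in> N \<longrightarrow> a \<in> K" for a
    proof (induction "nat \<bar>q a\<bar>" arbitrary: a rule: less_induct)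
      case less
      show ?case
      proof
        assume a: "a \<in> N"
        consider "q a = 0" | "q a > 0" | "q a < 0" by linarith
        then show "a \<in> K"
        proof cases
          case 1 then show ?thesis using a ker by blast
        next
          case 2
          have "q (a \<otimes> inv a0) = q a - q a0"
            using a a0 by (simp add: q qinv)
          then have "a \<otimes> inv a0 \<in> K"
            using less(1)[of "a \<otimes> inv a0"] least[OF a 2] a a0 2 by simp
          then have "a \<otimes> inv a0 \<otimes> a0 \<in> K"
            using a0K by blast
          then show ?thesis
            using a a0 by (simp add: m_assoc)
        next
          case 3
          have "q a0 \<le> - q a"
            using least[of "inv a"] a 3 qinv[OF a] by simp
          moreover have "q (a \<otimes> a0) = q a + q a0"
            using a a0 by (simp add: q)
          ultimately have "a \<otimes> a0 \<in> K"
            using less(1)[of "a \<otimes> a0"] a a0 3 by simp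
          then have "a \<otimes> a0 \<otimes> inv a0 \<in> K"
            using a0K by blast
          then show ?thesis
            using a a0 by (simp add: m_assoc)
        qed
      qed
    qed
    then show "N \<subseteq> K"
      by blast
  qed
qed

lemma subgroup_kernel:
  fixes q :: "'a \<Rightarrow> int"
  assumes N: "subgroup N G" and q: "\<And>a b. a \<in> N \<Longrightarrow> b \<in> N \<Longrightarrow> q (a \<otimes> b) = q a + q b"
  shows "subgroup {a\<in>N. q a = 0} G"
proof -
  interpret N: subgroup N G by (rule N)
  have q1: "q \<one> = 0"
    using q[of \<one> \<one>] by simp
  have qinv: "q (inv a) = - q a" if "a \<in> N" for a
    using q[of "inv a" a] that q1 by simp
  show ?thesis
    by unfold_locales (auto simp: q1 qinv q)
qed

text \<open>Induction on the number of coordinates: the kernel of the last coordinate is generated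
  by the induction hypothesis, and \<open>subgroup_cyclic_over_kernel\<close> adds one
  generator.\<close>

lemma lattice_finitely_generated:
  fixes p :: "'a \<Rightarrow> nat \<Rightarrow> int"
  assumes "subgroup N G"
    and "\<And>a b i. a \<in> N \<Longrightarrow> b \<in> N \<Longrightarrow> i < k \<Longrightarrow> p (a \<otimes> b) i = p a i + p b i"
    and "\<And>a. a \<in> N \<Longrightarrow> (\<And>i. i < k \<Longrightarrow> p a i = 0) \<Longrightarrow> a = \<one>"
  shows "\<exists>B. finite B \<and> B \<subseteq> N \<and> (\<forall>K. subgroup K G \<longrightarrow> B \<subseteq> K \<longrightarrow> N \<subseteq> K)"
  using assms
proof (induction k arbitrary: N)
  case 0
  then have "N \<subseteq> {\<one>}"
    by auto
  then show ?case
    by (intro exI[of _ "{}"]) (auto dest: subgroup.one_closed)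
next
  case (Suc k)
  let ?N = "{a\<in>N. p a k = 0}"
  have sub: "subgroup ?N G"
    using Suc.prems(2) by (intro subgroup_kernel Suc.prems(1)) auto
  have "\<exists>B. finite B \<and> B \<subseteq> ?N \<and> (\<forall>K. subgroup K G \<longrightarrow> B \<subseteq> K \<longrightarrow> ?N \<subseteq> K)"
  proof (rule Suc.IH[OF sub])
    fix a assume "a \<in> ?N" "\<And>i. i < k \<Longrightarrow> p a i = 0"
    then show "a = \<one>"
      using less_antisym by (intro Suc.prems(3)) blast+
  qed (use Suc.prems(2) in auto)
  then obtain B where B: "finite B" "B \<subseteq> ?N" "\<And>K. subgroup K G \<Longrightarrow> B \<subseteq> K \<Longrightarrow> ?N \<subseteq> K"
    by blast
  have "\<And>a b. a \<in> N \<Longrightarrow> b \<in> N \<Longrightarrow> p (a \<otimes> b) k = p a k + p b k"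
    using Suc.prems(2) by simp
  then obtain a0 where "a0 \<in> N"
    "\<And>K. subgroup K G \<Longrightarrow> a0 \<in> K \<Longrightarrow> ?N \<subseteq> K \<Longrightarrow> N \<subseteq> K"
    using subgroup_cyclic_over_kernel[OF Suc.prems(1), of "\<lambda>a. p a k"] by blast
  then show ?case
    using B by (intro exI[of _ "insert a0 B"]) (auto simp del: Collect_mono_iff)
qed

text \<open>Taking \<open>\<Lambda>\<close> to be the zero group or the group of integers, this describes the homomorphisms from
  a lattice to the reals and to the circle.\<close>
lemma lattice_hom_mod:
  fixes p :: "'a \<Rightarrow> nat \<Rightarrow> int" and h :: "'a \<Rightarrow> real"
  assumes "subgroup N G"
    and "\<And>a b i. a \<in> N \<Longrightarrow> b \<in> N \<Longrightarrow> i < k \<Longrightarrow> p (a \<otimes> b) i = p a i + p b i"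
    and "\<And>a. a \<in> N \<Longrightarrow> (\<And>i. i < k \<Longrightarrow> p a i = 0) \<Longrightarrow> a = \<one>"
    and \<Lambda>: "0 \<in> \<Lambda>" "\<And>s t. s \<in> \<Lambda> \<Longrightarrow> t \<in> \<Lambda> \<Longrightarrow> s + t \<in> \<Lambda>" "\<And>s. s \<in> \<Lambda> \<Longrightarrow> - s \<in> \<Lambda>"
    and "\<And>a b. a \<in> N \<Longrightarrow> b \<in> N \<Longrightarrow> h (a \<otimes> b) - h a - h b \<in> \<Lambda>"
  shows "\<exists>v. \<forall>a\<in>N. h a - (\<Sum>i<k. v i * real_of_int (p a i)) \<in> \<Lambda>"
  using assms(1-3,7)
proof (induction k arbitrary: N)
  case 0
  then have "N = {\<one>}"
    by (auto dest: subgroup.one_closed)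
  moreover from this have "- h \<one> \<in> \<Lambda>"
    using 0(4)[of \<one> \<one>] by simp
  then have "h \<one> \<in> \<Lambda>"
    using \<Lambda>(3) by fastforce
  ultimately show ?case
    by simp
next
  case (Suc k)
  interpret N: subgroup N G by (rule Suc.prems(1))
  let ?N = "{a\<in>N. p a k = 0}"
  have sub: "subgroup ?N G"
    using Suc.prems(2) by (intro subgroup_kernel Suc.prems(1)) auto
  have "\<exists>v. \<forall>a\<in>?N. h a - (\<Sum>i<k. v i * real_of_int (p a i)) \<in> \<Lambda>"
  proof (rule Suc.IH[OF sub])
    fix a assume "a \<in> ?N" "\<And>i. i < k \<Longrightarrow> p a i = 0"
    then show "a = \<one>"
      using less_antisym by (intro Suc.prems(3)) blast+
  qed (use Suc.prems(2,4) in auto)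
  then obtain v where v: "\<And>a. a \<in> ?N \<Longrightarrow> h a - (\<Sum>i<k. v i * real_of_int (p a i)) \<in> \<Lambda>"
    by blast
  have "\<And>a b. a \<in> N \<Longrightarrow> b \<in> N \<Longrightarrow> p (a \<otimes> b) k = p a k + p b k"
    using Suc.prems(2) by simp
  then obtain a0 where a0: "a0 \<in> N"
    "\<And>K. subgroup K G \<Longrightarrow> a0 \<in> K \<Longrightarrow> ?N \<subseteq> K \<Longrightarrow> N \<subseteq> K"
    using subgroup_cyclic_over_kernel[OF Suc.prems(1), of "\<lambda>a. p a k"] by blast
  \<comment> \<open>The new coefficient makes the remainder f vanish at a0. If a0 already lies in
    the kernel of the last coordinate, the division by 0 is harmless, since that coordinate then
    contributes nothing at a0.\<close>
  define c where "c = (h a0 - (\<Sum>i<k. v i * real_of_int (p a0 i))) / p a0 k"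
  define v' where "v' = v(k := c)"
  define f where "f a = h a - (\<Sum>i<Suc k. v' i * real_of_int (p a i))" for a
  have f_eq: "f a = h a - (\<Sum>i<k. v i * real_of_int (p a i)) - c * p a k" for a
    by (simp add: f_def v'_def)
  have f_mult: "f (a \<otimes> b) - f a - f b \<in> \<Lambda>" if "a \<in> N" "b \<in> N" for a b
  proof -
    have "(\<Sum>i<Suc k. v' i * p (a \<otimes> b) i) = (\<Sum>i<Suc k. v' i * real_of_int (p a i) + v' i * p b i)"
      using that Suc.prems(2) by (intro sum.cong) (auto simp: algebra_simps)
    then have "f (a \<otimes> b) - f a - f b = h (a \<otimes> b) - h a - h b"
      unfolding f_def by (simp add: sum.distrib)
    then show ?thesis
      using Suc.prems(4) that by simp
  qed
  have f_mult': "f (a \<otimes> b) \<in> \<Lambda>" if "a \<in> N" "b \<in> N" "f a \<in> \<Lambda>" "f b \<in> \<Lambda>" for a b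
    using \<Lambda>(2)[OF \<Lambda>(2)[OF f_mult[OF that(1,2)] that(3)] that(4)] by simp
  have f1: "f \<one> \<in> \<Lambda>"
    using \<Lambda>(3)[OF f_mult[of \<one> \<one>]] by simp
  have f_inv: "f (inv a) \<in> \<Lambda>" if "a \<in> N" "f a \<in> \<Lambda>" for a
  proof -
    have "- (f (a \<otimes> inv a) - f a - f (inv a)) \<in> \<Lambda>"
      using that by (intro \<Lambda>(3) f_mult) auto
    then have "- (f \<one> - f a - f (inv a)) + (f \<one> + - f a) \<in> \<Lambda>"
      using that f1 \<Lambda> by (intro \<Lambda>(2)) auto
    then show ?thesis
      by simp
  qed
  have "subgroup {a\<in>N. f a \<in> \<Lambda>} G"
    by unfold_locales (auto simp: f1 f_mult' f_inv)
  moreover have "?N \<subseteq> {a\<in>N. f a \<in> \<Lambda>}"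
    using v by (auto simp: f_eq)
  moreover have "a0 \<in> {a\<in>N. f a \<in> \<Lambda>}"
  proof (cases "p a0 k = 0")
    case True
    then show ?thesis using v[of a0] a0 by (simp add: f_eq)
  next
    case False
    then have "f a0 = 0"
      by (simp add: f_eq c_def)
    then show ?thesis using a0 \<Lambda> by simp
  qed
  ultimately have "N \<subseteq> {a\<in>N. f a \<in> \<Lambda>}"
    using a0(2) by blast
  then show ?case
    by (intro exI[of _ v']) (auto simp: f_def)
qed

text \<open>N is the kernel of the action of G on the right cosets of H by right multiplication. It
  fixes the coset H, hence lies in H, and its cosets are the fibres of a map into the finite set of
  self-maps of the coset space.\<close>

lemma normal_core:
  assumes H: "subgroup H G" and fin: "finite (rcosets H)"
  obtains N where "N \<lhd> G" "N \<subseteq> H" "finite (rcosets N)"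
proof -
  interpret H: subgroup H G by (rule H)
  define F where "F g = (\<lambda>C\<in>rcosets H. C #> g)" for g
  define N where "N = {g\<in>carrier G. \<forall>C\<in>rcosets H. C #> g = C}"
  have sub: "C \<subseteq> carrier G" if "C \<in> rcosets H" for C
    using that H.rcosets_carrier[OF is_group] by auto
  have act: "C #> g \<in> rcosets H" if C: "C \<in> rcosets H" and "g \<in> carrier G" for C g
  proof -
    obtain a where a: "a \<in> carrier G" "C = H #> a"
      using C by (auto simp: RCOSETS_def)
    then have "C #> g = H #> (a \<otimes> g)"
      using that H.subset by (simp add: coset_mult_assoc)
    then show ?thesis
      using a that by (auto simp: RCOSETS_def)
  qed
  have assoc: "C #> g #> h = C #> (g \<otimes> h)" if "C \<in> rcosets H" "g \<in> carrier G" "h \<in> carrier G" for C g h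
    using that sub by (simp add: coset_mult_assoc)
  have fixN: "C #> n = C" if "C \<in> rcosets H" "n \<in> N" for C n
    using that unfolding N_def by blast
  have cancel: "C #> g #> inv g = C" if "C \<in> rcosets H" "g \<in> carrier G" for C g
    unfolding assoc[OF that inv_closed[OF that(2)]] using that sub by (simp add: coset_mult_one)
  have subN: "subgroup N G"
  proof
    show "N \<subseteq> carrier G" by (auto simp: N_def)
    show "\<one> \<in> N" using sub by (auto simp: N_def coset_mult_one)
    show "x \<otimes> y \<in> N" if "x \<in> N" "y \<in> N" for x y
      using that assoc by (force simp: N_def)
    show "inv x \<in> N" if "x \<in> N" for x
    proof -
      have "C #> inv x = C" if C: "C \<in> rcosets H" for C
      proof -
        have "C #> inv x = C #> x #> inv x"
          using \<open>x \<in> N\<close> C by (simp add: N_def)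
        also have "\<dots> = C"
          using \<open>x \<in> N\<close> C by (intro cancel) (auto simp: N_def)
        finally show ?thesis .
      qed
      moreover have "inv x \<in> carrier G" using that by (simp add: N_def)
      ultimately show ?thesis unfolding N_def by blast
    qed
  qed
  interpret N: subgroup N G by (rule subN)
  have normal: "N \<lhd> G"
  proof (rule normal_invI[OF subN])
    fix g h assume g: "g \<in> carrier G" and h: "h \<in> N"
    then have hc: "h \<in> carrier G" by simp
    have "C #> (g \<otimes> h \<otimes> inv g) = C" if C: "C \<in> rcosets H" for C
    proof -
      have "C #> (g \<otimes> h \<otimes> inv g) = C #> g #> h #> inv g"
        using C g hc by (simp add: assoc act)
      also have "C #> g #> h = C #> g"
        by (rule fixN[OF act[OF C g] h])
      also have "C #> g #> inv g = C"
        by (rule cancel[OF C g])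
      finally show ?thesis .
    qed
    moreover have "g \<otimes> h \<otimes> inv g \<in> carrier G"
      using g hc by simp
    ultimately show "g \<otimes> h \<otimes> inv g \<in> N"
      unfolding N_def by blast
  qed
  have "N \<subseteq> H"
  proof
    fix g assume g: "g \<in> N"
    have "H \<in> rcosets H"
      using H.subgroup_in_rcosets[OF is_group] .
    then have "H #> g = H" using g by (rule fixN)
    then show "g \<in> H"
      using coset_join1 g H.subgroup_axioms by (metis N.mem_carrier)
  qed
  moreover have "finite (rcosets N)"
  proof -
    have F: "F g \<in> rcosets H \<rightarrow>\<^sub>E rcosets H" if "g \<in> carrier G" for g
      using act that by (auto simp: F_def)
    have "N #> g = {h\<in>carrier G. F h = F g}" if g: "g \<in> carrier G" for g
    proof (intro subset_antisym subsetI)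
      fix h assume "h \<in> N #> g"
      then obtain n where n: "n \<in> N" "h = n \<otimes> g"
        by (auto simp: r_coset_def)
      have nc: "n \<in> carrier G" using n by simp
      have "C #> (n \<otimes> g) = C #> g" if "C \<in> rcosets H" for C
        using assoc[OF that nc g] fixN[OF that n(1)] by simp
      then show "h \<in> {h\<in>carrier G. F h = F g}"
        using n g nc by (auto simp: F_def intro!: restrict_ext)
    next
      fix h assume "h \<in> {h\<in>carrier G. F h = F g}"
      then have h: "h \<in> carrier G" and "F h = F g" by auto
      then have eq: "C #> h = C #> g" if "C \<in> rcosets H" for C
        using that by (metis F_def restrict_apply')
      have "C #> (h \<otimes> inv g) = C" if C: "C \<in> rcosets H" for C
        using eq[OF C] assoc[OF C h inv_closed[OF g]] cancel[OF C g] by simp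
      moreover have "h \<otimes> inv g \<in> carrier G"
        using h g by simp
      ultimately have "h \<otimes> inv g \<in> N"
        unfolding N_def by blast
      then show "h \<in> N #> g"
        using h g by (auto simp: r_coset_def m_assoc intro!: bexI[of _ "h \<otimes> inv g"])
    qed
    then have "rcosets N \<subseteq> (\<lambda>f. {h\<in>carrier G. F h = f}) ` (rcosets H \<rightarrow>\<^sub>E rcosets H)"
      using F by (auto simp: RCOSETS_def)
    then show ?thesis
      using fin by (meson finite_PiE finite_imageI finite_subset)
  qed
  ultimately show ?thesis
    using that normal by blast
qed

end

text \<open>N is presented by an injective homomorphism p into the integer vectors of length k; its
  image may be any subgroup, so N is never identified with a free group of rank k. Having \<one> in
  S makes the forms \<open>x s\<close> special cases of the differences
  \<open>x s - x t\<close>.\<close>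

locale lattice_extension = group G for G (structure) +
  fixes N S :: "'a set" and k :: nat and p :: "'a \<Rightarrow> nat \<Rightarrow> int"
  assumes normal: "N \<lhd> G" and finite_index: "finite (rcosets N)"
    and N_commute: "\<And>a b. a \<in> N \<Longrightarrow> b \<in> N \<Longrightarrow> a \<otimes> b = b \<otimes> a"
    and p_mult: "\<And>a b i. a \<in> N \<Longrightarrow> b \<in> N \<Longrightarrow> i < k \<Longrightarrow> p (a \<otimes> b) i = p a i + p b i"
    and p_inj: "\<And>a. a \<in> N \<Longrightarrow> (\<And>i. i < k \<Longrightarrow> p a i = 0) \<Longrightarrow> a = \<one>"
    and finite_S: "finite S" and S_subset: "S \<subseteq> N" and one_S: "\<one> \<in> S"
    and S_conj: "\<And>g s. g \<in> carrier G \<Longrightarrow> s \<in> S \<Longrightarrow> inv g \<otimes> s \<otimes> g \<in> S"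
    and S_generates: "\<And>K. subgroup K G \<Longrightarrow> S \<subseteq> K \<Longrightarrow> N \<subseteq> K"

text \<open>S consists of all G-conjugates of a finite generating set enlarged by \<one>. Since N is
  abelian, conjugation on N depends only on the coset of the conjugating element, so finitely many
  conjugates of each generator occur.\<close>

lemma virtually_Zpow_lattice_extension:
  fixes G (structure)
  assumes G: "group G" and "virtually_Zpow G k"
  obtains N S p where "lattice_extension G N S k p"
proof -
  interpret group G by (rule G)
  obtain H \<phi> where H: "subgroup H G" "finite (rcosets H)" and \<phi>: "\<phi> \<in> iso (G\<lparr>carrier := H\<rparr>) (Zpow_group k)"
    using assms(2) unfolding virtually_Zpow_def is_iso_def by blast
  obtain N where N: "N \<lhd> G" "N \<subseteq> H" "finite (rcosets N)"
    using normal_core[OF H] by blast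
  interpret N: normal N G by (rule N(1))
  interpret H: subgroup H G by (rule H(1))
  have mult: "\<phi> (a \<otimes> b) = (\<lambda>i\<in>{..<k}. \<phi> a i + \<phi> b i)" if "a \<in> H" "b \<in> H" for a b
    using \<phi> that by (auto simp: iso_def hom_def Zpow_group_def)
  have car: "\<phi> a \<in> extensional {..<k}" if "a \<in> H" for a
    using \<phi> that by (auto simp: iso_def hom_def Zpow_group_def PiE_def)
  have inj: "inj_on \<phi> H"
    using \<phi> by (auto simp: iso_def bij_betw_def)
  have comm: "a \<otimes> b = b \<otimes> a" if "a \<in> N" "b \<in> N" for a b
  proof (rule inj_onD[OF inj])
    show "\<phi> (a \<otimes> b) = \<phi> (b \<otimes> a)"
      using that N(2) by (subst (1 2) mult) (auto simp: add.commute)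
  qed (use that N(2) in auto)
  have pm: "\<phi> (a \<otimes> b) i = \<phi> a i + \<phi> b i" if "a \<in> N" "b \<in> N" "i < k" for a b i
    using that N(2) by (subst mult) auto
  have pinj: "a = \<one>" if a: "a \<in> N" and z: "\<And>i. i < k \<Longrightarrow> \<phi> a i = 0" for a
  proof (rule inj_onD[OF inj])
    have "\<phi> \<one> i = 0" if "i < k" for i
      using pm[of "\<one>" "\<one>" i] that by simp
    then show "\<phi> a = \<phi> \<one>"
      using z car[of a] car[of "\<one>"] a N(2) by (intro extensionalityI[of _ "{..<k}"]) auto
  qed (use a N(2) in auto)
  obtain B where B: "finite B" "B \<subseteq> N" "\<And>K. subgroup K G \<Longrightarrow> B \<subseteq> K \<Longrightarrow> N \<subseteq> K"
    using lattice_finitely_generated[of N k \<phi>, OF N.subgroup_axioms pm pinj] by blast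
  define B' where "B' = insert \<one> B"
  define S where "S = (\<Union>g\<in>carrier G. (\<lambda>b. inv g \<otimes> b \<otimes> g) ` B')"
  have B': "finite B'" "B' \<subseteq> N" "\<one> \<in> B'"
    using B by (auto simp: B'_def)
  have conj: "inv (n \<otimes> g) \<otimes> b \<otimes> (n \<otimes> g) = inv g \<otimes> b \<otimes> g"
    if "n \<in> N" "g \<in> carrier G" "b \<in> N" for n g b
  proof -
    have "inv (n \<otimes> g) \<otimes> b \<otimes> (n \<otimes> g) = inv g \<otimes> (inv n \<otimes> (b \<otimes> n)) \<otimes> g"
      using that by (simp add: inv_mult_group m_assoc)
    also have "inv n \<otimes> (b \<otimes> n) = b"
      using that comm[of b n] by (simp add: inv_solve_left')
    finally show ?thesis .
  qed
  define Q where "Q C = (\<lambda>b. inv (SOME g. g \<in> C) \<otimes> b \<otimes> (SOME g. g \<in> C)) ` B'" for C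
  have "(\<lambda>b. inv g \<otimes> b \<otimes> g) ` B' = Q (N #> g)" if g: "g \<in> carrier G" for g
  proof -
    have "(SOME h. h \<in> N #> g) \<in> N #> g"
      using rcos_self[OF g N.subgroup_axioms] by (rule someI)
    then obtain n where "n \<in> N" "(SOME h. h \<in> N #> g) = n \<otimes> g"
      by (auto simp: r_coset_def)
    then show ?thesis
      unfolding Q_def using g B' by (intro image_cong refl) (auto simp: conj)
  qed
  then have "S = (\<Union>C\<in>rcosets N. Q C)"
    unfolding S_def RCOSETS_def by auto
  moreover have "finite (Q C)" for C
    using B' by (simp add: Q_def)
  ultimately have finS: "finite S"
    using N(3) by simp
  have BS: "B' \<subseteq> S"
  proof
    fix b assume b: "b \<in> B'"
    then have "b = inv \<one> \<otimes> b \<otimes> \<one>"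
      using B' by auto
    then show "b \<in> S"
      unfolding S_def using b by blast
  qed
  have "lattice_extension G N S k \<phi>"
  proof
    show "finite (rcosets N)" by (rule N)
    show "S \<subseteq> N"
      using B' N.inv_op_closed1 by (auto simp: S_def)
    show "\<one> \<in> S"
      using BS B' by blast
    fix g s assume g: "g \<in> carrier G" and s: "s \<in> S"
    obtain h b where hb: "h \<in> carrier G" "b \<in> B'" "s = inv h \<otimes> b \<otimes> h"
      using s by (auto simp: S_def)
    have "inv g \<otimes> s \<otimes> g = inv (h \<otimes> g) \<otimes> b \<otimes> (h \<otimes> g)"
      using hb g B' by (auto simp: inv_mult_group m_assoc)
    then show "inv g \<otimes> s \<otimes> g \<in> S"
      unfolding S_def using hb g by blast
  next
    fix K assume "subgroup K G" "S \<subseteq> K"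
    then show "N \<subseteq> K"
      using B(3) BS by (auto simp: B'_def)
  qed (use comm pm pinj finS in auto)
  then show ?thesis
    using that by blast
qed

section \<open>Discs and finite CW complexes\<close>

definition disc :: "nat \<Rightarrow> (nat \<Rightarrow> real) set" where
  "disc m = {x. (\<forall>i\<ge>m. x i = 0) \<and> (\<Sum>i<m. (x i)\<^sup>2) \<le> 1}"

lemma Euclidean_space_eq_top_of_set: "Euclidean_space m = top_of_set {x. \<forall>i\<ge>m. x i = 0}"
  by (simp add: Euclidean_space_def euclidean_product_topology)

lemma closed_disc_eq: "closed_disc m = top_of_set (disc m)"
proof -
  have "disc m = {x. \<forall>i\<ge>m. x i = 0} \<inter> {x. (\<Sum>i<m. (x i)\<^sup>2) \<le> 1}"
    by (auto simp: disc_def)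
  then show ?thesis
    by (simp add: closed_disc_def Euclidean_space_eq_top_of_set subtopology_subtopology)
qed

lemma open_disc_eq: "open_disc m = subtopology (closed_disc m) {x. (\<Sum>i<m. (x i)\<^sup>2) < 1}"
proof -
  have "{x :: nat \<Rightarrow> real. (\<Sum>i<m. (x i)\<^sup>2) \<le> 1} \<inter> {x. (\<Sum>i<m. (x i)\<^sup>2) < 1} = {x. (\<Sum>i<m. (x i)\<^sup>2) < 1}"
    by auto
  then show ?thesis
    by (simp add: open_disc_def closed_disc_def subtopology_subtopology)
qed

lemma continuous_on_coord [continuous_intros]: "continuous_on A (\<lambda>x :: nat \<Rightarrow> real. x i)"
  by (rule continuous_on_subset[OF continuous_on_product_coordinates]) simp

text \<open>Points of a disc are sequences, so compactness comes from Tychonoff: the disc lies in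
  the product of copies of [-1, 1].\<close>

lemma compact_disc_subset:
  assumes "closed A" "A \<subseteq> disc m"
  shows "compact A"
proof -
  have "compactin (product_topology (\<lambda>_. euclideanreal) UNIV) (PiE UNIV (\<lambda>_. {-1..1}))"
    by (simp add: compactin_PiE)
  then have "compact (PiE UNIV (\<lambda>_ :: nat. {-1..1 :: real}))"
    by (simp add: euclidean_product_topology)
  moreover have "A \<subseteq> PiE UNIV (\<lambda>_. {-1..1})"
  proof
    fix x assume "x \<in> A"
    then have x: "\<And>i. i \<ge> m \<Longrightarrow> x i = 0" "(\<Sum>i<m. (x i)\<^sup>2) \<le> 1"
      using assms(2) by (auto simp: disc_def)
    have "(x i)\<^sup>2 \<le> 1" for i
    proof (cases "i < m")
      case True
      then have "(x i)\<^sup>2 \<le> (\<Sum>i<m. (x i)\<^sup>2)"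
        by (intro member_le_sum) auto
      then show ?thesis using x by linarith
    qed (use x in auto)
    then show "x \<in> PiE UNIV (\<lambda>_. {-1..1})"
      by (auto simp: abs_square_le_1 abs_le_iff dest: spec)
  qed
  ultimately show ?thesis
    using assms(1) compact_Int_closed[of "PiE UNIV (\<lambda>_. {-1..1})" A] by (simp add: Int_absorb1)
qed

lemma closed_vanishing: "closed {x :: nat \<Rightarrow> real. \<forall>i\<ge>m. x i = 0}"
  by (intro closed_Collect_all closed_Collect_imp closed_Collect_eq continuous_intros) auto

lemma compact_disc: "compact (disc m)"
proof (rule compact_disc_subset[of _ m])
  show "closed (disc m)"
    unfolding disc_def
    by (intro closed_Collect_conj closed_vanishing closed_Collect_le continuous_intros)
qed simp

text \<open>The radial map \<open>u \<mapsto> (|u| / g u) u\<close>; at the origin the quotient is \<open>0 / 0 = 0\<close>.\<close>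
lemma radial_disc_map:
  fixes g :: "(nat \<Rightarrow> real) \<Rightarrow> real"
  assumes cont: "continuous_on UNIV g"
    and hom: "\<And>c t. c \<ge> 0 \<Longrightarrow> g (\<lambda>i. c * t i) = c * g t"
    and pos: "\<And>t. (\<And>i. i \<ge> m \<Longrightarrow> t i = 0) \<Longrightarrow> (\<exists>i. t i \<noteq> 0) \<Longrightarrow> g t > 0"
  obtains r where "continuous_on (disc m) r"
    "bij_betw r (disc m) {t. (\<forall>i\<ge>m. t i = 0) \<and> g t \<le> 1}"
    "\<forall>u\<in>disc m. g (r u) < 1 \<longleftrightarrow> (\<Sum>i<m. (u i)\<^sup>2) < 1"
proof -
  define nrm where "nrm u = sqrt (\<Sum>i<m. (u i)\<^sup>2)" for u :: "nat \<Rightarrow> real"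
  let ?E = "{t :: nat \<Rightarrow> real. \<forall>i\<ge>m. t i = 0}"
  have nrm_cont: "continuous_on A nrm" for A
    unfolding nrm_def by (intro continuous_intros)
  have nrm_hom: "nrm (\<lambda>i. c * t i) = \<bar>c\<bar> * nrm t" for c t
    unfolding nrm_def by (simp add: power_mult_distrib real_sqrt_mult flip: sum_distrib_left)
  have nrm_pos: "nrm t > 0" if "t \<in> ?E" "\<exists>i. t i \<noteq> 0" for t
  proof -
    obtain i where i: "t i \<noteq> 0"
      using \<open>\<exists>i. t i \<noteq> 0\<close> by blast
    then have "i < m"
      using that(1) by (metis (mono_tags, lifting) mem_Collect_eq not_le)
    then have "(\<Sum>i<m. (t i)\<^sup>2) > 0"
      using i by (intro sum_pos2[of _ i]) auto
    then show ?thesis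
      by (simp add: nrm_def)
  qed
  have nrm_nonneg: "nrm t \<ge> 0" for t
    by (simp add: nrm_def sum_nonneg)
  have nrm0: "nrm (\<lambda>i. 0) = 0"
    by (simp add: nrm_def)
  have g0: "g (\<lambda>i. 0) = 0"
    using hom[of 0 "\<lambda>i. 0"] by simp
  have zero_cases: "t = (\<lambda>i. 0) \<or> (\<exists>i. t i \<noteq> 0)" for t :: "nat \<Rightarrow> real"
    by auto
  have g_pos: "g t > 0" if "t \<in> ?E" "\<exists>i. t i \<noteq> 0" for t
    using pos that by simp
  have g_nonneg: "g t \<ge> 0" if "t \<in> ?E" for t
    using g_pos[of t] g0 that zero_cases[of t] by (metis less_imp_le order_refl)
  have disc_iff: "u \<in> disc m \<longleftrightarrow> u \<in> ?E \<and> nrm u \<le> 1" for u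
    by (simp add: disc_def nrm_def)
  define K where "K = {u \<in> ?E. nrm u = 1}"
  have "compact K"
  proof (rule compact_disc_subset[of _ m])
    have "K = ?E \<inter> {u. nrm u = 1}"
      by (auto simp: K_def)
    then show "closed K"
      by (simp only:) (intro closed_Int closed_vanishing closed_Collect_eq nrm_cont continuous_intros)
    show "K \<subseteq> disc m"
      by (auto simp: K_def disc_iff)
  qed
  \<comment> \<open>The minimum e of g on the unit sphere bounds the factor |u| / g u by 1 / e,
    which yields continuity of the radial map at the origin. For m = 0 the sphere is empty and any e
    serves.\<close>
  have "\<exists>e>0. \<forall>u\<in>K. e \<le> g u"
  proof (cases "K = {}")
    case False
    then obtain x where x: "x \<in> K" "\<forall>u\<in>K. g x \<le> g u"
      using continuous_attains_inf[OF \<open>compact K\<close> False continuous_on_subset[OF cont]] by blast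
    have "\<exists>i. x i \<noteq> 0"
      using x(1) nrm0 zero_cases[of x] unfolding K_def by force
    then have "g x > 0"
      using x(1) g_pos[of x] by (simp add: K_def)
    then show ?thesis
      using x(2) by blast
  qed (auto intro: exI[of _ 1])
  then obtain e where e: "e > 0" "\<And>u. u \<in> K \<Longrightarrow> e \<le> g u"
    by blast
  have bound: "nrm u / g u \<le> 1 / e" if u: "u \<in> ?E" "\<exists>i. u i \<noteq> 0" for u
  proof -
    have n: "nrm u > 0"
      using nrm_pos u by blast
    let ?u = "\<lambda>i. (1 / nrm u) * u i"
    have "?u \<in> K"
      unfolding K_def using u n by (simp only: nrm_hom mem_Collect_eq) simp
    then have "e \<le> (1 / nrm u) * g u"
      using e(2) hom[of "1 / nrm u" u] n by (metis less_imp_le zero_less_divide_1_iff)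
    then show ?thesis
      using e(1) n g_pos[OF u] by (simp add: field_simps)
  qed
  define r where "r u = (\<lambda>i. (nrm u / g u) * u i)" for u :: "nat \<Rightarrow> real"
  have r0: "r (\<lambda>i. 0) = (\<lambda>i. 0)"
    by (simp add: r_def)
  have rE: "r u \<in> ?E" if "u \<in> ?E" for u
    using that by (simp add: r_def)
  have gr: "g (r u) = nrm u" if "u \<in> ?E" for u
  proof (cases "\<exists>i. u i \<noteq> 0")
    case True
    then show ?thesis
      unfolding r_def using g_pos[OF that] nrm_nonneg by (subst hom) auto
  next
    case False
    then have "u = (\<lambda>i. 0)" by auto
    then show ?thesis
      by (simp only: r0 g0 nrm0)
  qed
  define s where "s t = (\<lambda>i. (g t / nrm t) * t i)" for t :: "nat \<Rightarrow> real"
  have s0: "s (\<lambda>i. 0) = (\<lambda>i. 0)"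
    by (simp add: s_def)
  have sE: "s u \<in> ?E" if "u \<in> ?E" for u
    using that by (simp add: s_def)
  have ns: "nrm (s t) = g t" if "t \<in> ?E" for t
  proof (cases "\<exists>i. t i \<noteq> 0")
    case True
    then show ?thesis
      unfolding s_def using nrm_pos[OF that] g_nonneg[OF that] by (subst nrm_hom) auto
  next
    case False
    then have "t = (\<lambda>i. 0)" by auto
    then show ?thesis
      by (simp only: s0 g0 nrm0)
  qed
  have sr: "s (r u) = u" if u: "u \<in> ?E" for u
  proof (cases "\<exists>i. u i \<noteq> 0")
    case True
    have p: "nrm u > 0" "g u > 0"
      using nrm_pos[OF u True] g_pos[OF u True] by auto
    have "nrm (r u) = (nrm u / g u) * nrm u"
      unfolding r_def nrm_hom using p by simp
    then show ?thesis
      unfolding s_def gr[OF u] using p by (simp add: r_def)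
  next
    case False
    then have "u = (\<lambda>i. 0)" by auto
    then show ?thesis
      by (simp only: r0 s0)
  qed
  have rs: "r (s t) = t" if t: "t \<in> ?E" for t
  proof (cases "\<exists>i. t i \<noteq> 0")
    case True
    have p: "nrm t > 0" "g t > 0"
      using nrm_pos[OF t True] g_pos[OF t True] by auto
    have "g (s t) = (g t / nrm t) * g t"
      unfolding s_def using p by (subst hom) auto
    then show ?thesis
      unfolding r_def ns[OF t] using p by (simp add: s_def)
  next
    case False
    then have "t = (\<lambda>i. 0)" by auto
    then show ?thesis
      by (simp only: r0 s0)
  qed
  show ?thesis
  proof
    show "bij_betw r (disc m) {t. (\<forall>i\<ge>m. t i = 0) \<and> g t \<le> 1}"
    proof (rule bij_betw_byWitness[where f' = s])
      show "\<forall>a\<in>disc m. s (r a) = a"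
        using sr by (simp add: disc_iff)
      show "\<forall>a\<in>{t. (\<forall>i\<ge>m. t i = 0) \<and> g t \<le> 1}. r (s a) = a"
        using rs by simp
      show "r ` disc m \<subseteq> {t. (\<forall>i\<ge>m. t i = 0) \<and> g t \<le> 1}"
        using gr rE by (auto simp: disc_iff)
      show "s ` {t. (\<forall>i\<ge>m. t i = 0) \<and> g t \<le> 1} \<subseteq> disc m"
        using ns sE by (auto simp: disc_iff)
    qed
    have "g (r u) < 1 \<longleftrightarrow> (\<Sum>i<m. (u i)\<^sup>2) < 1" if "u \<in> disc m" for u
      using that gr[of u] by (simp add: disc_iff) (simp add: nrm_def)
    then show "\<forall>u\<in>disc m. g (r u) < 1 \<longleftrightarrow> (\<Sum>i<m. (u i)\<^sup>2) < 1"
      by blast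
    show "continuous_on (disc m) r"
    proof (rule continuous_on_coordinatewise_then_product)
      fix i
      show "continuous_on (disc m) (\<lambda>u. r u i)"
        unfolding continuous_on
      proof
        fix u assume u: "u \<in> disc m"
        have lim: "((\<lambda>u. f u) \<longlongrightarrow> f u) (at u within disc m)" if "continuous_on (disc m) f" for f :: "_ \<Rightarrow> real"
          using that u unfolding continuous_on by blast
        show "((\<lambda>u. r u i) \<longlongrightarrow> r u i) (at u within disc m)"
        proof (cases "\<exists>i. u i \<noteq> 0")
          case True
          have "g u \<noteq> 0"
            using g_pos[OF _ True] u by (simp add: disc_iff)
          then show ?thesis
            unfolding r_def
            by (intro tendsto_intros lim nrm_cont continuous_on_subset[OF cont] continuous_intros) auto
        next
          case False
          then have u0: "u = (\<lambda>i. 0)" by auto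
          have "((\<lambda>v. \<bar>v i\<bar> / e) \<longlongrightarrow> \<bar>u i\<bar> / e) (at u within disc m)"
            using e(1) by (intro lim continuous_intros) auto
          then have l0: "((\<lambda>v. \<bar>v i\<bar> / e) \<longlongrightarrow> 0) (at u within disc m)"
            by (simp add: u0)
          have "((\<lambda>v. r v i) \<longlongrightarrow> 0) (at u within disc m)"
          proof (rule Lim_null_comparison[OF _ l0])
            have "norm (r v i) \<le> \<bar>v i\<bar> / e" if v: "v \<in> disc m" for v
            proof (cases "\<exists>i. v i \<noteq> 0")
              case True
              have vE: "v \<in> ?E" using v by (simp add: disc_iff)
              have "\<bar>nrm v / g v\<bar> * \<bar>v i\<bar> \<le> (1 / e) * \<bar>v i\<bar>"
                using bound[OF vE True] nrm_nonneg g_nonneg[OF vE] by (intro mult_right_mono) auto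
              then show ?thesis
                by (simp add: r_def abs_mult)
            next
              case False
              then have "v = (\<lambda>i. 0)" by auto
              then show ?thesis by (simp add: r0)
            qed
            then show "\<forall>\<^sub>F v in at u within disc m. norm (r v i) \<le> \<bar>v i\<bar> / e"
              by (simp add: eventually_at_filter)
          qed
          then show ?thesis
            by (simp add: u0 r0)
        qed
      qed
    qed
  qed
qed

lemma continuous_on_Max_finite:
  fixes f :: "'i \<Rightarrow> 'a::topological_space \<Rightarrow> real"
  assumes "finite I" "I \<noteq> {}" "\<And>i. i \<in> I \<Longrightarrow> continuous_on A (f i)"
  shows "continuous_on A (\<lambda>x. Max ((\<lambda>i. f i x) ` I))"
  using assms
proof (induction I rule: finite_ne_induct)
  case (insert i I)
  have "(\<lambda>x. Max ((\<lambda>i. f i x) ` insert i I)) = (\<lambda>x. max (f i x) (Max ((\<lambda>i. f i x) ` I)))"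
    using insert by (auto simp: Max_insert)
  then show ?case
    using insert by (auto intro!: continuous_intros)
qed auto

text \<open>A continuous map from a compact disc to a Hausdorff space is closed, and a closed map
  stays closed when restricted to the full preimage of a set. The open disc is the full preimage of
  e because the boundary misses e.\<close>

lemma characteristic_map_homeomorphic:
  assumes T: "Hausdorff_space T" and c: "continuous_map (closed_disc m) T f"
    and inj: "inj_on f (topspace (open_disc m))" and im: "f ` topspace (open_disc m) = e"
    and bd: "f ` disc_boundary m \<inter> e = {}"
  shows "homeomorphic_map (open_disc m) (subtopology T e) f"
proof -
  let ?O = "{x. (\<Sum>i<m. (x i)\<^sup>2) < (1::real)}"
  have "compact_space (closed_disc m)"
    unfolding closed_disc_eq by (simp add: compact_space_subtopology compact_disc)
  then have "closed_map (closed_disc m) T f"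
    using continuous_imp_closed_map c T by blast
  moreover have top: "topspace (open_disc m) = topspace (closed_disc m) \<inter> ?O"
    by (simp add: open_disc_eq)
  moreover have "{x \<in> topspace (closed_disc m). f x \<in> e} = topspace (closed_disc m) \<inter> ?O"
  proof (intro subset_antisym subsetI)
    fix x assume x: "x \<in> {x \<in> topspace (closed_disc m). f x \<in> e}"
    then have "x \<notin> disc_boundary m"
      using bd by auto
    then show "x \<in> topspace (closed_disc m) \<inter> ?O"
      using x by (auto simp: closed_disc_def disc_boundary_def)
  next
    fix x assume "x \<in> topspace (closed_disc m) \<inter> ?O"
    then show "x \<in> {x \<in> topspace (closed_disc m). f x \<in> e}"
      using im top by auto
  qed
  ultimately have "closed_map (subtopology (closed_disc m) (topspace (closed_disc m) \<inter> ?O)) (subtopology T e) f"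
    by (intro closed_map_restriction)
  moreover have "open_disc m = subtopology (closed_disc m) (topspace (closed_disc m) \<inter> ?O)"
    by (subst open_disc_eq) (rule subtopology_restrict[symmetric])
  ultimately have cl: "closed_map (open_disc m) (subtopology T e) f"
    by (simp only:)
  have "continuous_map (open_disc m) T f"
    unfolding open_disc_eq by (rule continuous_map_from_subtopology[OF c])
  then have co: "continuous_map (open_disc m) (subtopology T e) f"
    using im by (auto simp: continuous_map_in_subtopology)
  have "e \<subseteq> topspace T"
    using im \<open>continuous_map (open_disc m) T f\<close> by (auto simp: continuous_map_def)
  then show ?thesis
    using im by (intro bijective_closed_imp_homeomorphic_map co cl inj) auto
qed

text \<open>With finitely many cells, closure-finiteness and the weak topology are automatic.
  Disjointness together with the drop in dimension shows that boundaries avoid their own cell, so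
  the homeomorphism condition reduces to a bijection on open discs.\<close>

lemma CW_complex_dim_leI_finite:
  fixes dm :: "'a set \<Rightarrow> nat" and chr :: "'a set \<Rightarrow> (nat \<Rightarrow> real) \<Rightarrow> 'a"
  assumes T: "Hausdorff_space T" and fin: "finite cells" and cov: "\<Union>cells = topspace T"
    and disj: "pairwise disjnt cells" and ne: "{} \<notin> cells" and dm_le: "\<And>e. e \<in> cells \<Longrightarrow> dm e \<le> d"
    and cont: "\<And>e. e \<in> cells \<Longrightarrow> continuous_map (closed_disc (dm e)) T (chr e)"
    and inj: "\<And>e. e \<in> cells \<Longrightarrow> inj_on (chr e) (topspace (open_disc (dm e)))"
    and im: "\<And>e. e \<in> cells \<Longrightarrow> chr e ` topspace (open_disc (dm e)) = e"
    and bd: "\<And>e. e \<in> cells \<Longrightarrow> chr e ` disc_boundary (dm e) \<subseteq> \<Union>{e'\<in>cells. dm e' < dm e}"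
  shows "CW_complex_dim_le T d"
proof -
  have hom: "homeomorphic_map (open_disc (dm e)) (subtopology T e) (chr e)" if e: "e \<in> cells" for e
  proof (rule characteristic_map_homeomorphic[OF T cont[OF e] inj[OF e] im[OF e]])
    show "chr e ` disc_boundary (dm e) \<inter> e = {}"
    proof (intro equals0I)
      fix x assume x: "x \<in> chr e ` disc_boundary (dm e) \<inter> e"
      then obtain e' where e': "e' \<in> cells" "dm e' < dm e" "x \<in> e'"
        using bd[OF e] by blast
      then have "disjnt e e'"
        using disj e by (auto simp: pairwise_def)
      then show False
        using x e' by (auto simp: disjnt_def)
    qed
  qed
  have weak: "closedin T A \<longleftrightarrow> (\<forall>e\<in>cells. closedin T (A \<inter> (T closure_of e)))" if A: "A \<subseteq> topspace T" for A
  proof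
    assume "\<forall>e\<in>cells. closedin T (A \<inter> (T closure_of e))"
    then have "closedin T (\<Union>e\<in>cells. A \<inter> (T closure_of e))"
      using fin by (intro closedin_Union) auto
    moreover have "e \<subseteq> T closure_of e" if "e \<in> cells" for e
      using that cov by (intro closure_of_subset) auto
    then have "\<Union>cells \<subseteq> (\<Union>e\<in>cells. T closure_of e)"
      by (intro Union_least) blast
    then have "A \<subseteq> (\<Union>e\<in>cells. T closure_of e)"
      using A unfolding cov by (rule order_trans[rotated])
    then have "(\<Union>e\<in>cells. A \<inter> (T closure_of e)) = A"
      by auto
    ultimately show "closedin T A"
      by simp
  qed auto
  have "\<exists>F. finite F \<and> F \<subseteq> cells \<and> (\<forall>e'\<in>F. dm e' < dm e) \<and> chr e ` disc_boundary (dm e) \<subseteq> \<Union>F"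
    if e: "e \<in> cells" for e
    using fin bd[OF e] by (intro exI[of _ "{e'\<in>cells. dm e' < dm e}"]) auto
  then show ?thesis
    unfolding CW_complex_dim_le_def
    using T cov disj ne dm_le cont hom weak
    by (intro conjI exI[of _ cells] exI[of _ dm] exI[of _ chr]) simp_all
qed

section \<open>The space of irreducible representations\<close>

lemma continuous_map_matrix_mult:
  fixes f g :: "'a \<Rightarrow> complex^'n^'n"
  assumes "continuous_map X euclidean f" "continuous_map X euclidean g"
  shows "continuous_map X euclidean (\<lambda>x. f x ** g x)"
proof -
  have "continuous_on UNIV (\<lambda>z :: (complex^'n^'n) \<times> (complex^'n^'n). fst z ** snd z)"
    by (intro continuous_intros)
  then have "continuous_map (prod_topology euclidean euclidean) euclidean
     (\<lambda>z :: (complex^'n^'n) \<times> (complex^'n^'n). fst z ** snd z)"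
    by simp
  from continuous_map_compose[OF continuous_map_pairedI[OF assms] this] show ?thesis
    by (simp add: o_def)
qed

lemma continuous_map_conj_transpose:
  fixes f :: "'a \<Rightarrow> complex^'n^'n"
  assumes "continuous_map X euclidean f"
  shows "continuous_map X euclidean (\<lambda>x. conj_transpose (f x))"
proof -
  have "continuous_on UNIV (\<lambda>A :: complex^'n^'n. conj_transpose A)"
    by (intro continuous_intros)
  then have "continuous_map euclidean euclidean (\<lambda>A :: complex^'n^'n. conj_transpose A)"
    by simp
  from continuous_map_compose[OF assms this] show ?thesis
    by (simp add: o_def)
qed

lemma continuous_map_matrix_entry:
  fixes f :: "'a \<Rightarrow> complex^'n^'n"
  assumes "continuous_map X euclidean f"
  shows "continuous_map X euclidean (\<lambda>x. f x $ i $ j)"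
proof -
  have "continuous_on UNIV (\<lambda>A :: complex^'n^'n. A $ i $ j)"
    by (intro continuous_intros)
  then have "continuous_map euclidean euclidean (\<lambda>A :: complex^'n^'n. A $ i $ j)"
    by simp
  from continuous_map_compose[OF assms this] show ?thesis
    by (simp add: o_def)
qed

lemma closedin_Collect_ball:
  assumes "\<And>i. i \<in> I \<Longrightarrow> closedin X {x \<in> topspace X. P i x}"
  shows "closedin X {x \<in> topspace X. \<forall>i\<in>I. P i x}"
proof (cases "I = {}")
  case False
  then have "{x \<in> topspace X. \<forall>i\<in>I. P i x} = \<Inter> ((\<lambda>i. {x \<in> topspace X. P i x}) ` I)"
    by auto
  then show ?thesis
    using False assms by (auto intro: closedin_Inter)
qed simp

lemma topspace_Hom_top [simp]: "topspace (Hom_top G) = Hom_U G"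
  by (auto simp: Hom_top_def Hom_U_def PiE_def)

lemma continuous_map_eval:
  "x \<in> carrier G \<Longrightarrow> continuous_map (Hom_top G) euclidean (\<lambda>\<rho>. \<rho> x)"
  unfolding Hom_top_def
  by (intro continuous_map_from_subtopology continuous_map_product_projection)

lemma continuous_map_into_Hom_top:
  assumes "\<And>t. t \<in> topspace X \<Longrightarrow> f t \<in> Hom_U G"
    and "\<And>x. x \<in> carrier G \<Longrightarrow> continuous_map X euclidean (\<lambda>t. f t x)"
  shows "continuous_map X (Hom_top G) f"
  unfolding Hom_top_def continuous_map_in_subtopology continuous_map_componentwise
  using assms Hom_U_extensional by blast

lemma Hausdorff_Hom_top: "Hausdorff_space (Hom_top G :: ('g \<Rightarrow> complex^'n^'n) topology)"
  unfolding Hom_top_def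
  by (intro Hausdorff_space_subtopology) (simp add: Hausdorff_space_product_topology)

text \<open>The multiplicativity equations are closed conditions in a product of copies of the
  compact unitary group.\<close>

lemma compact_Hom_top:
  assumes "group G"
  shows "compact_space (Hom_top G :: ('g \<Rightarrow> complex^'n^'n) topology)"
proof -
  interpret group G by fact
  let ?P = "product_topology (\<lambda>_. euclidean) (carrier G) :: ('g \<Rightarrow> complex^'n^'n) topology"
  let ?K = "carrier G \<rightarrow>\<^sub>E (unitary_group :: (complex^'n^'n) set)"
  let ?X = "subtopology ?P ?K"
  have K: "compactin ?P ?K"
    using compact_unitary by (auto simp: compactin_PiE)
  have X: "topspace ?X = ?K"
    by (auto simp: PiE_def)
  have ev: "continuous_map ?X euclidean (\<lambda>\<rho>. \<rho> x)" if "x \<in> carrier G" for x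
    using that by (intro continuous_map_from_subtopology continuous_map_product_projection)
  have cl: "closedin ?X {\<rho> \<in> topspace ?X. \<rho> (x \<otimes>\<^bsub>G\<^esub> y) = \<rho> x ** \<rho> y}" if "x \<in> carrier G" "y \<in> carrier G" for x y
    using that by (intro closedin_continuous_maps_eq[where Y = euclidean] ev continuous_map_matrix_mult) auto
  have "closedin ?X {\<rho> \<in> topspace ?X. \<forall>z\<in>carrier G \<times> carrier G. \<rho> (fst z \<otimes>\<^bsub>G\<^esub> snd z) = \<rho> (fst z) ** \<rho> (snd z)}"
    by (rule closedin_Collect_ball) (rule cl; auto)
  moreover have "{\<rho> \<in> topspace ?X. \<forall>z\<in>carrier G \<times> carrier G. \<rho> (fst z \<otimes>\<^bsub>G\<^esub> snd z) = \<rho> (fst z) ** \<rho> (snd z)} = Hom_U G"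
    unfolding X Hom_U_def by auto
  ultimately have "closedin ?X (Hom_U G)"
    by simp
  moreover have "compact_space ?X"
    using K by (simp add: compact_space_subtopology)
  ultimately have "compactin ?X (Hom_U G)"
    using closedin_compact_space by blast
  then show ?thesis
    unfolding Hom_top_def by (simp add: compactin_subtopology compact_space_subtopology)
qed

text \<open>The image of the compact set \<open>unitary_group \<times> C\<close> under the
  continuous conjugation action is compact, hence closed in a Hausdorff space.\<close>

lemma closedin_conj_saturation:
  fixes C :: "('g \<Rightarrow> complex^'n^'n) set"
  assumes G: "group G" and C: "closedin (Hom_top G) C"
  shows "closedin (Hom_top G) ((\<lambda>(U, \<sigma>). conj_rep G U \<sigma>) ` (unitary_group \<times> C))"
proof -
  let ?X = "prod_topology (top_of_set unitary_group) (Hom_top G) :: ((complex^'n^'n) \<times> ('g \<Rightarrow> complex^'n^'n)) topology"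
  have "continuous_map ?X (Hom_top G) (\<lambda>z. conj_rep G (fst z) (snd z))"
  proof (rule continuous_map_into_Hom_top)
    fix z assume "z \<in> topspace ?X"
    then show "conj_rep G (fst z) (snd z) \<in> Hom_U G"
      by (intro conj_rep_Hom_U[OF G]) (simp_all add: mem_Times_iff)
  next
    fix x assume x: "x \<in> carrier G"
    have 1: "continuous_map ?X euclidean fst"
      by (rule continuous_map_into_fulltopology[OF continuous_map_fst])
    have 2: "continuous_map ?X euclidean (\<lambda>z. snd z x)"
      using continuous_map_compose[OF continuous_map_snd continuous_map_eval[OF x]] by (simp add: o_def)
    show "continuous_map ?X euclidean (\<lambda>z. conj_rep G (fst z) (snd z) x)"
      unfolding conj_rep_apply[OF x]
      by (intro continuous_map_matrix_mult continuous_map_conj_transpose 1 2)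
  qed
  moreover have "compactin (Hom_top G) C"
    using compact_Hom_top[OF G] C closedin_compact_space by blast
  then have "compactin ?X (unitary_group \<times> C)"
    by (simp add: compactin_Times compact_unitary compactin_subtopology)
  ultimately have "compactin (Hom_top G) ((\<lambda>z. conj_rep G (fst z) (snd z)) ` (unitary_group \<times> C))"
    by (rule image_compactin[rotated])
  then show ?thesis
    using compactin_imp_closedin[OF Hausdorff_Hom_top] by (simp add: case_prod_beta')
qed

text \<open>For each of the finitely many index sets S the block representations are defined by
  vanishing entries; the reducible ones form the union of the conjugation saturations of these
  closed sets.\<close>

lemma closedin_reducible:
  assumes G: "group G"
  shows "closedin (Hom_top G) {\<rho> \<in> Hom_U G. reducible_rep G (\<rho> :: 'g \<Rightarrow> complex^'n^'n)}"
proof -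
  define Z where "Z S = {\<sigma> \<in> Hom_U G. \<forall>\<gamma>\<in>carrier G. \<forall>i j. (i \<in> S \<longleftrightarrow> j \<notin> S) \<longrightarrow> (\<sigma> \<gamma> :: complex^'n^'n) $ i $ j = 0}" for S
  have "closedin (Hom_top G) (Z S)" for S
  proof -
    let ?I = "{z. fst z \<in> carrier G \<and> (fst (snd z) \<in> S \<longleftrightarrow> snd (snd z) \<notin> S)}"
    have "closedin (Hom_top G) {\<sigma> \<in> topspace (Hom_top G). \<forall>z\<in>?I. (\<sigma> (fst z) :: complex^'n^'n) $ fst (snd z) $ snd (snd z) = 0}"
    proof (rule closedin_Collect_ball)
      fix z assume "z \<in> ?I"
      then have "fst z \<in> carrier G" by simp
      then show "closedin (Hom_top G) {\<sigma> \<in> topspace (Hom_top G). (\<sigma> (fst z) :: complex^'n^'n) $ fst (snd z) $ snd (snd z) = 0}"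
        by (intro closedin_continuous_maps_eq[where Y = euclidean] continuous_map_matrix_entry continuous_map_eval) auto
    qed
    moreover have "{\<sigma> \<in> topspace (Hom_top G). \<forall>z\<in>?I. (\<sigma> (fst z) :: complex^'n^'n) $ fst (snd z) $ snd (snd z) = 0} = Z S"
      unfolding Z_def topspace_Hom_top by fastforce
    ultimately show ?thesis
      by simp
  qed
  then have "closedin (Hom_top G) (\<Union>S\<in>{S. S \<noteq> {} \<and> S \<noteq> UNIV}. (\<lambda>(U, \<sigma>). conj_rep G U \<sigma>) ` (unitary_group \<times> Z S))"
    by (intro closedin_Union finite_imageI) (auto intro: closedin_conj_saturation[OF G])
  moreover have "(\<Union>S\<in>{S. S \<noteq> {} \<and> S \<noteq> UNIV}. (\<lambda>(U, \<sigma>). conj_rep G U \<sigma>) ` (unitary_group \<times> Z S)) =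
     {\<rho> \<in> Hom_U G. reducible_rep G \<rho>}" (is "?L = ?R")
  proof (intro subset_antisym subsetI)
    fix \<rho> assume "\<rho> \<in> ?L"
    then obtain S U \<sigma> where S: "S \<noteq> {}" "S \<noteq> UNIV" and U: "U \<in> unitary_group" and \<sigma>: "\<sigma> \<in> Z S" and \<rho>: "\<rho> = conj_rep G U \<sigma>"
      by auto
    have "reducible_rep G \<sigma>"
      using \<sigma> S unfolding Z_def by (intro reducible_repI_blocks[of _ _ S]) auto
    then show "\<rho> \<in> ?R"
      using \<rho> \<sigma> U by (simp add: reducible_rep_conj_rep conj_rep_Hom_U[OF G] Z_def)
  next
    fix \<rho> assume \<rho>: "\<rho> \<in> ?R"
    then obtain U S where U: "U \<in> unitary_group" and S: "S \<noteq> {}" "S \<noteq> UNIV"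
      and z: "\<forall>\<gamma>\<in>carrier G. \<forall>i j. (i \<in> S \<longleftrightarrow> j \<notin> S) \<longrightarrow> conj_rep G U \<rho> \<gamma> $ i $ j = 0"
      unfolding reducible_rep_def by blast
    have "conj_rep G U \<rho> \<in> Z S"
      unfolding Z_def using z conj_rep_Hom_U[OF G _ U] \<rho> by blast
    moreover have "\<rho> = conj_rep G (conj_transpose U) (conj_rep G U \<rho>)"
      using \<rho> by (simp add: conj_rep_conj_rep unitary_groupD[OF U] conj_rep_mat1)
    ultimately have "\<rho> \<in> (\<lambda>(U, \<sigma>). conj_rep G U \<sigma>) ` (unitary_group \<times> Z S)"
      using conj_transpose_unitary[OF U] by (intro image_eqI[of _ _ "(conj_transpose U, conj_rep G U \<rho>)"]) auto
    then show "\<rho> \<in> ?L"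
      using S by blast
  qed
  ultimately show ?thesis
    by simp
qed

section \<open>The quotient by conjugation with the reducibles collapsed\<close>

lemma irr_plus_proj_conj_rep:
  fixes \<rho> :: "'g \<Rightarrow> complex^'n^'n"
  shows "U \<in> unitary_group \<Longrightarrow> irr_plus_proj G (conj_rep G U \<rho>) = irr_plus_proj G \<rho>"
  by (simp add: irr_plus_proj_def reducible_rep_conj_rep rep_orbit_conj_rep)

lemma topspace_Irr_plus_top:
  fixes G :: "('g, 'b) monoid_scheme"
  shows "topspace (Irr_plus_top G :: ('g \<Rightarrow> complex^'n^'n) set option topology) =
    insert None (irr_plus_proj G ` Hom_U G)" (is "topspace ?T = ?S")
proof (rule subset_antisym)
  have "irr_plus_open G (topspace ?T)"
    using openin_topspace[of ?T] unfolding openin_Irr_plus_top .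
  then show "topspace ?T \<subseteq> ?S"
    unfolding irr_plus_open_def by (rule conjunct1)
  have "{\<rho> \<in> topspace (Hom_top G). irr_plus_proj G \<rho> \<in> ?S} = topspace (Hom_top G)"
    by auto
  then have "openin ?T ?S"
    unfolding openin_Irr_plus_top irr_plus_open_def by (simp only: openin_topspace order_refl simp_thms)
  then show "?S \<subseteq> topspace ?T"
    by (rule openin_subset)
qed

lemma continuous_map_irr_plus_proj: "continuous_map (Hom_top G) (Irr_plus_top G) (irr_plus_proj G)"
  unfolding continuous_map_def
proof (intro conjI allI impI)
  show "irr_plus_proj G \<in> topspace (Hom_top G) \<rightarrow> topspace (Irr_plus_top G)"
    unfolding topspace_Irr_plus_top by auto
  fix U assume "openin (Irr_plus_top G) U"
  then show "openin (Hom_top G) {\<rho> \<in> topspace (Hom_top G). irr_plus_proj G \<rho> \<in> U}"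
    unfolding openin_Irr_plus_top irr_plus_open_def by (rule conjunct2)
qed

text \<open>This makes the quotient map closed, from which the Hausdorff property follows.\<close>

lemma closedin_irr_plus_saturation:
  fixes C :: "('g \<Rightarrow> complex^'n^'n) set"
  assumes G: "group G" and C: "closedin (Hom_top G) C"
  shows "closedin (Hom_top G) {\<rho> \<in> Hom_U G. irr_plus_proj G \<rho> \<in> irr_plus_proj G ` C}"
proof -
  let ?R = "{\<rho> \<in> Hom_U G. reducible_rep G (\<rho> :: 'g \<Rightarrow> complex^'n^'n)}"
  let ?S = "(\<lambda>(U, \<sigma>). conj_rep G U \<sigma>) ` (unitary_group \<times> C)"
  have CH: "C \<subseteq> Hom_U G"
    using closedin_subset[OF C] by simp
  \<comment> \<open>The collapse adds all reducibles as soon as C contains one, and nothing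
    otherwise.\<close>
  define E where "E = {\<rho> \<in> ?R. \<exists>\<sigma>\<in>C. reducible_rep G \<sigma>}"
  have eq: "{\<rho> \<in> Hom_U G. irr_plus_proj G \<rho> \<in> irr_plus_proj G ` C} = ?S \<union> E" (is "?L = _")
  proof (intro subset_antisym subsetI)
    fix \<rho> assume "\<rho> \<in> ?L"
    then obtain \<sigma> where \<rho>: "\<rho> \<in> Hom_U G" and \<sigma>: "\<sigma> \<in> C" "irr_plus_proj G \<rho> = irr_plus_proj G \<sigma>"
      by auto
    show "\<rho> \<in> ?S \<union> E"
    proof (cases "reducible_rep G \<rho>")
      case True
      then have "reducible_rep G \<sigma>"
        using \<sigma> by (simp add: irr_plus_proj_def split: if_splits)
      then show ?thesis
        using True \<rho> \<sigma> by (auto simp: E_def)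
    next
      case False
      then have "rep_orbit G \<sigma> = rep_orbit G \<rho>"
        using \<sigma> by (simp add: irr_plus_proj_def split: if_splits)
      then obtain U where "U \<in> unitary_group" "\<rho> = conj_rep G U \<sigma>"
        using rep_orbit_eqD[OF _ \<rho>] by metis
      then show ?thesis
        using \<sigma> by auto
    qed
  next
    fix \<rho> assume "\<rho> \<in> ?S \<union> E"
    then show "\<rho> \<in> ?L"
    proof
      assume "\<rho> \<in> ?S"
      then obtain U \<sigma> where "U \<in> unitary_group" "\<sigma> \<in> C" "\<rho> = conj_rep G U \<sigma>"
        by auto
      then show ?thesis
        using CH conj_rep_Hom_U[OF G, of \<sigma> U] by (auto simp: irr_plus_proj_conj_rep)
    next
      assume "\<rho> \<in> E"
      then obtain \<sigma> where "\<sigma> \<in> C" "reducible_rep G \<sigma>" "\<rho> \<in> Hom_U G" "reducible_rep G \<rho>"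
        by (auto simp: E_def)
      then show ?thesis
        by (auto simp: irr_plus_proj_def intro!: image_eqI[of _ _ \<sigma>])
    qed
  qed
  have "closedin (Hom_top G) E"
    using closedin_reducible[OF G] unfolding E_def by (cases "\<exists>\<sigma>\<in>C. reducible_rep G \<sigma>") simp_all
  then show ?thesis
    unfolding eq using closedin_conj_saturation[OF G C] by (rule closedin_Un[rotated])
qed

text \<open>Fibres of the projection are compact, so two of them have disjoint open neighbourhoods.
  As the projection is closed, the points whose whole fibre lies in a given open set form an open
  set of the quotient.\<close>

lemma Hausdorff_Irr_plus_top:
  assumes G: "group G"
  shows "Hausdorff_space (Irr_plus_top G :: ('g \<Rightarrow> complex^'n^'n) set option topology)"
  unfolding Hausdorff_space_def
proof (intro allI impI)
  fix x y :: "('g \<Rightarrow> complex^'n^'n) set option"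
  assume xy: "x \<in> topspace (Irr_plus_top G) \<and> y \<in> topspace (Irr_plus_top G) \<and> x \<noteq> y"
  define F where "F z = {\<rho> \<in> Hom_U G. irr_plus_proj G \<rho> = z}" for z :: "('g \<Rightarrow> complex^'n^'n) set option"
  have F: "closedin (Hom_top G) (F z)" for z
  proof (cases "F z = {}")
    case False
    then obtain \<rho> where \<rho>: "\<rho> \<in> Hom_U G" "irr_plus_proj G \<rho> = z"
      by (auto simp: F_def)
    then have "F z = {\<sigma> \<in> Hom_U G. irr_plus_proj G \<sigma> \<in> irr_plus_proj G ` {\<rho>}}"
      by (auto simp: F_def)
    moreover have "closedin (Hom_top G) {\<rho>}"
      using closedin_Hausdorff_singleton[OF Hausdorff_Hom_top] \<rho> by auto
    ultimately show ?thesis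
      using closedin_irr_plus_saturation[OF G, of "{\<rho>}"] by (simp only:)
  qed simp
  have cF: "compactin (Hom_top G) (F z)" for z
    by (rule closedin_compact_space[OF compact_Hom_top[OF G] F])
  have dF: "disjnt (F x) (F y)"
    using xy by (auto simp: F_def disjnt_def)
  obtain U V where UV: "openin (Hom_top G) U" "openin (Hom_top G) V" "F x \<subseteq> U" "F y \<subseteq> V" "disjnt U V"
    by (rule Hausdorff_space_compact_separation[OF Hausdorff_Hom_top cF cF dF])
  \<comment> \<open>The clause on t concerns the base point without reducibles: its fibre is empty,
    hence contained in every A, and without the clause it would belong to both
    neighbourhoods.\<close>
  define W where "W A z = {t \<in> topspace (Irr_plus_top G). F t \<subseteq> A \<and> (t = z \<or> F t \<noteq> {})}" for A z
  have op: "openin (Irr_plus_top G) (W A z)" if A: "openin (Hom_top G) A" for A z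
    unfolding openin_Irr_plus_top irr_plus_open_def
  proof
    show "W A z \<subseteq> insert None (irr_plus_proj G ` Hom_U G)"
      by (auto simp: W_def topspace_Irr_plus_top)
    have "{\<rho> \<in> topspace (Hom_top G). irr_plus_proj G \<rho> \<in> W A z} =
       topspace (Hom_top G) - {\<rho> \<in> Hom_U G. irr_plus_proj G \<rho> \<in> irr_plus_proj G ` (topspace (Hom_top G) - A)}"
      unfolding W_def F_def topspace_Irr_plus_top by (auto, metis DiffI image_eqI)
    moreover have "closedin (Hom_top G) {\<rho> \<in> Hom_U G. irr_plus_proj G \<rho> \<in> irr_plus_proj G ` (topspace (Hom_top G) - A)}"
      by (intro closedin_irr_plus_saturation[OF G] closedin_diff closedin_topspace A)
    ultimately show "openin (Hom_top G) {\<rho> \<in> topspace (Hom_top G). irr_plus_proj G \<rho> \<in> W A z}"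
      by (simp only: openin_diff[OF openin_topspace])
  qed
  have "x \<in> W U x" "y \<in> W V y"
    using xy UV by (auto simp: W_def)
  moreover have "disjnt (W U x) (W V y)"
    unfolding disjnt_def
  proof (intro equals0I)
    fix t assume "t \<in> W U x \<inter> W V y"
    then have t: "F t \<subseteq> U \<inter> V" "t = x \<or> F t \<noteq> {}" "t = y \<or> F t \<noteq> {}"
      by (auto simp: W_def)
    then have "F t = {}"
      using UV(5) by (auto simp: disjnt_def)
    then show False
      using t(2,3) xy by auto
  qed
  ultimately show "\<exists>U V. openin (Irr_plus_top G) U \<and> openin (Irr_plus_top G) V \<and> x \<in> U \<and> y \<in> V \<and> disjnt U V"
    using op[OF UV(1)] op[OF UV(2)] by (intro exI[of _ "W U x"] exI[of _ "W V y"] conjI)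
qed

section \<open>The polyhedral decomposition\<close>

text \<open>If u changes from s to \<pi> s, then order preservation makes it change in the same
  direction at every further iterate, giving infinitely many values on a finite set.\<close>

lemma permutation_preserving_order:
  fixes u :: "'b \<Rightarrow> real"
  assumes fin: "finite A" and \<pi>: "\<And>s. s \<in> A \<Longrightarrow> \<pi> s \<in> A"
    and ord: "\<And>s t. s \<in> A \<Longrightarrow> t \<in> A \<Longrightarrow> u s < u t \<longleftrightarrow> u (\<pi> s) < u (\<pi> t)" and s: "s \<in> A"
  shows "u (\<pi> s) = u s"
proof (rule ccontr)
  assume ne: "u (\<pi> s) \<noteq> u s"
  have A: "(\<pi> ^^ n) s \<in> A" for n
    by (induction n) (auto simp: s \<pi>)
  have up: "u ((\<pi> ^^ n) s) < u ((\<pi> ^^ Suc n) s)" if "u s < u (\<pi> s)" for n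
  proof (induction n)
    case (Suc n)
    then show ?case
      using ord[OF A[of n] A[of "Suc n"]] by simp
  qed (use that in simp)
  have down: "u ((\<pi> ^^ Suc n) s) < u ((\<pi> ^^ n) s)" if "u (\<pi> s) < u s" for n
  proof (induction n)
    case (Suc n)
    then show ?case
      using ord[OF A[of "Suc n"] A[of n]] by simp
  qed (use that in simp)
  have "inj (\<lambda>n. u ((\<pi> ^^ n) s))"
  proof (cases "u s < u (\<pi> s)")
    case True
    then have "strict_mono (\<lambda>n. u ((\<pi> ^^ n) s))"
      using up by (intro strict_monoI_Suc) blast
    then show ?thesis
      by (rule strict_mono_imp_inj_on)
  next
    case False
    then have "u (\<pi> s) < u s"
      using ne by linarith
    then have "strict_mono (\<lambda>n. - u ((\<pi> ^^ n) s))"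
      using down by (intro strict_monoI_Suc) simp
    then have "inj (\<lambda>n. - u ((\<pi> ^^ n) s))"
      by (rule strict_mono_imp_inj_on)
    then show ?thesis
      by (simp add: inj_def)
  qed
  moreover have "range (\<lambda>n. u ((\<pi> ^^ n) s)) \<subseteq> u ` A"
    using A by auto
  ultimately show False
    using fin by (meson finite_imageI finite_subset infinite_UNIV_nat finite_imageD)
qed

context lattice_extension
begin

section \<open>Real homomorphisms of the lattice and the action of G on them\<close>

sublocale N: normal N G
  by (rule normal)

text \<open>The value 0 outside N makes equality of functions the same as equality on N.\<close>

definition V :: "('a \<Rightarrow> real) set" where
  "V = {x. (\<forall>a\<in>N. \<forall>b\<in>N. x (a \<otimes> b) = x a + x b) \<and> (\<forall>a. a \<notin> N \<longrightarrow> x a = 0)}"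

text \<open>The left action dual to conjugation. On V it factors through the finite quotient of G by
  N, because N is abelian.\<close>

definition act :: "'a \<Rightarrow> ('a \<Rightarrow> real) \<Rightarrow> 'a \<Rightarrow> real" where
  "act g x = (\<lambda>a. if a \<in> N then x (inv g \<otimes> a \<otimes> g) else 0)"

text \<open>Within V these are the homomorphisms x whose character exp (2 pi \<i> x) is
  trivial.\<close>

definition integral_on_N :: "('a \<Rightarrow> real) \<Rightarrow> bool" where
  "integral_on_N x \<longleftrightarrow> (\<forall>a\<in>N. x a \<in> \<int>)"

lemma V_mult: "x \<in> V \<Longrightarrow> a \<in> N \<Longrightarrow> b \<in> N \<Longrightarrow> x (a \<otimes> b) = x a + x b"
  by (simp add: V_def)

lemma V_outside: "x \<in> V \<Longrightarrow> a \<notin> N \<Longrightarrow> x a = 0"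
  by (simp add: V_def)

lemma V_one: "x \<in> V \<Longrightarrow> x \<one> = 0"
  using V_mult[of x \<one> \<one>] by simp

lemma V_inv: "x \<in> V \<Longrightarrow> a \<in> N \<Longrightarrow> x (inv a) = - x a"
  using V_mult[of x a "inv a"] V_one[of x] by simp

lemma V_add: "x \<in> V \<Longrightarrow> y \<in> V \<Longrightarrow> x + y \<in> V"
  by (simp add: V_def)

lemma V_diff: "x \<in> V \<Longrightarrow> y \<in> V \<Longrightarrow> x - y \<in> V"
  by (simp add: V_def)

lemma V_scale: "x \<in> V \<Longrightarrow> (\<lambda>a. c * x a) \<in> V"
  by (simp add: V_def algebra_simps)

lemma V_zero: "0 \<in> V"
  by (simp add: V_def)

lemma conj_in_N: "g \<in> carrier G \<Longrightarrow> a \<in> N \<Longrightarrow> inv g \<otimes> a \<otimes> g \<in> N"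
  by (rule N.inv_op_closed1)

lemma conj_mult:
  assumes "g \<in> carrier G" "a \<in> carrier G" "b \<in> carrier G"
  shows "inv g \<otimes> (a \<otimes> b) \<otimes> g = (inv g \<otimes> a \<otimes> g) \<otimes> (inv g \<otimes> b \<otimes> g)"
proof -
  have "(inv g \<otimes> a \<otimes> g) \<otimes> (inv g \<otimes> b \<otimes> g) = inv g \<otimes> a \<otimes> (g \<otimes> inv g) \<otimes> b \<otimes> g"
    using assms by (simp only: m_assoc m_closed inv_closed)
  then show ?thesis
    using assms by (simp add: m_assoc)
qed

lemma conj_inv:
  assumes "g \<in> carrier G" "a \<in> carrier G"
  shows "inv g \<otimes> inv a \<otimes> g = inv (inv g \<otimes> a \<otimes> g)"
  using assms by (simp add: inv_mult_group m_assoc)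

lemma conj_conj:
  assumes "g \<in> carrier G" "h \<in> carrier G" "a \<in> carrier G"
  shows "inv h \<otimes> (inv g \<otimes> a \<otimes> g) \<otimes> h = inv (g \<otimes> h) \<otimes> a \<otimes> (g \<otimes> h)"
  using assms by (simp add: inv_mult_group m_assoc)

lemma act_apply: "a \<in> N \<Longrightarrow> act g x a = x (inv g \<otimes> a \<otimes> g)"
  by (simp add: act_def)

lemma act_V: "g \<in> carrier G \<Longrightarrow> x \<in> V \<Longrightarrow> act g x \<in> V"
  unfolding V_def act_def by (auto simp: conj_mult conj_in_N V_mult V_def)

lemma act_act:
  assumes "g \<in> carrier G" "h \<in> carrier G"
  shows "act g (act h x) = act (g \<otimes> h) x"
  using assms by (auto simp: act_def fun_eq_iff conj_in_N conj_conj)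

lemma act_N:
  assumes "n \<in> N" "x \<in> V"
  shows "act n x = x"
proof
  fix a
  have "inv n \<otimes> a \<otimes> n = a" if "a \<in> N"
    using that assms N_commute[of a n] by (simp add: m_assoc) (simp flip: m_assoc)
  then show "act n x a = x a"
    using assms by (simp add: act_def V_outside)
qed

lemma act_one: "x \<in> V \<Longrightarrow> act \<one> x = x"
  by (rule act_N) auto

lemma act_inv_act: "g \<in> carrier G \<Longrightarrow> x \<in> V \<Longrightarrow> act (inv g) (act g x) = x"
  by (simp add: act_act act_one)

lemma act_diff: "act g (x - y) = act g x - act g y"
  by (simp add: act_def fun_eq_iff)

lemma act_add: "act g (x + y) = act g x + act g y"
  by (simp add: act_def fun_eq_iff)

lemma act_zero: "act g 0 = 0"
  by (simp add: act_def fun_eq_iff)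

lemma integral_act: "g \<in> carrier G \<Longrightarrow> integral_on_N x \<Longrightarrow> integral_on_N (act g x)"
  by (auto simp: integral_on_N_def act_def conj_in_N)

lemma integral_diff: "integral_on_N x \<Longrightarrow> integral_on_N y \<Longrightarrow> integral_on_N (x - y)"
  by (auto simp: integral_on_N_def)

lemma V_values_from_S:
  assumes x: "x \<in> V" and \<Lambda>: "0 \<in> \<Lambda>" "\<And>s t. s \<in> \<Lambda> \<Longrightarrow> t \<in> \<Lambda> \<Longrightarrow> s + t \<in> \<Lambda>" "\<And>s. s \<in> \<Lambda> \<Longrightarrow> - s \<in> \<Lambda>"
    and S: "\<And>s. s \<in> S \<Longrightarrow> x s \<in> \<Lambda>" and a: "a \<in> N"
  shows "x a \<in> \<Lambda>"
proof -
  have "subgroup {a\<in>N. x a \<in> \<Lambda>} G"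
    by unfold_locales (auto simp: V_one[OF x] V_inv[OF x] V_mult[OF x] \<Lambda>)
  then have "N \<subseteq> {a\<in>N. x a \<in> \<Lambda>}"
    using S S_subset by (intro S_generates) auto
  then show ?thesis
    using a by blast
qed

lemma V_eq_on_S:
  assumes "x \<in> V" "y \<in> V" "\<And>s. s \<in> S \<Longrightarrow> x s = y s"
  shows "x = y"
proof
  fix a
  have "(x - y) a \<in> {0}" if "a \<in> N"
    using assms by (intro V_values_from_S[OF V_diff _ _ _ _ that]) auto
  then show "x a = y a"
    using V_outside[OF assms(1)] V_outside[OF assms(2)] by (cases "a \<in> N") auto
qed

text \<open>Every unitary character of N comes from a point of V: h is an arbitrary choice of
  normalized arguments of the character, so it is additive only modulo integers.\<close>

lemma lift_character:
  assumes h: "\<And>a b. a \<in> N \<Longrightarrow> b \<in> N \<Longrightarrow> h (a \<otimes> b) - h a - h b \<in> \<int>"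
  obtains x where "x \<in> V" "\<And>a. a \<in> N \<Longrightarrow> h a - x a \<in> \<int>"
proof -
  have "\<exists>v. \<forall>a\<in>N. h a - (\<Sum>i<k. v i * real_of_int (p a i)) \<in> \<int>"
    by (rule lattice_hom_mod[OF N.subgroup_axioms]) (simp_all add: p_mult p_inj h)
  then obtain v where v: "\<forall>a\<in>N. h a - (\<Sum>i<k. v i * real_of_int (p a i)) \<in> \<int>" ..
  define x where "x a = (if a \<in> N then (\<Sum>i<k. v i * real_of_int (p a i)) else 0)" for a
  have "x \<in> V"
    by (auto simp: V_def x_def p_mult distrib_left sum.distrib)
  moreover have "h a - x a \<in> \<int>" if "a \<in> N" for a
    using v that by (simp add: x_def)
  ultimately show ?thesis
    by (rule that)
qed

lemma V_coordinates:
  assumes "x \<in> V"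
  obtains v where "\<And>a. a \<in> N \<Longrightarrow> x a = (\<Sum>i<k. v i * real_of_int (p a i))"
proof -
  have "\<exists>v. \<forall>a\<in>N. x a - (\<Sum>i<k. v i * real_of_int (p a i)) \<in> {0}"
    by (rule lattice_hom_mod[OF N.subgroup_axioms]) (simp_all add: p_mult p_inj V_mult[OF assms])
  then obtain v where "\<forall>a\<in>N. x a - (\<Sum>i<k. v i * real_of_int (p a i)) \<in> {0}" ..
  then have "x a = (\<Sum>i<k. v i * real_of_int (p a i))" if "a \<in> N" for a
    using that by simp
  then show ?thesis
    by (rule that)
qed

text \<open>Evaluating x at \<open>s \<otimes> inv t\<close> gives \<open>x s - x t\<close>, so the
  hyperplanes are the integer levels of evaluation at these elements.\<close>

definition Phi :: "'a set" where
  "Phi = (\<lambda>(s, t). s \<otimes> inv t) ` (S \<times> S)"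

lemma finite_Phi: "finite Phi"
  using finite_S by (simp add: Phi_def)

lemma Phi_subset: "Phi \<subseteq> N"
  using S_subset by (auto simp: Phi_def)

lemma PhiI: "s \<in> S \<Longrightarrow> t \<in> S \<Longrightarrow> s \<otimes> inv t \<in> Phi"
  by (auto simp: Phi_def)

lemma S_Phi: "S \<subseteq> Phi"
proof
  fix s assume s: "s \<in> S"
  then have "s \<otimes> inv \<one> = s"
    using S_subset by auto
  then show "s \<in> Phi"
    using PhiI[OF s one_S] by simp
qed

lemma S_in_N: "s \<in> S \<Longrightarrow> s \<in> N"
  using S_subset by blast

lemma Phi_in_N: "f \<in> Phi \<Longrightarrow> f \<in> N"
  using Phi_subset by blast

lemma Phi_conj:
  assumes g: "g \<in> carrier G" and f: "f \<in> Phi"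
  shows "inv g \<otimes> f \<otimes> g \<in> Phi"
proof -
  obtain s t where st: "s \<in> S" "t \<in> S" "f = s \<otimes> inv t"
    using f by (auto simp: Phi_def)
  then have "inv g \<otimes> f \<otimes> g = (inv g \<otimes> s \<otimes> g) \<otimes> inv (inv g \<otimes> t \<otimes> g)"
    using g S_in_N by (simp add: conj_mult conj_inv)
  then show ?thesis
    using PhiI S_conj g st by simp
qed

text \<open>Floor and ceiling together tell whether a value is an integer, and otherwise which open
  unit interval contains it. The face is thus cut out by equations for the integral forms and strict
  inequalities for the others.\<close>

definition face :: "('a \<Rightarrow> real) \<Rightarrow> ('a \<Rightarrow> real) set" where
  "face x = {y \<in> V. \<forall>f\<in>Phi. \<lfloor>y f\<rfloor> = \<lfloor>x f\<rfloor> \<and> \<lceil>y f\<rceil> = \<lceil>x f\<rceil>}"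

text \<open>At a form where x is integral both bounds coincide, so the hyperplanes through x are
  kept as equations.\<close>

definition closed_face :: "('a \<Rightarrow> real) \<Rightarrow> ('a \<Rightarrow> real) set" where
  "closed_face x = {y \<in> V. \<forall>f\<in>Phi. of_int \<lfloor>x f\<rfloor> \<le> y f \<and> y f \<le> of_int \<lceil>x f\<rceil>}"

lemma face_V: "y \<in> face x \<Longrightarrow> y \<in> V"
  by (simp add: face_def)

lemma closed_face_V: "y \<in> closed_face x \<Longrightarrow> y \<in> V"
  by (simp add: closed_face_def)

lemma face_subset_closed_face: "face x \<subseteq> closed_face x"
proof
  fix y assume y: "y \<in> face x"
  have "of_int \<lfloor>x f\<rfloor> \<le> y f \<and> y f \<le> of_int \<lceil>x f\<rceil>" if "f \<in> Phi" for f
  proof -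
    have "\<lfloor>y f\<rfloor> = \<lfloor>x f\<rfloor>" "\<lceil>y f\<rceil> = \<lceil>x f\<rceil>"
      using y that by (auto simp: face_def)
    then show ?thesis
      by (metis of_int_floor_le le_of_int_ceiling)
  qed
  then show "y \<in> closed_face x"
    using y by (simp add: closed_face_def face_def)
qed

lemma face_refl: "x \<in> V \<Longrightarrow> x \<in> face x"
  by (simp add: face_def)

lemma face_eq: "y \<in> face x \<Longrightarrow> face y = face x"
  by (auto simp: face_def)

lemma closed_face_eq: "y \<in> face x \<Longrightarrow> closed_face y = closed_face x"
  by (auto simp: face_def closed_face_def)

text \<open>If \<open>h\<close> fixes \<open>x\<close> modulo integral homomorphisms, then \<open>x\<close> is integral at
  \<open>(inv h \<otimes> s \<otimes> h) \<otimes> inv s\<close>, hence so is every point of the closed face.\<close>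
lemma stabilizer_fixes_closed_face:
  assumes x: "x \<in> V" and h: "h \<in> carrier G" and int: "integral_on_N (act h x - x)" and y: "y \<in> closed_face x"
  shows "act h (y - x) = y - x"
proof (rule V_eq_on_S)
  have yV: "y \<in> V"
    using y by (rule closed_face_V)
  show "y - x \<in> V" "act h (y - x) \<in> V"
    using x yV h by (auto intro!: V_diff act_V)
  fix s assume s: "s \<in> S"
  let ?f = "(inv h \<otimes> s \<otimes> h) \<otimes> inv s"
  have f: "?f \<in> Phi"
    using S_conj[OF h s] s by (rule PhiI)
  have eval: "z ?f = (act h z - z) s" if "z \<in> V" for z
    using that s h S_in_N[OF s] by (simp add: act_apply V_mult V_inv conj_in_N)
  have "x ?f \<in> \<int>"
    using int S_in_N[OF s] eval[OF x] by (simp add: integral_on_N_def)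
  then obtain n where n: "x ?f = of_int n"
    by (auto elim: Ints_cases)
  have "of_int \<lfloor>x ?f\<rfloor> \<le> y ?f \<and> y ?f \<le> of_int \<lceil>x ?f\<rceil>"
    using y f unfolding closed_face_def by blast
  then have "y ?f = x ?f"
    unfolding n by simp
  then show "act h (y - x) s = (y - x) s"
    using eval[OF x] eval[OF yV] by (simp add: act_diff)
qed

text \<open>Applying \<open>inv h\<close> turns the hypothesis into a statement about the stabilizer
  of x. The congruence of two weights at x thereby becomes an exact equality of the displacements
  along the closed face.\<close>

lemma act_eq_on_closed_face:
  assumes x: "x \<in> V" and g: "g \<in> carrier G" and h: "h \<in> carrier G"
    and int: "integral_on_N (act g x - act h x)" and y: "y \<in> closed_face x"
  shows "act g (y - x) = act h (y - x)"
proof -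
  have yV: "y \<in> V"
    using y by (rule closed_face_V)
  have "act (inv h) (act g x - act h x) = act (inv h \<otimes> g) x - x"
    using x g h by (simp add: act_diff act_act act_inv_act act_one)
  then have "integral_on_N (act (inv h \<otimes> g) x - x)"
    using integral_act[OF _ int, of "inv h"] h by simp
  then have "act (inv h \<otimes> g) (y - x) = y - x"
    using x y g h by (intro stabilizer_fixes_closed_face) auto
  then have "act h (act (inv h \<otimes> g) (y - x)) = act h (y - x)"
    by simp
  then show ?thesis
    using g h by (simp add: act_act m_assoc[symmetric])
qed

lemma integral_value: "integral_on_N l \<Longrightarrow> a \<in> N \<Longrightarrow> \<exists>n. l a = of_int n"
  by (auto simp: integral_on_N_def elim: Ints_cases)

text \<open>G permutes \<open>Phi\<close> by conjugation, and an integral homomorphism shifts floors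
  and ceilings by the same integer.\<close>

lemma affine_act_face:
  assumes g: "g \<in> carrier G" and l: "l \<in> V" "integral_on_N l"
  shows "y \<in> face x \<Longrightarrow> act g y + l \<in> face (act g x + l)"
    and "y \<in> closed_face x \<Longrightarrow> act g y + l \<in> closed_face (act g x + l)"
proof -
  have *: "\<exists>n. (act g z + l) f = z (inv g \<otimes> f \<otimes> g) + of_int n \<and> (act g w + l) f = w (inv g \<otimes> f \<otimes> g) + of_int n"
    if "f \<in> Phi" for f z w
    using integral_value[OF l(2), of f] Phi_in_N[OF that] by (auto simp: act_apply)
  show "act g y + l \<in> face (act g x + l)" if y: "y \<in> face x"
    unfolding face_def
  proof (intro CollectI conjI ballI)
    show "act g y + l \<in> V"
      using face_V[OF y] g l by (intro V_add act_V)
    fix f assume f: "f \<in> Phi"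
    have "\<lfloor>y (inv g \<otimes> f \<otimes> g)\<rfloor> = \<lfloor>x (inv g \<otimes> f \<otimes> g)\<rfloor>" "\<lceil>y (inv g \<otimes> f \<otimes> g)\<rceil> = \<lceil>x (inv g \<otimes> f \<otimes> g)\<rceil>"
      using y Phi_conj[OF g f] by (auto simp: face_def)
    then show "\<lfloor>(act g y + l) f\<rfloor> = \<lfloor>(act g x + l) f\<rfloor>" "\<lceil>(act g y + l) f\<rceil> = \<lceil>(act g x + l) f\<rceil>"
      using *[OF f, of y x] by auto
  qed
  show "act g y + l \<in> closed_face (act g x + l)" if y: "y \<in> closed_face x"
    unfolding closed_face_def
  proof (intro CollectI conjI ballI)
    show "act g y + l \<in> V"
      using closed_face_V[OF y] g l by (intro V_add act_V)
    fix f assume f: "f \<in> Phi"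
    have "of_int \<lfloor>x (inv g \<otimes> f \<otimes> g)\<rfloor> \<le> y (inv g \<otimes> f \<otimes> g)" "y (inv g \<otimes> f \<otimes> g) \<le> of_int \<lceil>x (inv g \<otimes> f \<otimes> g)\<rceil>"
      using y Phi_conj[OF g f] by (auto simp: closed_face_def)
    then show "of_int \<lfloor>(act g x + l) f\<rfloor> \<le> (act g y + l) f" "(act g y + l) f \<le> of_int \<lceil>(act g x + l) f\<rceil>"
      using *[OF f, of x y] by auto
  qed
qed

text \<open>The face of \<open>x\<close> records the order of the fractional parts of the values \<open>x s\<close>, and \<open>g\<close> permutes
  these fractional parts.\<close>
lemma affine_act_fixes_face:
  assumes x: "x \<in> V" and g: "g \<in> carrier G" and l: "l \<in> V" "integral_on_N l"
    and face: "act g x + l \<in> face x"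
  shows "act g x + l = x"
proof (rule V_eq_on_S)
  define y where "y = act g x + l"
  have yV: "y \<in> V"
    using face face_V by (simp add: y_def)
  show "act g x + l \<in> V" "x \<in> V"
    using x yV by (auto simp: y_def)
  have fl: "\<lfloor>y f\<rfloor> = \<lfloor>x f\<rfloor>" if "f \<in> Phi" for f
    using face that by (auto simp: face_def y_def)
  let ?\<pi> = "\<lambda>s. inv g \<otimes> s \<otimes> g"
  have fr: "frac (y s) = frac (x (?\<pi> s))" if "s \<in> S" for s
  proof -
    obtain n where "l s = of_int n"
      using integral_value[OF l(2)] S_in_N \<open>s \<in> S\<close> by blast
    then have "y s = x (?\<pi> s) + of_int n"
      using S_in_N[OF that] by (simp add: y_def act_apply)
    then show ?thesis
      by (simp add: frac_def)
  qed
  have floor_diff: "\<lfloor>a - b\<rfloor> = \<lfloor>a\<rfloor> - \<lfloor>b\<rfloor> + (if frac a < frac b then -1 else 0)" for a b :: real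
    unfolding frac_def by (rule floor_unique) (auto; linarith)+
  \<comment> \<open>By \<open>floor_diff\<close>, a difference borrows 1 exactly when the first
    fractional part is smaller. The floors of x and y agree at s, at t and at the difference, so the
    borrow agrees too.\<close>
  have ordS: "frac (x s) < frac (x t) \<longleftrightarrow> frac (y s) < frac (y t)" if s: "s \<in> S" and t: "t \<in> S" for s t
  proof -
    have ev: "z (s \<otimes> inv t) = z s - z t" if "z \<in> V" for z
      using that s t S_in_N by (simp add: V_mult V_inv)
    have "\<lfloor>y s - y t\<rfloor> = \<lfloor>x s - x t\<rfloor>"
      using fl[OF PhiI[OF s t]] ev[OF x] ev[OF yV] by simp
    moreover have "\<lfloor>y s\<rfloor> = \<lfloor>x s\<rfloor>" "\<lfloor>y t\<rfloor> = \<lfloor>x t\<rfloor>"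
      using fl S_Phi s t by auto
    ultimately show ?thesis
      by (auto simp: floor_diff split: if_splits)
  qed
  fix s assume s: "s \<in> S"
  have "frac (x (?\<pi> s)) = frac (x s)"
  proof (rule permutation_preserving_order[OF finite_S, where u = "\<lambda>s. frac (x s)" and \<pi> = ?\<pi>, OF _ _ s])
    show "?\<pi> s \<in> S" if "s \<in> S" for s
      using S_conj[OF g that] .
    show "frac (x s) < frac (x t) \<longleftrightarrow> frac (x (?\<pi> s)) < frac (x (?\<pi> t))" if "s \<in> S" "t \<in> S" for s t
      using ordS[OF that] fr that by simp
  qed
  then have "frac (y s) = frac (x s)"
    using fr[OF s] by simp
  then show "(act g x + l) s = x s"
    using fl[of s] s S_Phi by (auto simp: frac_def y_def)
qed

section \<open>Coset representatives and the averaged transfer\<close>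

definition coset_rep :: "'a \<Rightarrow> 'a" where
  "coset_rep g = (SOME h. h \<in> N #> g)"

definition R :: "'a set" where
  "R = coset_rep ` carrier G"

lemma coset_rep_eq:
  assumes "g \<in> carrier G"
  obtains n where "n \<in> N" "coset_rep g = n \<otimes> g"
proof -
  have "coset_rep g \<in> N #> g"
    unfolding coset_rep_def using rcos_self[OF assms N.subgroup_axioms] by (rule someI)
  then show ?thesis
    using that by (auto simp: r_coset_def)
qed

lemma coset_rep_closed: "g \<in> carrier G \<Longrightarrow> coset_rep g \<in> carrier G"
  by (metis coset_rep_eq m_closed N.mem_carrier)

lemma R_closed: "d \<in> R \<Longrightarrow> d \<in> carrier G"
  by (auto simp: R_def coset_rep_closed)

lemma coset_rep_in_R: "g \<in> carrier G \<Longrightarrow> coset_rep g \<in> R"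
  by (simp add: R_def)

lemma finite_R: "finite R"
proof -
  have "R \<subseteq> (\<lambda>C. SOME h. h \<in> C) ` (rcosets N)"
    by (auto simp: R_def coset_rep_def RCOSETS_def)
  then show ?thesis
    using finite_index finite_surj by blast
qed

lemma card_R: "card R > 0"
  using finite_R coset_rep_in_R[OF one_closed] card_gt_0_iff by blast

lemma coset_rep_mult_left:
  assumes "n \<in> N" "g \<in> carrier G"
  shows "coset_rep (n \<otimes> g) = coset_rep g"
proof -
  have "N #> (n \<otimes> g) = N #> g"
    using assms by (metis N.mem_carrier N.subset coset_join2 coset_mult_assoc N.subgroup_axioms)
  then show ?thesis
    by (simp add: coset_rep_def)
qed

lemma coset_rep_mult_coset_rep:
  assumes g: "g \<in> carrier G" and h: "h \<in> carrier G"
  shows "coset_rep (g \<otimes> coset_rep h) = coset_rep (g \<otimes> h)"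
proof -
  obtain n where n: "n \<in> N" "coset_rep h = n \<otimes> h"
    using coset_rep_eq[OF h] by blast
  then have "g \<otimes> coset_rep h = (g \<otimes> n \<otimes> inv g) \<otimes> (g \<otimes> h)"
    using g h by (simp add: m_assoc) (simp flip: m_assoc)
  moreover have "g \<otimes> n \<otimes> inv g \<in> N"
    using n g N.inv_op_closed2 by blast
  ultimately show ?thesis
    using g h coset_rep_mult_left by simp
qed

lemma coset_rep_R: "d \<in> R \<Longrightarrow> coset_rep d = d"
  using coset_rep_mult_coset_rep[of \<one>] by (auto simp: R_def coset_rep_closed)

text \<open>Since N is normal, left translation by g acts on its right cosets and so permutes their
  representatives; the inverse permutation comes from \<open>inv g\<close>.\<close>

lemma sum_R_shift:
  assumes g: "g \<in> carrier G"
  shows "(\<Sum>d\<in>R. F (coset_rep (g \<otimes> d))) = (\<Sum>d\<in>R. F d)"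
proof (rule sum.reindex_bij_witness[where i = "\<lambda>d. coset_rep (inv g \<otimes> d)" and j = "\<lambda>d. coset_rep (g \<otimes> d)"])
  fix d assume d: "d \<in> R"
  note dc = R_closed[OF d]
  show "coset_rep (inv g \<otimes> coset_rep (g \<otimes> d)) = d"
    using g dc d by (simp add: coset_rep_mult_coset_rep coset_rep_R flip: m_assoc)
  show "coset_rep (g \<otimes> coset_rep (inv g \<otimes> d)) = d"
    using g dc d by (simp add: coset_rep_mult_coset_rep coset_rep_R flip: m_assoc)
  show "coset_rep (g \<otimes> d) \<in> R" "coset_rep (inv g \<otimes> d) \<in> R"
    using g dc by (auto intro: coset_rep_in_R)
qed simp

text \<open>The averaged transfer; it extends a homomorphism \<open>N \<rightarrow> \<real>\<close> to a crossed homomorphism of \<open>G\<close>.\<close>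
definition transfer :: "'a \<Rightarrow> ('a \<Rightarrow> real) \<Rightarrow> real" where
  "transfer g x = (\<Sum>d\<in>R. x (d \<otimes> inv (coset_rep (g \<otimes> d)) \<otimes> g)) / card R"

lemma transfer_add: "transfer g (x + y) = transfer g x + transfer g y"
  by (simp add: transfer_def sum.distrib add_divide_distrib)

lemma transfer_zero: "transfer g 0 = 0"
  by (simp add: transfer_def)

lemma transfer_arg_in_N:
  assumes "g \<in> carrier G" "d \<in> carrier G"
  shows "d \<otimes> inv (coset_rep (g \<otimes> d)) \<otimes> g \<in> N"
proof -
  have gd: "g \<otimes> d \<in> carrier G"
    using assms by simp
  obtain n where n: "n \<in> N" "coset_rep (g \<otimes> d) = n \<otimes> (g \<otimes> d)"
    by (rule coset_rep_eq[OF gd])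
  then have "d \<otimes> inv (coset_rep (g \<otimes> d)) \<otimes> g = d \<otimes> (inv d \<otimes> inv g \<otimes> inv n) \<otimes> g"
    using assms by (simp add: inv_mult_group m_assoc)
  also have "\<dots> = inv g \<otimes> inv n \<otimes> g"
    using assms n by (simp add: m_assoc) (simp flip: m_assoc)
  also have "\<dots> \<in> N"
    using n assms by (intro conj_in_N) auto
  finally show ?thesis .
qed

lemma transfer_N:
  assumes n: "n \<in> N" and x: "x \<in> V"
  shows "transfer n x = x n"
proof -
  have "d \<otimes> inv (coset_rep (n \<otimes> d)) \<otimes> n = n" if "d \<in> R" for d
    using that n coset_rep_mult_left[OF n R_closed[OF that]] coset_rep_R R_closed by simp
  then have "transfer n x = (\<Sum>d\<in>R. x n) / card R"
    unfolding transfer_def by simp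
  then show ?thesis
    using card_R by simp
qed

text \<open>Write t g d for the argument in \<open>transfer\<close>, and e for the representative of
  h d. Then t (g h) d is the product of t h d and the conjugate of t g e by h; applying x and
  shifting the sum over e gives the cocycle identity.\<close>

lemma transfer_mult:
  assumes g: "g \<in> carrier G" and h: "h \<in> carrier G" and x: "x \<in> V"
  shows "transfer (g \<otimes> h) x = transfer g (act h x) + transfer h x"
proof -
  let ?t = "\<lambda>g d. d \<otimes> inv (coset_rep (g \<otimes> d)) \<otimes> g"
  have "x (?t (g \<otimes> h) d) = act h x (?t g (coset_rep (h \<otimes> d))) + x (?t h d)" if d: "d \<in> R" for d
  proof -
    note dc = R_closed[OF d]
    let ?e = "coset_rep (h \<otimes> d)"
    have e: "?e \<in> carrier G"
      using h dc by (intro coset_rep_closed) auto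
    have ge: "coset_rep (g \<otimes> ?e) = coset_rep (g \<otimes> h \<otimes> d)"
      using g h dc by (simp add: coset_rep_mult_coset_rep m_assoc)
    let ?c = "coset_rep (g \<otimes> h \<otimes> d)"
    have c: "?c \<in> carrier G"
      using g h dc by (intro coset_rep_closed) auto
    have "?t h d \<otimes> (inv h \<otimes> ?t g ?e \<otimes> h) = d \<otimes> (inv ?e \<otimes> ((h \<otimes> inv h) \<otimes> (?e \<otimes> inv ?c \<otimes> g \<otimes> h)))"
      using g h dc e c unfolding ge by (simp only: m_assoc m_closed inv_closed)
    also have "\<dots> = d \<otimes> (inv ?e \<otimes> ?e) \<otimes> (inv ?c \<otimes> g \<otimes> h)"
      using g h dc e c by (simp only: r_inv l_one m_assoc m_closed inv_closed)
    also have "\<dots> = ?t (g \<otimes> h) d"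
      using g h dc e c by (simp add: m_assoc)
    finally have eq: "?t (g \<otimes> h) d = ?t h d \<otimes> (inv h \<otimes> ?t g ?e \<otimes> h)"
      by simp
    have "?t g ?e \<in> N" "?t h d \<in> N"
      using g h dc e by (auto intro: transfer_arg_in_N)
    then show ?thesis
      unfolding eq using h x by (simp add: V_mult conj_in_N act_apply)
  qed
  then have "(\<Sum>d\<in>R. x (?t (g \<otimes> h) d)) = (\<Sum>d\<in>R. act h x (?t g (coset_rep (h \<otimes> d)))) + (\<Sum>d\<in>R. x (?t h d))"
    by (simp add: sum.distrib)
  also have "(\<Sum>d\<in>R. act h x (?t g (coset_rep (h \<otimes> d)))) = (\<Sum>d\<in>R. act h x (?t g d))"
    by (rule sum_R_shift[OF h])
  finally show ?thesis
    by (simp add: transfer_def add_divide_distrib)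
qed

end

section \<open>Twisting representations\<close>

definition circ :: "real \<Rightarrow> complex" where
  "circ t = cis (2 * pi * t)"

lemma circ_add: "circ (s + t) = circ s * circ t"
  by (simp add: circ_def cis_mult distrib_left)

lemma circ_zero [simp]: "circ 0 = 1"
  by (simp add: circ_def)

lemma circ_cnj: "circ t * cnj (circ t) = 1"
  by (simp add: circ_def cis_cnj cis_mult)

lemma circ_eq_iff: "circ s = circ t \<longleftrightarrow> s - t \<in> \<int>"
proof -
  have "circ s = circ t \<longleftrightarrow> (\<exists>n::int. \<i> * (2 * pi * s) = \<i> * (2 * pi * t) + of_int (2 * n) * pi * \<i>)"
    unfolding circ_def cis_conv_exp exp_eq by simp
  also have "\<dots> \<longleftrightarrow> (\<exists>n::int. s = t + of_int n)"
  proof (intro iff_exI)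
    fix n :: int
    have "\<i> * (2 * pi * s) = \<i> * (2 * pi * t) + of_int (2 * n) * pi * \<i> \<longleftrightarrow>
       (\<i> * (2 * pi)) * complex_of_real s = (\<i> * (2 * pi)) * complex_of_real (t + of_int n)"
      by (simp add: algebra_simps)
    also have "\<dots> \<longleftrightarrow> s = t + of_int n"
      by (simp del: of_real_add)
    finally show "\<i> * (2 * pi * s) = \<i> * (2 * pi * t) + of_int (2 * n) * pi * \<i> \<longleftrightarrow> s = t + of_int n" .
  qed
  also have "\<dots> \<longleftrightarrow> s - t \<in> \<int>"
    by (auto simp: algebra_simps elim!: Ints_cases)
  finally show ?thesis .
qed

lemma circ_surj:
  assumes "cmod z = 1"
  shows "\<exists>t. z = circ t"
proof
  have "z \<noteq> 0"
    using assms by auto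
  then show "z = circ (Arg z / (2 * pi))"
    using assms cis_Arg[of z] by (simp add: circ_def sgn_div_norm)
qed

lemma continuous_on_circ [continuous_intros]:
  "continuous_on A f \<Longrightarrow> continuous_on A (\<lambda>x. circ (f x))"
  unfolding circ_def by (intro continuous_intros)

context lattice_extension
begin

text \<open>The element \<open>g j\<close> carries the single weight x to the weight of the j-th
  basis vector. It is determined only up to elements fixing x modulo integral homomorphisms.\<close>

definition standard_form :: "('a \<Rightarrow> complex^'n^'n) \<Rightarrow> ('n \<Rightarrow> 'a) \<Rightarrow> ('a \<Rightarrow> real) \<Rightarrow> bool" where
  "standard_form \<rho> g x \<longleftrightarrow> \<rho> \<in> Hom_U G \<and> x \<in> V \<and> range g \<subseteq> carrier G \<and>
     (\<forall>a\<in>N. \<rho> a = (\<chi> i j. if i = j then circ (act (g j) x a) else 0))"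

text \<open>The displacement u of the weight x becomes \<open>act (g j) u\<close> at the j-th basis
  vector, and column j of each matrix receives the phase of the transfer of that
  displacement.\<close>

definition deform :: "('a \<Rightarrow> complex^'n^'n) \<Rightarrow> ('n \<Rightarrow> 'a) \<Rightarrow> ('a \<Rightarrow> real) \<Rightarrow> 'a \<Rightarrow> complex^'n^'n" where
  "deform \<rho> g u = (\<lambda>\<gamma>\<in>carrier G. \<chi> i j. \<rho> \<gamma> $ i $ j * circ (transfer \<gamma> (act (g j) u)))"

lemma deform_nth:
  "\<gamma> \<in> carrier G \<Longrightarrow> deform \<rho> g u \<gamma> $ i $ j = \<rho> \<gamma> $ i $ j * circ (transfer \<gamma> (act (g j) u))"
  by (simp add: deform_def)

lemma standard_formD:
  assumes "standard_form \<rho> g x"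
  shows "\<rho> \<in> Hom_U G" "x \<in> V" "g i \<in> carrier G"
  using assms by (auto simp: standard_form_def)

lemma standard_form_N:
  "standard_form \<rho> g x \<Longrightarrow> a \<in> N \<Longrightarrow> \<rho> a $ i $ j = (if i = j then circ (act (g j) x a) else 0)"
  by (simp add: standard_form_def)

text \<open>Both sides are diagonal on N, so a nonzero entry of M forces the two characters that it
  links to coincide, and equal characters have weights that differ by an integral
  homomorphism.\<close>

lemma standard_form_intertwiner:
  fixes \<rho> \<rho>' :: "'a \<Rightarrow> complex^'n^'n"
  assumes sf: "standard_form \<rho> g x" and sf': "standard_form \<rho>' g' x'"
    and M: "\<And>a. a \<in> N \<Longrightarrow> M ** \<rho> a = \<rho>' a ** M" and ij: "M $ i $ j \<noteq> 0"
  shows "integral_on_N (act (g' i) x' - act (g j) x)"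
  unfolding integral_on_N_def
proof
  fix a assume a: "a \<in> N"
  have d: "i \<noteq> j \<Longrightarrow> \<rho> a $ i $ j = 0" "i \<noteq> j \<Longrightarrow> \<rho>' a $ i $ j = 0" for i j
    using standard_form_N[OF sf a] standard_form_N[OF sf' a] by auto
  have "(M ** \<rho> a) $ i $ j = (\<rho>' a ** M) $ i $ j"
    using M[OF a] by simp
  then have "M $ i $ j * \<rho> a $ j $ j = \<rho>' a $ i $ i * M $ i $ j"
    using diagonal_mult[of "\<rho> a" M] diagonal_mult[of "\<rho>' a" M] d by simp
  then have "circ (act (g' i) x' a) = circ (act (g j) x a)"
    using ij by (simp add: standard_form_N[OF sf a] standard_form_N[OF sf' a])
  then show "(act (g' i) x' - act (g j) x) a \<in> \<int>"
    by (simp add: circ_eq_iff)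
qed

text \<open>Compare the (i, j) entries of the two sides of \<open>\<rho> a ** \<rho> \<gamma> =
  \<rho> \<gamma> ** \<rho> (inv \<gamma> \<otimes> a \<otimes> \<gamma>)\<close>.\<close>

lemma diagonal_on_N_weight:
  assumes \<rho>: "\<rho> \<in> Hom_U G" and diag: "\<And>a i j. a \<in> N \<Longrightarrow> i \<noteq> j \<Longrightarrow> \<rho> a $ i $ j = 0"
    and \<gamma>: "\<gamma> \<in> carrier G" and ij: "\<rho> \<gamma> $ i $ j \<noteq> 0" and a: "a \<in> N"
  shows "\<rho> a $ i $ i = \<rho> (inv \<gamma> \<otimes> a \<otimes> \<gamma>) $ j $ j"
proof -
  have c: "inv \<gamma> \<otimes> a \<otimes> \<gamma> \<in> N"
    using \<gamma> a by (rule conj_in_N)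
  have "a \<otimes> \<gamma> = \<gamma> \<otimes> (inv \<gamma> \<otimes> a \<otimes> \<gamma>)"
    using \<gamma> a by (simp add: m_assoc) (simp flip: m_assoc)
  then have "\<rho> a ** \<rho> \<gamma> = \<rho> \<gamma> ** \<rho> (inv \<gamma> \<otimes> a \<otimes> \<gamma>)"
    using Hom_U_mult[OF \<rho>] \<gamma> a c by (metis N.mem_carrier)
  then have "(\<rho> a ** \<rho> \<gamma>) $ i $ j = (\<rho> \<gamma> ** \<rho> (inv \<gamma> \<otimes> a \<otimes> \<gamma>)) $ i $ j"
    by simp
  then have "\<rho> a $ i $ i * \<rho> \<gamma> $ i $ j = \<rho> \<gamma> $ i $ j * \<rho> (inv \<gamma> \<otimes> a \<otimes> \<gamma>) $ j $ j"
    using diagonal_mult[of "\<rho> a"] diagonal_mult[of "\<rho> (inv \<gamma> \<otimes> a \<otimes> \<gamma>)"] diag[OF a] diag[OF c] by simp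
  then show ?thesis
    using ij by simp
qed

lemma standard_form_weight:
  assumes sf: "standard_form \<rho> g x" and \<gamma>: "\<gamma> \<in> carrier G" and ij: "\<rho> \<gamma> $ i $ j \<noteq> 0"
  shows "integral_on_N (act (g i) x - act (\<gamma> \<otimes> g j) x)"
  unfolding integral_on_N_def
proof
  fix a assume a: "a \<in> N"
  have c: "inv \<gamma> \<otimes> a \<otimes> \<gamma> \<in> N"
    using \<gamma> a by (rule conj_in_N)
  have "\<rho> a $ i $ i = \<rho> (inv \<gamma> \<otimes> a \<otimes> \<gamma>) $ j $ j"
    using standard_form_N[OF sf] by (intro diagonal_on_N_weight[OF standard_formD(1)[OF sf] _ \<gamma> ij a]) auto
  then have "circ (act (g i) x a) = circ (act \<gamma> (act (g j) x) a)"
    by (simp add: standard_form_N[OF sf a] standard_form_N[OF sf c] act_apply[OF a])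
  then show "(act (g i) x - act (\<gamma> \<otimes> g j) x) a \<in> \<int>"
    using \<gamma> standard_formD(3)[OF sf] by (simp add: circ_eq_iff act_act)
qed

text \<open>The weights at i and j are related only modulo integral homomorphisms, but their
  displacements exactly. The exact relation is essential, since \<open>transfer\<close> need not be
  integral on integral homomorphisms.\<close>

lemma standard_form_equivariant:
  assumes sf: "standard_form \<rho> g x" and \<gamma>: "\<gamma> \<in> carrier G" and ij: "\<rho> \<gamma> $ i $ j \<noteq> 0" and y: "y \<in> closed_face x"
  shows "act (g i) (y - x) = act \<gamma> (act (g j) (y - x))"
  using act_eq_on_closed_face[OF standard_formD(2)[OF sf] _ _ standard_form_weight[OF sf \<gamma> ij] y] \<gamma> standard_formD(3)[OF sf]
  by (simp add: act_act)

text \<open>Unitarity survives because the phase depends only on the column and cancels in the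
  product with the adjoint. On N the transfer is evaluation, so the weight moves from x to
  y.\<close>

lemma deform_standard_form:
  fixes \<rho> :: "'a \<Rightarrow> complex^'n^'n"
  assumes sf: "standard_form \<rho> g x" and y: "y \<in> closed_face x"
  shows "standard_form (deform \<rho> g (y - x)) g y"
proof -
  note \<rho> = standard_formD(1)[OF sf] and x = standard_formD(2)[OF sf] and g = standard_formD(3)[OF sf]
  have yV: "y \<in> V"
    using y by (rule closed_face_V)
  have uV: "act (g j) (y - x) \<in> V" for j
    using x yV g by (intro act_V V_diff) auto
  let ?\<sigma> = "deform \<rho> g (y - x)"
  have unit: "?\<sigma> \<gamma> \<in> unitary_group" if \<gamma>: "\<gamma> \<in> carrier G" for \<gamma>
  proof -
    have "(?\<sigma> \<gamma> ** conj_transpose (?\<sigma> \<gamma>)) $ i $ j = (\<rho> \<gamma> ** conj_transpose (\<rho> \<gamma>)) $ i $ j" for i j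
    proof -
      have *: "\<rho> \<gamma> $ i $ l * circ t * (cnj (\<rho> \<gamma> $ j $ l) * cnj (circ t)) = \<rho> \<gamma> $ i $ l * cnj (\<rho> \<gamma> $ j $ l)" for l t
      proof -
        have "\<rho> \<gamma> $ i $ l * circ t * (cnj (\<rho> \<gamma> $ j $ l) * cnj (circ t)) = \<rho> \<gamma> $ i $ l * cnj (\<rho> \<gamma> $ j $ l) * (circ t * cnj (circ t))"
          by (simp only: mult_ac)
        then show ?thesis
          by (simp only: circ_cnj mult_1_right)
      qed
      show ?thesis
        by (simp only: matrix_mult_nth conj_transpose_nth deform_nth[OF \<gamma>] complex_cnj_mult *)
    qed
    then have "?\<sigma> \<gamma> ** conj_transpose (?\<sigma> \<gamma>) = \<rho> \<gamma> ** conj_transpose (\<rho> \<gamma>)"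
      by (simp add: matrix_eq_iff)
    then show ?thesis
      using Hom_U_unitary[OF \<rho> \<gamma>] by (simp add: unitary_group_def)
  qed
  have mult: "?\<sigma> (\<beta> \<otimes> \<gamma>) = ?\<sigma> \<beta> ** ?\<sigma> \<gamma>" if \<beta>: "\<beta> \<in> carrier G" and \<gamma>: "\<gamma> \<in> carrier G" for \<beta> \<gamma>
  proof -
    have "?\<sigma> (\<beta> \<otimes> \<gamma>) $ i $ l = (?\<sigma> \<beta> ** ?\<sigma> \<gamma>) $ i $ l" for i l
    proof -
      \<comment> \<open>A nonzero entry of \<rho> \<gamma> at (j, l) identifies the displacement at
        j with the \<gamma>-translate of the one at l. The two phases then combine by the cocycle
        identity of \<open>transfer_mult\<close>.\<close>
      have *: "\<rho> \<beta> $ i $ j * circ (transfer \<beta> (act (g j) (y - x))) * (\<rho> \<gamma> $ j $ l * circ (transfer \<gamma> (act (g l) (y - x)))) =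
         \<rho> \<beta> $ i $ j * \<rho> \<gamma> $ j $ l * circ (transfer (\<beta> \<otimes> \<gamma>) (act (g l) (y - x)))" for j
      proof (cases "\<rho> \<gamma> $ j $ l = 0")
        case False
        then have "act (g j) (y - x) = act \<gamma> (act (g l) (y - x))"
          using standard_form_equivariant[OF sf \<gamma> _ y] by blast
        then show ?thesis
          by (simp add: transfer_mult[OF \<beta> \<gamma> uV] circ_add mult_ac)
      qed simp
      have "(?\<sigma> \<beta> ** ?\<sigma> \<gamma>) $ i $ l = (\<Sum>j\<in>UNIV. \<rho> \<beta> $ i $ j * \<rho> \<gamma> $ j $ l) * circ (transfer (\<beta> \<otimes> \<gamma>) (act (g l) (y - x)))"
        by (simp only: matrix_mult_nth deform_nth \<beta> \<gamma> sum_distrib_right *)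
      also have "(\<Sum>j\<in>UNIV. \<rho> \<beta> $ i $ j * \<rho> \<gamma> $ j $ l) = \<rho> (\<beta> \<otimes> \<gamma>) $ i $ l"
        by (simp add: Hom_U_mult[OF \<rho> \<beta> \<gamma>] matrix_mult_nth)
      finally show ?thesis
        by (simp only: deform_nth m_closed \<beta> \<gamma>)
    qed
    then show ?thesis
      by (simp add: matrix_eq_iff)
  qed
  have "?\<sigma> \<in> Hom_U G"
    unfolding Hom_U_def using unit mult by (auto simp: deform_def)
  moreover have "?\<sigma> a = (\<chi> i j. if i = j then circ (act (g j) y a) else 0)" if a: "a \<in> N" for a
  proof -
    have "act (g j) y a = act (g j) x a + act (g j) (y - x) a" for j
      by (simp add: act_diff)
    then show ?thesis
      using a by (simp add: matrix_eq_iff deform_nth standard_form_N[OF sf a] transfer_N[OF a uV] flip: circ_add)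
  qed
  ultimately show ?thesis
    unfolding standard_form_def using yV g by auto
qed

text \<open>Wherever M is nonzero the linked displacements agree, so both twists multiply the
  corresponding terms by the same phase and M intertwines the twisted families too.\<close>

lemma deform_intertwiner:
  fixes \<rho> \<rho>' :: "'a \<Rightarrow> complex^'n^'n"
  assumes M: "\<And>\<gamma>. \<gamma> \<in> carrier G \<Longrightarrow> M ** \<rho> \<gamma> = \<rho>' \<gamma> ** M"
    and eq: "\<And>i j. M $ i $ j \<noteq> 0 \<Longrightarrow> act (g' i) u' = act (g j) u"
    and \<gamma>: "\<gamma> \<in> carrier G"
  shows "M ** deform \<rho> g u \<gamma> = deform \<rho>' g' u' \<gamma> ** M"
proof -
  have "(M ** deform \<rho> g u \<gamma>) $ i $ j = (deform \<rho>' g' u' \<gamma> ** M) $ i $ j" for i j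
  proof -
    have "(M ** deform \<rho> g u \<gamma>) $ i $ j = (M ** \<rho> \<gamma>) $ i $ j * circ (transfer \<gamma> (act (g j) u))"
      by (simp add: matrix_mult_nth deform_nth[OF \<gamma>] sum_distrib_right mult.assoc)
    also have "\<dots> = (\<Sum>l\<in>UNIV. \<rho>' \<gamma> $ i $ l * M $ l $ j * circ (transfer \<gamma> (act (g j) u)))"
      by (simp add: M[OF \<gamma>]) (simp add: matrix_mult_nth sum_distrib_right)
    also have "\<dots> = (\<Sum>l\<in>UNIV. deform \<rho>' g' u' \<gamma> $ i $ l * M $ l $ j)"
    proof (rule sum.cong[OF refl])
      fix l
      show "\<rho>' \<gamma> $ i $ l * M $ l $ j * circ (transfer \<gamma> (act (g j) u)) = deform \<rho>' g' u' \<gamma> $ i $ l * M $ l $ j"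
        using eq[of l j] by (cases "M $ l $ j = 0") (simp_all add: deform_nth[OF \<gamma>])
    qed
    finally show ?thesis
      by (simp add: matrix_mult_nth)
  qed
  then show ?thesis
    by (simp add: matrix_eq_iff)
qed

lemma deform_deform: "deform (deform \<rho> g u) g v = deform \<rho> g (u + v)"
  by (auto simp: deform_def fun_eq_iff matrix_eq_iff act_add transfer_add circ_add)

lemma deform_zero: "\<rho> \<in> Hom_U G \<Longrightarrow> deform \<rho> g 0 = \<rho>"
  using Hom_U_extensional[of \<rho> G]
  by (auto simp: deform_def fun_eq_iff matrix_eq_iff act_zero transfer_zero extensional_def)

text \<open>In the relative interior the roles of x and y are symmetric. Twisting back from y to x
  carries the commutant of the twist into that of \<rho>, where Schur applies. On the boundary this
  breaks down, since x leaves the closed face of y.\<close>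

lemma deform_irreducible:
  assumes sf: "standard_form \<rho> g x" and irr: "\<not> reducible_rep G \<rho>" and y: "y \<in> face x"
  shows "\<not> reducible_rep G (deform \<rho> g (y - x))"
proof (rule irreducibleI)
  let ?\<sigma> = "deform \<rho> g (y - x)"
  fix B assume herm: "conj_transpose B = B" and comm: "\<And>\<gamma>. \<gamma> \<in> carrier G \<Longrightarrow> B ** ?\<sigma> \<gamma> = ?\<sigma> \<gamma> ** B"
  have yc: "y \<in> closed_face x"
    using y face_subset_closed_face by blast
  have sf': "standard_form ?\<sigma> g y"
    using sf yc by (rule deform_standard_form)
  have x: "x \<in> closed_face y"
    using closed_face_eq[OF y] face_refl[OF standard_formD(2)[OF sf]] face_subset_closed_face by blast
  have "(y - x) + (x - y) = 0"
    by (simp add: fun_eq_iff)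
  then have undo: "deform ?\<sigma> g (x - y) = \<rho>"
    unfolding deform_deform using deform_zero[OF standard_formD(1)[OF sf]] by simp
  have "B ** \<rho> \<gamma> = \<rho> \<gamma> ** B" if \<gamma>: "\<gamma> \<in> carrier G" for \<gamma>
  proof -
    have "B ** deform ?\<sigma> g (x - y) \<gamma> = deform ?\<sigma> g (x - y) \<gamma> ** B"
    proof (rule deform_intertwiner[OF comm _ \<gamma>])
      fix i j assume ij: "B $ i $ j \<noteq> 0"
      have "integral_on_N (act (g i) y - act (g j) y)"
        using comm by (intro standard_form_intertwiner[OF sf' sf' _ ij]) auto
      then show "act (g i) (x - y) = act (g j) (x - y)"
        using standard_formD[OF sf'] x by (intro act_eq_on_closed_face) auto
    qed
    then show ?thesis
      by (simp only: undo)
  qed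
  then show "\<exists>c. B = mat c"
    using schur_hermitian[OF irr herm] by blast
qed

text \<open>One unitary matrix conjugates the whole families of twists, while their parameters are
  related by an affine symmetry of V. This gives both the independence of a cell from its
  presentation and the injectivity of its parametrization.\<close>

lemma deform_conj_rep:
  fixes \<rho> \<rho>' :: "'a \<Rightarrow> complex^'n^'n"
  assumes sf: "standard_form \<rho> g x" and sf': "standard_form \<rho>' g' x'"
    and U: "U \<in> unitary_group" and \<rho>': "\<rho>' = conj_rep G U \<rho>"
  obtains \<gamma> l where "\<gamma> \<in> carrier G" "l \<in> V" "integral_on_N l" "x' = act \<gamma> x + l"
    "\<And>y. y \<in> closed_face x \<Longrightarrow> deform \<rho>' g' (act \<gamma> y + l - x') = conj_rep G U (deform \<rho> g (y - x))"
proof -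
  have inter: "U ** \<rho> \<gamma> = \<rho>' \<gamma> ** U" if "\<gamma> \<in> carrier G" for \<gamma>
    unfolding \<rho>' conj_rep_apply[OF that] by (simp add: unitary_cancel[OF U])
  have int: "integral_on_N (act (g' i) x' - act (g j) x)" if "U $ i $ j \<noteq> 0" for i j
    using inter by (intro standard_form_intertwiner[OF sf sf' _ that]) auto
  note x = standard_formD(2)[OF sf] and x' = standard_formD(2)[OF sf'] and g = standard_formD(3)[OF sf] and g' = standard_formD(3)[OF sf']
  have "U \<noteq> 0"
  proof
    assume "U = 0"
    then have "norm U = 0"
      by simp
    then show False
      using norm_unitary_sq[OF U] by simp
  qed
  then obtain i j where ij: "U $ i $ j \<noteq> 0"
    by (auto simp: vec_eq_iff)
  \<comment> \<open>A single nonzero entry of U determines the linear part; the translation l is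
    whatever remains, and is integral by the intertwiner relation.\<close>
  define \<gamma> where "\<gamma> = inv (g' i) \<otimes> g j"
  define l where "l = x' - act \<gamma> x"
  have \<gamma>: "\<gamma> \<in> carrier G"
    using g g' by (simp add: \<gamma>_def)
  have l: "l \<in> V"
    using x x' \<gamma> by (auto simp: l_def intro!: V_diff act_V)
  have "act (inv (g' i)) (act (g' i) x' - act (g j) x) = l"
    using g g' x x' by (simp add: act_diff act_act l_def \<gamma>_def act_one)
  then have il: "integral_on_N l"
    using integral_act[OF _ int[OF ij], of "inv (g' i)"] g' by simp
  have x'_eq: "x' = act \<gamma> x + l"
    by (simp add: l_def)
  have "deform \<rho>' g' (act \<gamma> y + l - x') = conj_rep G U (deform \<rho> g (y - x))" if y: "y \<in> closed_face x" for y
  proof -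
    have u': "act \<gamma> y + l - x' = act \<gamma> (y - x)"
      by (simp add: l_def act_diff fun_eq_iff)
    have "U ** deform \<rho> g (y - x) \<beta> = deform \<rho>' g' (act \<gamma> (y - x)) \<beta> ** U" if \<beta>: "\<beta> \<in> carrier G" for \<beta>
    proof (rule deform_intertwiner[OF inter _ \<beta>])
      fix i j assume "U $ i $ j \<noteq> 0"
      then have "integral_on_N (act (g' i) x' - act (g j) x)"
        by (rule int)
      \<comment> \<open>Other nonzero entries of U may link the weights by other group elements.
        Modulo integral homomorphisms these agree with \<gamma> at x, which suffices for equal
        displacements.\<close>
      then have "integral_on_N (act (g' i) x' - act (g j) x - act (g' i) l)"
        by (rule integral_diff[OF _ integral_act[OF g' il]])
      moreover have "act (g' i) x' - act (g j) x - act (g' i) l = act (g' i \<otimes> \<gamma>) x - act (g j) x"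
        unfolding x'_eq using g' \<gamma> by (simp add: act_add act_act fun_eq_iff)
      ultimately have "act (g' i \<otimes> \<gamma>) (y - x) = act (g j) (y - x)"
        using x y g g' \<gamma> by (intro act_eq_on_closed_face) auto
      then show "act (g' i) (act \<gamma> (y - x)) = act (g j) (y - x)"
        using g' \<gamma> by (simp add: act_act)
    qed
    then have "deform \<rho>' g' (act \<gamma> (y - x)) \<beta> = U ** deform \<rho> g (y - x) \<beta> ** conj_transpose U" if "\<beta> \<in> carrier G" for \<beta>
      using that by (simp add: unitary_cancel(3)[OF U])
    then show ?thesis
      unfolding u' by (auto simp: conj_rep_def fun_eq_iff) (auto simp: deform_def)
  qed
  then show ?thesis
    using that \<gamma> l il x'_eq by blast
qed

text \<open>After diagonalization on N, a nonzero entry of a group element moves weights within one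
  orbit. The indices with weights in a fixed orbit therefore form a block, which irreducibility
  makes the whole index set.\<close>

lemma irreducible_standard_form:
  fixes \<rho> :: "'a \<Rightarrow> complex^'n^'n"
  assumes \<rho>: "\<rho> \<in> Hom_U G" and irr: "\<not> reducible_rep G \<rho>"
  obtains U g x where "U \<in> unitary_group" "standard_form (conj_rep G U \<rho>) g x"
proof -
  have comm: "A ** B = B ** A" if A: "A \<in> \<rho> ` N" and B: "B \<in> \<rho> ` N" for A B
  proof -
    obtain a b where ab: "a \<in> N" "b \<in> N" "A = \<rho> a" "B = \<rho> b"
      using A B by blast
    then have "\<rho> a ** \<rho> b = \<rho> (a \<otimes> b)" "\<rho> b ** \<rho> a = \<rho> (b \<otimes> a)"
      using Hom_U_mult[OF \<rho>] by simp_all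
    then show ?thesis
      using ab N_commute by simp
  qed
  have adj: "conj_transpose A \<in> \<rho> ` N" if A: "A \<in> \<rho> ` N" for A
  proof -
    obtain a where a: "a \<in> N" "A = \<rho> a"
      using A by blast
    then have "conj_transpose A = \<rho> (inv a)"
      using Hom_U_inv[OF is_group \<rho>] by simp
    then show ?thesis
      using a by blast
  qed
  obtain U where U: "U \<in> unitary_group"
    and dg: "\<And>A i j. A \<in> \<rho> ` N \<Longrightarrow> i \<noteq> j \<Longrightarrow> (U ** A ** conj_transpose U) $ i $ j = 0"
    using simultaneous_diagonalization[of "\<rho> ` N"] comm adj by blast
  define \<sigma> where "\<sigma> = conj_rep G U \<rho>"
  have \<sigma>: "\<sigma> \<in> Hom_U G" "\<not> reducible_rep G \<sigma>"
    using conj_rep_Hom_U[OF is_group \<rho> U] irr by (simp_all add: \<sigma>_def reducible_rep_conj_rep[OF U])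
  have diag: "\<sigma> a $ i $ j = 0" if "a \<in> N" "i \<noteq> j" for a i j
    using dg[of "\<rho> a" i j] that by (simp add: \<sigma>_def conj_rep_apply)
  let ?i = "undefined :: 'n"
  have unit: "cmod (\<sigma> a $ i $ i) = 1" if a: "a \<in> N" for a i
  proof -
    have "(\<Sum>j\<in>UNIV. (cmod (\<sigma> a $ i $ j))\<^sup>2) = 1"
      using Hom_U_unitary[OF \<sigma>(1)] a by (intro unitary_row_norm) auto
    moreover have "(\<Sum>j\<in>UNIV. (cmod (\<sigma> a $ i $ j))\<^sup>2) = (cmod (\<sigma> a $ i $ i))\<^sup>2"
      using diag[OF a] by (subst sum.remove[of _ i]) auto
    ultimately have "(cmod (\<sigma> a $ i $ i))\<^sup>2 = 1"
      by simp
    then show ?thesis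
      by (simp add: power2_eq_1_iff) (metis norm_ge_zero not_one_le_zero neg_0_le_iff_le)
  qed
  have "\<exists>t. \<sigma> a $ ?i $ ?i = circ t" if "a \<in> N" for a
    using circ_surj[OF unit[OF that]] by blast
  then obtain h where h: "\<And>a. a \<in> N \<Longrightarrow> \<sigma> a $ ?i $ ?i = circ (h a)"
    by metis
  have "h (a \<otimes> b) - h a - h b \<in> \<int>" if a: "a \<in> N" and b: "b \<in> N" for a b
  proof -
    have "\<sigma> (a \<otimes> b) $ ?i $ ?i = (\<sigma> a ** \<sigma> b) $ ?i $ ?i"
      using Hom_U_mult[OF \<sigma>(1)] a b by simp
    also have "\<dots> = \<sigma> a $ ?i $ ?i * \<sigma> b $ ?i $ ?i"
      using diag[OF a] by (intro diagonal_mult(1)) auto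
    finally have "circ (h (a \<otimes> b)) = circ (h a + h b)"
      using a b by (simp add: h circ_add)
    then show ?thesis
      by (simp add: circ_eq_iff algebra_simps)
  qed
  then obtain x where x: "x \<in> V" "\<And>a. a \<in> N \<Longrightarrow> h a - x a \<in> \<int>"
    using lift_character[of h] by blast
  have hx: "\<sigma> a $ ?i $ ?i = circ (x a)" if "a \<in> N" for a
    using x(2)[OF that] h[OF that] by (simp add: circ_eq_iff)
  \<comment> \<open>J is closed under passing along nonzero entries of \<sigma> \<gamma> in both
    directions, the reverse one by applying \<open>step\<close> to the inverse of \<gamma>.\<close>
  define J where "J = {j. \<exists>\<gamma>\<in>carrier G. \<forall>a\<in>N. \<sigma> a $ j $ j = circ (act \<gamma> x a)}"
  have "?i \<in> J"
    unfolding J_def using hx act_one[OF x(1)] by (auto intro!: bexI[of _ \<one>])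
  have step: "i \<in> J" if \<gamma>: "\<gamma> \<in> carrier G" and ij: "\<sigma> \<gamma> $ i $ j \<noteq> 0" and j: "j \<in> J" for \<gamma> i j
  proof -
    obtain \<delta> where \<delta>: "\<delta> \<in> carrier G" "\<And>a. a \<in> N \<Longrightarrow> \<sigma> a $ j $ j = circ (act \<delta> x a)"
      using j by (auto simp: J_def)
    have "\<sigma> a $ i $ i = circ (act (\<gamma> \<otimes> \<delta>) x a)" if a: "a \<in> N" for a
    proof -
      have "\<sigma> a $ i $ i = \<sigma> (inv \<gamma> \<otimes> a \<otimes> \<gamma>) $ j $ j"
        by (rule diagonal_on_N_weight[OF \<sigma>(1) diag \<gamma> ij a])
      also have "\<dots> = circ (act \<gamma> (act \<delta> x) a)"
        using \<delta>(2)[OF conj_in_N[OF \<gamma> a]] by (simp add: act_apply[OF a, of \<gamma>])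
      finally show ?thesis
        using \<gamma> \<delta>(1) by (simp add: act_act)
    qed
    then show ?thesis
      unfolding J_def using \<gamma> \<delta>(1) by blast
  qed
  have "J = UNIV"
  proof (rule ccontr)
    assume "J \<noteq> UNIV"
    have "reducible_rep G \<sigma>"
    proof (rule reducible_repI_blocks[OF \<sigma>(1) _ \<open>J \<noteq> UNIV\<close>])
      show "J \<noteq> {}"
        using \<open>?i \<in> J\<close> by blast
      fix \<gamma> i j assume \<gamma>: "\<gamma> \<in> carrier G" and ij: "i \<in> J \<longleftrightarrow> j \<notin> J"
      have adj: "\<sigma> (inv \<gamma>) $ j $ i = cnj (\<sigma> \<gamma> $ i $ j)"
        using Hom_U_inv[OF is_group \<sigma>(1) \<gamma>] by simp
      show "\<sigma> \<gamma> $ i $ j = 0"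
      proof (rule ccontr)
        assume ne: "\<sigma> \<gamma> $ i $ j \<noteq> 0"
        then have "\<sigma> (inv \<gamma>) $ j $ i \<noteq> 0"
          by (simp add: adj)
        then show False
          using step[OF \<gamma> ne] step[of "inv \<gamma>" j i] \<gamma> ij by auto
      qed
    qed
    then show False
      using \<sigma>(2) by blast
  qed
  then have "\<forall>j. \<exists>\<gamma>. \<gamma> \<in> carrier G \<and> (\<forall>a\<in>N. \<sigma> a $ j $ j = circ (act \<gamma> x a))"
    unfolding J_def by blast
  then obtain g where g: "\<And>j. g j \<in> carrier G" "\<And>j a. a \<in> N \<Longrightarrow> \<sigma> a $ j $ j = circ (act (g j) x a)"
    by metis
  have "standard_form \<sigma> g x"
    unfolding standard_form_def using \<sigma>(1) x(1) g diag by (auto simp: matrix_eq_iff)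
  then show ?thesis
    using that U by (simp add: \<sigma>_def)
qed

end

section \<open>Cells\<close>

lemma finite_image_factor:
  assumes fin: "finite (f ` A)" and eq: "\<And>a b. a \<in> A \<Longrightarrow> b \<in> A \<Longrightarrow> f a = f b \<Longrightarrow> h a = h b"
  shows "finite (h ` A)"
proof -
  have "h a \<in> (\<lambda>c. h (SOME b. b \<in> A \<and> f b = c)) ` f ` A" if a: "a \<in> A" for a
  proof -
    have "(SOME b. b \<in> A \<and> f b = f a) \<in> A \<and> f (SOME b. b \<in> A \<and> f b = f a) = f a"
      by (rule someI[of _ a]) (use a in simp)
    then have "h a = h (SOME b. b \<in> A \<and> f b = f a)"
      using eq a by metis
    then show ?thesis
      using a by blast
  qed
  then have "h ` A \<subseteq> (\<lambda>c. h (SOME b. b \<in> A \<and> f b = c)) ` f ` A"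
    by blast
  then show ?thesis
    using fin finite_subset by blast
qed

text \<open>The real part of the trace of X Y* is the real inner product of X and Y; testing against
  the identity thus detects that an averaged intertwiner is nonzero.\<close>

lemma inner_matrix_mat1:
  fixes X Y :: "complex^'n^'n"
  shows "inner (X ** conj_transpose Y) (mat 1) = inner X Y"
proof -
  have "inner (X ** conj_transpose Y) (mat 1) = (\<Sum>i\<in>UNIV. \<Sum>j\<in>UNIV. inner ((X ** conj_transpose Y) $ i $ j) (if i = j then 1 else 0))"
    by (simp add: inner_vec_def mat_def)
  also have "\<dots> = (\<Sum>i\<in>UNIV. inner ((X ** conj_transpose Y) $ i $ i) 1)"
  proof (rule sum.cong[OF refl])
    fix i
    show "(\<Sum>j\<in>UNIV. inner ((X ** conj_transpose Y) $ i $ j) (if i = j then 1 else 0)) = inner ((X ** conj_transpose Y) $ i $ i) 1"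
      by (subst sum.remove[of _ i]) auto
  qed
  also have "\<dots> = (\<Sum>i\<in>UNIV. \<Sum>k\<in>UNIV. inner (X $ i $ k) (Y $ i $ k))"
    by (simp add: matrix_mult_nth inner_complex_def)
  finally show ?thesis
    by (simp add: inner_vec_def)
qed

text \<open>With n the matrix size, |X - Y|^2 = 2 n - 2 \<open>inner X Y\<close>, so distance below
  1 leaves an inner product above n - 1/2.\<close>

lemma inner_pos_if_close:
  fixes X Y :: "complex^'n^'n"
  assumes "X \<in> unitary_group" "Y \<in> unitary_group" "dist X Y < 1"
  shows "inner X Y > 0"
proof -
  have "(norm (X - Y))\<^sup>2 < 1"
    using assms(3) by (simp add: dist_norm abs_square_less_1)
  moreover have "(norm (X - Y))\<^sup>2 = (norm X)\<^sup>2 + (norm Y)\<^sup>2 - 2 * inner X Y"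
    by (simp add: power2_norm_eq_inner inner_diff_left inner_diff_right inner_commute)
  moreover have "real CARD('n) \<ge> 1"
    using zero_less_card_finite[where 'a = 'n] by linarith
  ultimately show ?thesis
    using norm_unitary_sq[OF assms(1)] norm_unitary_sq[OF assms(2)] by linarith
qed

context lattice_extension
begin

definition cell :: "('a \<Rightarrow> complex^'n^'n) \<Rightarrow> ('n \<Rightarrow> 'a) \<Rightarrow> ('a \<Rightarrow> real) \<Rightarrow> ('a \<Rightarrow> complex^'n^'n) set option set" where
  "cell \<rho> g x = (\<lambda>y. Some (rep_orbit G (deform \<rho> g (y - x)))) ` face x"

definition irreducible_form :: "('a \<Rightarrow> complex^'n^'n) \<Rightarrow> ('n \<Rightarrow> 'a) \<Rightarrow> ('a \<Rightarrow> real) \<Rightarrow> bool" where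
  "irreducible_form \<rho> g x \<longleftrightarrow> standard_form \<rho> g x \<and> \<not> reducible_rep G \<rho>"

lemma face_closed_face: "y \<in> face x \<Longrightarrow> y \<in> closed_face x"
  using face_subset_closed_face by blast

lemma cell_deform:
  assumes "y \<in> face x"
  shows "cell (deform \<rho> g (y - x)) g y = cell \<rho> g x"
proof -
  have "(y - x) + (z - y) = z - x" for z
    by (simp add: fun_eq_iff)
  then show ?thesis
    by (simp only: cell_def deform_deform face_eq[OF assms])
qed

text \<open>The affine symmetry of \<open>deform_conj_rep\<close> carries the face of x into the
  face of x', and corresponding twists are conjugate.\<close>

lemma cell_subset:
  fixes \<rho> \<rho>' :: "'a \<Rightarrow> complex^'n^'n"
  assumes sf: "standard_form \<rho> g x" and sf': "standard_form \<rho>' g' x'" and orb: "rep_orbit G \<rho> = rep_orbit G \<rho>'"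
  shows "cell \<rho> g x \<subseteq> cell \<rho>' g' x'"
proof -
  obtain U where U: "U \<in> unitary_group" "\<rho>' = conj_rep G U \<rho>"
    by (rule rep_orbit_eqD[OF orb standard_formD(1)[OF sf']])
  obtain \<gamma> l where \<gamma>: "\<gamma> \<in> carrier G" and l: "l \<in> V" "integral_on_N l" and x': "x' = act \<gamma> x + l"
    and def: "\<And>y. y \<in> closed_face x \<Longrightarrow> deform \<rho>' g' (act \<gamma> y + l - x') = conj_rep G U (deform \<rho> g (y - x))"
    by (rule deform_conj_rep[OF sf sf' U]) blast
  show ?thesis
    unfolding cell_def
  proof (rule image_subsetI)
    fix z assume z: "z \<in> face x"
    have "rep_orbit G (deform \<rho> g (z - x)) = rep_orbit G (deform \<rho>' g' (act \<gamma> z + l - x'))"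
      unfolding def[OF face_closed_face[OF z]] by (rule rep_orbit_conj_rep[OF U(1), symmetric])
    moreover have "act \<gamma> z + l \<in> face x'"
      unfolding x' by (rule affine_act_face(1)[OF \<gamma> l z])
    ultimately show "Some (rep_orbit G (deform \<rho> g (z - x))) \<in> (\<lambda>y. Some (rep_orbit G (deform \<rho>' g' (y - x')))) ` face x'"
      by (intro image_eqI[of _ _ "act \<gamma> z + l"]) (simp_all only:)
  qed
qed

lemma cell_eq:
  assumes "standard_form \<rho> g x" "standard_form \<rho>' g' x'" "rep_orbit G \<rho> = rep_orbit G \<rho>'"
  shows "cell \<rho> g x = cell \<rho>' g' x'"
  using cell_subset[OF assms] cell_subset[OF assms(2,1) assms(3)[symmetric]] by (rule subset_antisym)

text \<open>By \<open>cell_deform\<close> a cell can be based at any of its points, so two cells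
  with a common point reduce to \<open>cell_eq\<close>.\<close>

lemma cells_disjoint:
  assumes sf: "standard_form \<rho> g x" and sf': "standard_form \<rho>' g' x'" and c: "c \<in> cell \<rho> g x" "c \<in> cell \<rho>' g' x'"
  shows "cell \<rho> g x = cell \<rho>' g' x'"
proof -
  obtain y where y: "y \<in> face x" "c = Some (rep_orbit G (deform \<rho> g (y - x)))"
    using c(1) by (auto simp: cell_def)
  obtain y' where y': "y' \<in> face x'" "c = Some (rep_orbit G (deform \<rho>' g' (y' - x')))"
    using c(2) by (auto simp: cell_def)
  have "cell (deform \<rho> g (y - x)) g y = cell (deform \<rho>' g' (y' - x')) g' y'"
    using y y' by (intro cell_eq deform_standard_form sf sf' face_closed_face) auto
  then show ?thesis
    using y y' by (simp add: cell_deform)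
qed

lemma standard_form_orbit_eq:
  fixes \<rho> \<rho>' :: "'a \<Rightarrow> complex^'n^'n"
  assumes sf: "standard_form \<rho> g x" and sf': "standard_form \<rho>' g' x'" and orb: "rep_orbit G \<rho> = rep_orbit G \<rho>'"
  obtains \<gamma> l where "\<gamma> \<in> carrier G" "l \<in> V" "integral_on_N l" "x' = act \<gamma> x + l"
proof -
  obtain U where U: "U \<in> unitary_group" "\<rho>' = conj_rep G U \<rho>"
    by (rule rep_orbit_eqD[OF orb standard_formD(1)[OF sf']])
  show ?thesis
    by (rule deform_conj_rep[OF sf sf' U]) (use that in blast)
qed

text \<open>Conjugate twists have parameters related by an affine symmetry; as both parameters lie
  in one face, that symmetry fixes the first one.\<close>

lemma face_orbit_injective:
  fixes \<rho> :: "'a \<Rightarrow> complex^'n^'n"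
  assumes sf: "standard_form \<rho> g x" and y: "y \<in> face x" and z: "z \<in> face x"
    and orb: "rep_orbit G (deform \<rho> g (y - x)) = rep_orbit G (deform \<rho> g (z - x))"
  shows "y = z"
proof -
  obtain \<gamma> l where *: "\<gamma> \<in> carrier G" "l \<in> V" "integral_on_N l" "z = act \<gamma> y + l"
    using standard_form_orbit_eq[OF deform_standard_form[OF sf face_closed_face[OF y]]
      deform_standard_form[OF sf face_closed_face[OF z]] orb] by blast
  have "act \<gamma> y + l \<in> face y"
    using z *(4) face_eq[OF y] by simp
  then show ?thesis
    using affine_act_fixes_face[OF face_V[OF y] *(1-3)] *(4) by simp
qed

text \<open>Averaging over the cosets of \<open>N\<close> produces an intertwiner, which is nonzero when the two
  representations are close on the coset representatives.\<close>
lemma close_standard_forms_conjugate: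
  fixes \<rho> \<rho>' :: "'a \<Rightarrow> complex^'n^'n"
  assumes sf: "standard_form \<rho> g x" and sf': "standard_form \<rho>' g x" and irr: "\<not> reducible_rep G \<rho>'"
    and close: "\<And>d. d \<in> R \<Longrightarrow> inner (\<rho> d) (\<rho>' d) > 0"
  shows "rep_orbit G \<rho> = rep_orbit G \<rho>'"
proof -
  note \<rho> = standard_formD(1)[OF sf] and \<rho>' = standard_formD(1)[OF sf']
  \<comment> \<open>Both representations agree on N, so T is constant on cosets of N and the sum
    over representatives is a sum over G/N.\<close>
  define T where "T h = \<rho> h ** conj_transpose (\<rho>' h)" for h
  define A where "A = (\<Sum>d\<in>R. T d)"
  have T_N: "T (h \<otimes> n) = T h" if h: "h \<in> carrier G" and n: "n \<in> N" for h n
  proof -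
    have eq: "\<rho> n = \<rho>' n"
      using sf sf' n unfolding standard_form_def by simp
    have u: "\<rho>' n \<in> unitary_group"
      using Hom_U_unitary[OF \<rho>'] n by simp
    have "T (h \<otimes> n) = \<rho> h ** \<rho>' n ** (conj_transpose (\<rho>' n) ** conj_transpose (\<rho>' h))"
      using h n by (simp add: T_def Hom_U_mult[OF \<rho>] Hom_U_mult[OF \<rho>'] conj_transpose_mult eq)
    then show ?thesis
      by (simp add: T_def matrix_mul_assoc unitary_cancel(3)[OF u])
  qed
  have T_rep: "T (coset_rep h) = T h" if h: "h \<in> carrier G" for h
  proof -
    obtain n where n: "n \<in> N" "coset_rep h = n \<otimes> h"
      by (rule coset_rep_eq[OF h])
    have "n \<otimes> h = h \<otimes> (inv h \<otimes> n \<otimes> h)"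
      using n h by (simp add: m_assoc) (simp flip: m_assoc)
    then show ?thesis
      unfolding n(2) using T_N[OF h conj_in_N[OF h n(1)]] by simp
  qed
  have inter: "\<rho> \<gamma> ** A = A ** \<rho>' \<gamma>" if \<gamma>: "\<gamma> \<in> carrier G" for \<gamma>
  proof -
    have u: "\<rho>' \<gamma> \<in> unitary_group"
      using Hom_U_unitary[OF \<rho>' \<gamma>] .
    have "A = (\<Sum>d\<in>R. T (coset_rep (\<gamma> \<otimes> d)))"
      unfolding A_def by (rule sum_R_shift[OF \<gamma>, symmetric])
    also have "\<dots> = (\<Sum>d\<in>R. \<rho> \<gamma> ** T d ** conj_transpose (\<rho>' \<gamma>))"
    proof (rule sum.cong[OF refl])
      fix d assume "d \<in> R"
      then have d: "d \<in> carrier G"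
        by (rule R_closed)
      show "T (coset_rep (\<gamma> \<otimes> d)) = \<rho> \<gamma> ** T d ** conj_transpose (\<rho>' \<gamma>)"
        using \<gamma> d by (simp add: T_rep)
          (simp add: T_def Hom_U_mult[OF \<rho>] Hom_U_mult[OF \<rho>'] conj_transpose_mult matrix_mul_assoc)
    qed
    also have "\<dots> = \<rho> \<gamma> ** A ** conj_transpose (\<rho>' \<gamma>)"
    proof -
      have "linear (\<lambda>X. \<rho> \<gamma> ** X ** conj_transpose (\<rho>' \<gamma>))"
        by (rule linearI) (simp_all add: matrix_eq_iff matrix_mult_nth sum.distrib algebra_simps
            sum_distrib_left sum_distrib_right scaleR_sum_right)
      from linear_sum[OF this, of T R] show ?thesis
        unfolding A_def by (rule sym)
    qed
    finally have "A = \<rho> \<gamma> ** A ** conj_transpose (\<rho>' \<gamma>)" .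
    then have "A ** \<rho>' \<gamma> = \<rho> \<gamma> ** A ** conj_transpose (\<rho>' \<gamma>) ** \<rho>' \<gamma>"
      by (rule arg_cong[where f = "\<lambda>X. X ** \<rho>' \<gamma>"])
    then show ?thesis
      by (simp only: unitary_cancel(4)[OF u])
  qed
  have "inner A (mat 1) = (\<Sum>d\<in>R. inner (\<rho> d) (\<rho>' d))"
    by (simp add: A_def T_def inner_sum_left inner_matrix_mat1)
  also have "\<dots> > 0"
    using finite_R card_R close by (intro sum_pos) auto
  finally have "A \<noteq> 0"
    by auto
  then obtain U where "U \<in> unitary_group" "\<rho> = conj_rep G U \<rho>'"
    using schur_conjugate[OF irr \<rho> \<rho>' _ inter] by blast
  then show ?thesis
    using rep_orbit_conj_rep by blast
qed

text \<open>Cover the unitary group by finitely many balls of radius 1/2 and record, for each coset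
  representative, a ball containing its image. Equal records put the images at distance below 1, so
  the representations are conjugate.\<close>

lemma finite_cells_of_point:
  "finite ((\<lambda>\<rho>. cell \<rho> g x) ` {\<rho> :: 'a \<Rightarrow> complex^'n^'n. irreducible_form \<rho> g x})"
proof -
  obtain K where K: "finite K" "(unitary_group :: (complex^'n^'n) set) \<subseteq> (\<Union>c\<in>K. ball c (1/2))"
    using compact_unitary[where 'n = 'n] unfolding compact_eq_totally_bounded by (meson half_gt_zero zero_less_one)
  have "\<forall>X\<in>unitary_group. \<exists>c. c \<in> K \<and> dist c X < 1/2"
  proof
    fix X :: "complex^'n^'n" assume "X \<in> unitary_group"
    then have "X \<in> (\<Union>c\<in>K. ball c (1/2))"
      by (rule subsetD[OF K(2)])
    then show "\<exists>c. c \<in> K \<and> dist c X < 1/2"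
      unfolding UN_iff mem_ball by blast
  qed
  then obtain \<kappa> where "\<forall>X\<in>unitary_group. \<kappa> X \<in> K \<and> dist (\<kappa> X) X < 1/2"
    by (rule bchoice[THEN exE])
  then have \<kappa>: "\<kappa> X \<in> K \<and> dist (\<kappa> X) X < 1/2" if "X \<in> unitary_group" for X
    using that by (rule bspec)
  let ?A = "{\<rho> :: 'a \<Rightarrow> complex^'n^'n. irreducible_form \<rho> g x}"
  define f where "f \<rho> = (\<lambda>d\<in>R. \<kappa> (\<rho> d))" for \<rho> :: "'a \<Rightarrow> complex^'n^'n"
  have unit: "\<rho> d \<in> unitary_group" if "\<rho> \<in> ?A" "d \<in> R" for \<rho> d
  proof (rule Hom_U_unitary[OF _ R_closed[OF that(2)]])
    show "\<rho> \<in> Hom_U G"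
      using that(1) by (simp add: irreducible_form_def standard_form_def)
  qed
  have "f ` ?A \<subseteq> R \<rightarrow>\<^sub>E K"
    using unit \<kappa> by (auto simp: f_def)
  then have "finite (f ` ?A)"
    using finite_R K(1) by (meson finite_PiE finite_subset)
  then show ?thesis
  proof (rule finite_image_factor)
    fix \<rho> \<rho>' assume \<rho>: "\<rho> \<in> ?A" and \<rho>': "\<rho>' \<in> ?A" and eq: "f \<rho> = f \<rho>'"
    have sf: "standard_form \<rho> g x" "standard_form \<rho>' g x" "\<not> reducible_rep G \<rho>'"
      using \<rho> \<rho>' by (auto simp: irreducible_form_def)
    have "rep_orbit G \<rho> = rep_orbit G \<rho>'"
    proof (rule close_standard_forms_conjugate[OF sf])
      fix d assume d: "d \<in> R"
      have "\<kappa> (\<rho> d) = \<kappa> (\<rho>' d)"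
        using fun_cong[OF eq, of d] d by (simp add: f_def)
      then have "dist (\<rho> d) (\<rho>' d) < 1"
        using \<kappa>[OF unit[OF \<rho> d]] \<kappa>[OF unit[OF \<rho>' d]] dist_triangle_half_r[of "\<kappa> (\<rho> d)" "\<rho> d" 1 "\<rho>' d"] by simp
      then show "inner (\<rho> d) (\<rho>' d) > 0"
        using unit[OF \<rho> d] unit[OF \<rho>' d] by (intro inner_pos_if_close)
    qed
    then show "cell \<rho> g x = cell \<rho>' g x"
      by (rule cell_eq[OF sf(1,2)])
  qed
qed

section \<open>Finiteness of the set of cells\<close>

definition pattern :: "('a \<Rightarrow> real) \<Rightarrow> 'a \<Rightarrow> int \<times> int" where
  "pattern x = (\<lambda>f\<in>Phi. (\<lfloor>x f\<rfloor>, \<lceil>x f\<rceil>))"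

lemma face_iff_pattern: "y \<in> face x \<longleftrightarrow> y \<in> V \<and> pattern y = pattern x"
  by (auto simp: face_def pattern_def fun_eq_iff restrict_def)

text \<open>Removing the integer parts of the coordinates of x leaves coefficients in [0, 1). The
  value at f is then bounded by c f, the sum of the absolute coordinates of f, which leaves finitely
  many floors and ceilings.\<close>

lemma finite_patterns_mod_integral:
  obtains P where "finite P" "\<And>x. x \<in> V \<Longrightarrow> \<exists>l\<in>V. integral_on_N l \<and> pattern (x - l) \<in> P"
proof -
  define c where "c f = (\<Sum>i<k. \<bar>p f i\<bar>)" for f
  define P where "P = (\<Pi>\<^sub>E f\<in>Phi. {- c f..c f} \<times> {- c f..c f})"
  have "finite P"
    unfolding P_def using finite_Phi by (intro finite_PiE) auto
  moreover have "\<exists>l\<in>V. integral_on_N l \<and> pattern (x - l) \<in> P" if x: "x \<in> V" for x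
  proof -
    obtain v where v: "\<And>a. a \<in> N \<Longrightarrow> x a = (\<Sum>i<k. v i * real_of_int (p a i))"
      using V_coordinates[OF x] by blast
    define l where "l a = (if a \<in> N then (\<Sum>i<k. of_int \<lfloor>v i\<rfloor> * real_of_int (p a i)) else 0)" for a
    have "l \<in> V"
      by (auto simp: V_def l_def p_mult distrib_left sum.distrib)
    moreover have "integral_on_N l"
      by (auto simp: integral_on_N_def l_def)
    moreover have "pattern (x - l) \<in> P"
    proof -
      have bd: "\<bar>(x - l) f\<bar> \<le> of_int (c f)" if "f \<in> Phi" for f
      proof -
        have "(x - l) f = (\<Sum>i<k. frac (v i) * real_of_int (p f i))"
          using Phi_in_N[OF that] by (simp add: v l_def frac_def left_diff_distrib sum_subtractf)
        also have "\<bar>\<dots>\<bar> \<le> (\<Sum>i<k. \<bar>frac (v i) * real_of_int (p f i)\<bar>)"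
          by (rule sum_abs)
        also have "\<dots> \<le> (\<Sum>i<k. \<bar>real_of_int (p f i)\<bar>)"
        proof (rule sum_mono)
          fix i
          have "\<bar>frac (v i)\<bar> * \<bar>real_of_int (p f i)\<bar> \<le> 1 * \<bar>real_of_int (p f i)\<bar>"
            using frac_lt_1[of "v i"] frac_ge_0[of "v i"] by (intro mult_right_mono) auto
          then show "\<bar>frac (v i) * real_of_int (p f i)\<bar> \<le> \<bar>real_of_int (p f i)\<bar>"
            by (simp add: abs_mult)
        qed
        finally show ?thesis
          by (simp add: c_def)
      qed
      have "\<lfloor>(x - l) f\<rfloor> \<in> {- c f..c f}" "\<lceil>(x - l) f\<rceil> \<in> {- c f..c f}" if "f \<in> Phi" for f
        using bd[OF that] by (auto simp: le_floor_iff floor_le_iff ceiling_le_iff le_ceiling_iff abs_le_iff simp del: minus_apply)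
      then show ?thesis
        unfolding P_def pattern_def by (intro restrict_PiE_iff[THEN iffD2]) (auto simp del: minus_apply)
    qed
    ultimately show ?thesis
      by blast
  qed
  ultimately show ?thesis
    using that by blast
qed

text \<open>N acts trivially on V, so each g j may be replaced by its coset representative, and an
  integral shift of x leaves all characters unchanged. This leaves finitely many choices for
  g.\<close>

lemma standard_form_change:
  assumes sf: "standard_form \<rho> g x" and l: "l \<in> V" "integral_on_N l"
  shows "standard_form \<rho> (\<lambda>i. coset_rep (g i)) (x - l)"
proof -
  note g = standard_formD(3)[OF sf] and x = standard_formD(2)[OF sf]
  have xl: "x - l \<in> V"
    using x l by (intro V_diff)
  have "\<rho> a $ i $ j = (if i = j then circ (act (coset_rep (g j)) (x - l) a) else 0)" if a: "a \<in> N" for a i j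
  proof -
    obtain n where n: "n \<in> N" "coset_rep (g j) = n \<otimes> g j"
      by (rule coset_rep_eq[OF g])
    then have "act (coset_rep (g j)) (x - l) = act n (act (g j) (x - l))"
      using g by (simp add: act_act)
    also have "\<dots> = act (g j) (x - l)"
      using n g xl by (intro act_N act_V) auto
    finally have "act (coset_rep (g j)) (x - l) a = act (g j) x a - act (g j) l a"
      by (simp add: act_diff)
    moreover have "act (g j) l a \<in> \<int>"
      using integral_act[OF g l(2)] a by (simp add: integral_on_N_def)
    ultimately have "circ (act (coset_rep (g j)) (x - l) a) = circ (act (g j) x a)"
      by (simp add: circ_eq_iff)
    then show ?thesis
      by (simp add: standard_form_N[OF sf a])
  qed
  then show ?thesis
    unfolding standard_form_def using standard_formD(1)[OF sf] xl g coset_rep_closed by (auto simp: matrix_eq_iff)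
qed

definition cells :: "('a \<Rightarrow> complex^'n^'n) set option set set" where
  "cells = {cell \<rho> g x |\<rho> g x. irreducible_form \<rho> g x}"

text \<open>Every cell has a presentation in which g takes values in R, the pattern of x is in a
  finite set, and x is the chosen point with that pattern; \<open>finite_cells_of_point\<close>
  bounds what remains.\<close>

lemma finite_cells: "finite (cells :: ('a \<Rightarrow> complex^'n^'n) set option set set)"
proof -
  obtain P where P: "finite P" "\<And>x. x \<in> V \<Longrightarrow> \<exists>l\<in>V. integral_on_N l \<and> pattern (x - l) \<in> P"
    using finite_patterns_mod_integral by blast
  \<comment> \<open>One base point per pattern: twisting within a face moves any representation to
    it without changing the cell.\<close>
  define pt where "pt q = (SOME y. y \<in> V \<and> pattern y = q)" for q
  define F where "F g q = (\<lambda>\<rho>. cell \<rho> g (pt q)) ` {\<rho> :: 'a \<Rightarrow> complex^'n^'n. irreducible_form \<rho> g (pt q)}" for g q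
  have "cells \<subseteq> (\<Union>g\<in>UNIV \<rightarrow>\<^sub>E R. \<Union>q\<in>P. F g q)"
  proof
    fix e :: "('a \<Rightarrow> complex^'n^'n) set option set"
    assume "e \<in> cells"
    then obtain \<rho> g x where e: "e = cell \<rho> g x" and irr: "irreducible_form \<rho> g x"
      by (auto simp: cells_def)
    then have sf: "standard_form \<rho> g x" and nr: "\<not> reducible_rep G \<rho>"
      by (auto simp: irreducible_form_def)
    obtain l where l: "l \<in> V" "integral_on_N l" and Pl: "pattern (x - l) \<in> P"
      using P(2)[OF standard_formD(2)[OF sf]] by blast
    define g' where "g' = (\<lambda>i. coset_rep (g i))"
    define q where "q = pattern (x - l)"
    have sf': "standard_form \<rho> g' (x - l)"
      unfolding g'_def using sf l by (rule standard_form_change)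
    have "pt q \<in> V \<and> pattern (pt q) = q"
      unfolding pt_def by (rule someI[of _ "x - l"]) (intro conjI standard_formD(2)[OF sf'] q_def[symmetric])
    then have pt: "pt q \<in> face (x - l)"
      by (simp add: face_iff_pattern q_def)
    define \<sigma> where "\<sigma> = deform \<rho> g' (pt q - (x - l))"
    have "irreducible_form \<sigma> g' (pt q)"
      unfolding irreducible_form_def \<sigma>_def
      using deform_standard_form[OF sf' face_closed_face[OF pt]] deform_irreducible[OF sf' nr pt] by blast
    moreover have "e = cell \<sigma> g' (pt q)"
      unfolding e \<sigma>_def cell_deform[OF pt] by (rule cell_eq[OF sf sf' refl])
    ultimately have "e \<in> F g' q"
      by (auto simp: F_def)
    moreover have "g' \<in> UNIV \<rightarrow>\<^sub>E R"
      using standard_formD(3)[OF sf] by (auto simp: g'_def intro: coset_rep_in_R)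
    ultimately show "e \<in> (\<Union>g\<in>UNIV \<rightarrow>\<^sub>E R. \<Union>q\<in>P. F g q)"
      using Pl by (auto simp: q_def)
  qed
  moreover have "finite (\<Union>g\<in>(UNIV :: 'n set) \<rightarrow>\<^sub>E R. \<Union>q\<in>P. F g q)"
    using finite_R P(1) by (auto intro!: finite_PiE finite_cells_of_point simp: F_def)
  ultimately show ?thesis
    by (rule finite_subset)
qed

end

section \<open>Dimensions and charts\<close>

interpretation real_fun: vector_space "\<lambda>(c::real) (f::'a \<Rightarrow> real). (\<lambda>a. c * f a)"
  by unfold_locales (auto simp: fun_eq_iff algebra_simps)

lemma sum_fun_apply: "(\<Sum>i\<in>A. F i) a = (\<Sum>i\<in>A. F i a :: real)"
  by (induction A rule: infinite_finite_induct) auto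

text \<open>Coordinate vectors are sequences vanishing from m on, to match the discs in
  \<open>Euclidean_space\<close>. The finite spanning set B ensures that the basis of W is
  finite.\<close>

lemma function_space_basis:
  fixes W B :: "('a \<Rightarrow> real) set"
  assumes sub: "real_fun.subspace W" and B: "W \<subseteq> real_fun.span B" "finite B"
  defines "m \<equiv> real_fun.dim W"
  obtains b where "\<And>l. l < m \<Longrightarrow> b l \<in> W"
    "bij_betw (\<lambda>t a. \<Sum>l<m. t l * b l a) {t. \<forall>i\<ge>m. t i = 0} W"
proof -
  obtain C where C: "C \<subseteq> W" "\<not> real_fun.dependent C" "W \<subseteq> real_fun.span C" "card C = m"
    using real_fun.basis_exists[of W] unfolding m_def by blast
  have finC: "finite C"
    using real_fun.independent_span_bound[OF B(2) C(2)] C(1) B(1) by blast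
  obtain b where b: "bij_betw b {..<m} C"
    using ex_bij_betw_nat_finite[OF finC] C(4) by (auto simp: atLeast0LessThan)
  have inW: "b l \<in> W" if "l < m" for l
    using b C(1) that by (auto simp: bij_betw_def)
  let ?F = "\<lambda>t a. \<Sum>l<m. t l * b l a"
  let ?E = "{t :: nat \<Rightarrow> real. \<forall>i\<ge>m. t i = 0}"
  have F_sum: "?F t = (\<Sum>l<m. (\<lambda>a. t l * b l a))" for t
    by (simp add: fun_eq_iff sum_fun_apply)
  have "?F ` ?E = W"
  proof (intro subset_antisym subsetI)
    fix u assume "u \<in> ?F ` ?E"
    then obtain t where t: "u = ?F t"
      by blast
    show "u \<in> W"
      unfolding t F_sum by (intro real_fun.subspace_sum[OF sub] real_fun.subspace_scale[OF sub] inW) simp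
  next
    fix u assume "u \<in> W"
    then have "u \<in> real_fun.span C"
      using C(3) by blast
    then obtain q where q: "u = (\<Sum>v\<in>C. (\<lambda>a. q v * v a))"
      unfolding real_fun.span_finite[OF finC] by blast
    also have "\<dots> = (\<Sum>l<m. (\<lambda>a. q (b l) * b l a))"
      by (rule sum.reindex_bij_betw[OF b, symmetric])
    also have "\<dots> = ?F (\<lambda>l. if l < m then q (b l) else 0)"
      by (auto simp: fun_eq_iff sum_fun_apply)
    finally have "u = ?F (\<lambda>l. if l < m then q (b l) else 0)" .
    then show "u \<in> ?F ` ?E"
      unfolding image_iff by (intro bexI[of _ "\<lambda>l. if l < m then q (b l) else 0"]) simp_all
  qed
  moreover have "inj_on ?F ?E"
  proof (rule inj_onI)
    fix s t assume s: "s \<in> ?E" and t: "t \<in> ?E" and eq: "?F s = ?F t"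
    define q where "q v = s (the_inv_into {..<m} b v) - t (the_inv_into {..<m} b v)" for v
    have qb: "q (b l) = s l - t l" if "l < m" for l
      using that b unfolding q_def by (simp add: the_inv_into_f_f bij_betw_def)
    have "(\<Sum>v\<in>C. (\<lambda>a. q v * v a)) = (\<Sum>l<m. (\<lambda>a. q (b l) * b l a))"
      by (rule sum.reindex_bij_betw[OF b, symmetric])
    also have "\<dots> = (\<Sum>l<m. (\<lambda>a. (s l - t l) * b l a))"
      by (rule sum.cong) (simp_all add: qb)
    also have "\<dots> = 0"
      using eq by (simp add: fun_eq_iff sum_fun_apply left_diff_distrib sum_subtractf)
    finally have z: "(\<Sum>v\<in>C. (\<lambda>a. q v * v a)) = 0" .
    have "q v = 0" if "v \<in> C" for v
      using real_fun.independentD[OF C(2) finC subset_refl z that] .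
    then have "s l = t l" if "l < m" for l
      using qb[OF that] b that by (auto simp: bij_betw_def)
    then show "s = t"
      using s t by (auto simp: fun_eq_iff) (metis not_le)
  qed
  ultimately show ?thesis
    using that[OF inW] by (simp add: bij_betw_def)
qed

lemma function_space_dim_less:
  fixes W W' B :: "('a \<Rightarrow> real) set"
  assumes W: "W \<subseteq> real_fun.span B" "finite B" and W': "real_fun.subspace W'" "W' \<subseteq> W" and u: "u \<in> W" "u \<notin> W'"
  shows "real_fun.dim W' < real_fun.dim W"
proof -
  obtain C where C: "C \<subseteq> W" "\<not> real_fun.dependent C" "W \<subseteq> real_fun.span C" "card C = real_fun.dim W"
    using real_fun.basis_exists[of W] by blast
  obtain C' where C': "C' \<subseteq> W'" "\<not> real_fun.dependent C'" "W' \<subseteq> real_fun.span C'" "card C' = real_fun.dim W'"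
    using real_fun.basis_exists[of W'] by blast
  have finC: "finite C"
    using real_fun.independent_span_bound[OF W(2) C(2)] C(1) W(1) by blast
  have "real_fun.span C' \<subseteq> W'"
    using C'(1) W'(1) by (rule real_fun.span_minimal)
  then have "u \<notin> real_fun.span C'"
    using u by blast
  then have ind: "\<not> real_fun.dependent (insert u C')"
    using C'(2) by (rule real_fun.independent_insertI)
  have "insert u C' \<subseteq> real_fun.span C"
    using C'(1) W'(2) u(1) C(3) by auto
  then have "finite (insert u C') \<and> card (insert u C') \<le> card C"
    by (rule real_fun.independent_span_bound[OF finC ind])
  moreover have "u \<notin> C'"
    using \<open>u \<notin> real_fun.span C'\<close> real_fun.span_base by blast
  ultimately show ?thesis
    using C(4) C'(4) by auto
qed

context lattice_extension
begin

text \<open>The tangent space of the face of x: the forms integral at x are constant on the face,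
  and the others stay strictly between integers near x.\<close>

definition direction :: "('a \<Rightarrow> real) \<Rightarrow> ('a \<Rightarrow> real) set" where
  "direction x = {u \<in> V. \<forall>f\<in>Phi. x f \<in> \<int> \<longrightarrow> u f = 0}"

definition face_dim :: "('a \<Rightarrow> real) \<Rightarrow> nat" where
  "face_dim x = real_fun.dim (direction x)"

definition coords :: "('a \<Rightarrow> real) set" where
  "coords = (\<lambda>i a. if a \<in> N then real_of_int (p a i) else 0) ` {..<k}"

lemma finite_coords: "finite coords" and card_coords: "card coords \<le> k"
  using card_image_le[of "{..<k}"] by (auto simp: coords_def)

lemma V_span: "V \<subseteq> real_fun.span coords"
proof
  fix x assume x: "x \<in> V"
  obtain v where v: "\<And>a. a \<in> N \<Longrightarrow> x a = (\<Sum>i<k. v i * real_of_int (p a i))"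
    using V_coordinates[OF x] by blast
  have "x = (\<Sum>i<k. (\<lambda>a. v i * (if a \<in> N then real_of_int (p a i) else 0)))"
  proof
    fix a
    show "x a = (\<Sum>i<k. (\<lambda>a. v i * (if a \<in> N then real_of_int (p a i) else 0))) a"
      using v[of a] V_outside[OF x, of a] by (cases "a \<in> N") (simp_all add: sum_fun_apply)
  qed
  also have "\<dots> \<in> real_fun.span coords"
    by (intro real_fun.span_sum real_fun.span_scale real_fun.span_base) (auto simp: coords_def)
  finally show "x \<in> real_fun.span coords" .
qed

lemma direction_V: "direction x \<subseteq> V"
  by (auto simp: direction_def)

lemma direction_span: "direction x \<subseteq> real_fun.span coords"
  using direction_V V_span by blast

lemma subspace_direction: "real_fun.subspace (direction x)"
  unfolding real_fun.subspace_def direction_def by (auto simp: V_zero V_add V_scale)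

lemma face_dim_le: "face_dim x \<le> k"
  unfolding face_dim_def
  using real_fun.dim_le_card[OF direction_span finite_coords] card_coords by (rule le_trans)

lemma closed_face_eq_if_integral:
  assumes "y \<in> closed_face x" "f \<in> Phi" "x f \<in> \<int>"
  shows "y f = x f"
proof -
  obtain n where n: "x f = of_int n"
    using assms(3) by (auto elim: Ints_cases)
  have "of_int \<lfloor>x f\<rfloor> \<le> y f \<and> y f \<le> of_int \<lceil>x f\<rceil>"
    using assms(1,2) by (auto simp: closed_face_def)
  then show ?thesis
    by (simp add: n)
qed

lemma closed_face_direction:
  assumes "x \<in> V" "y \<in> closed_face x"
  shows "y - x \<in> direction x"
  using assms V_diff closed_face_V closed_face_eq_if_integral by (auto simp: direction_def)

lemma ceiling_eq_floor_plus_1: "\<lceil>r\<rceil> = \<lfloor>r\<rfloor> + 1" if "r \<notin> \<int>" for r :: real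
  using that by (metis Ints_of_int ceiling_altdef)

text \<open>Forms integral at x stay integral at y, and leaving the open face makes a further one
  integral. The vector y - x is tangent to the face of x but is not killed by that new form.\<close>

lemma face_dim_less:
  assumes x: "x \<in> V" and y: "y \<in> closed_face x" "y \<notin> face x"
  shows "face_dim y < face_dim x"
  unfolding face_dim_def
proof (rule function_space_dim_less[OF direction_span finite_coords subspace_direction])
  have yV: "y \<in> V"
    using y(1) by (rule closed_face_V)
  show "direction y \<subseteq> direction x"
    using closed_face_eq_if_integral[OF y(1)] by (auto simp: direction_def)
  show "y - x \<in> direction x"
    using x y(1) by (rule closed_face_direction)
  obtain f where f: "f \<in> Phi" "\<lfloor>y f\<rfloor> \<noteq> \<lfloor>x f\<rfloor> \<or> \<lceil>y f\<rceil> \<noteq> \<lceil>x f\<rceil>"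
    using y(2) yV by (auto simp: face_def)
  have xf: "x f \<notin> \<int>"
    using closed_face_eq_if_integral[OF y(1) f(1)] f(2) by auto
  have bd: "of_int \<lfloor>x f\<rfloor> \<le> y f" "y f \<le> of_int \<lfloor>x f\<rfloor> + 1"
    using y(1) f(1) ceiling_eq_floor_plus_1[OF xf] by (auto simp: closed_face_def)
  \<comment> \<open>y f lies in the closed unit interval between the floor and ceiling of x f; in
    the open interval it would have the same floor and ceiling as x f.\<close>
  have yf: "y f \<in> \<int>"
  proof (rule ccontr)
    assume ny: "y f \<notin> \<int>"
    have "y f \<noteq> of_int \<lfloor>x f\<rfloor> + 1"
      using ny by (metis Ints_of_int of_int_1 of_int_add)
    then have "\<lfloor>y f\<rfloor> = \<lfloor>x f\<rfloor>"
      using bd by (intro floor_unique) auto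
    then show False
      using f(2) ceiling_eq_floor_plus_1[OF xf] ceiling_eq_floor_plus_1[OF ny] by simp
  qed
  then have "(y - x) f \<noteq> 0"
    using xf by auto
  then show "y - x \<notin> direction y"
    using f(1) yf unfolding direction_def by blast
qed

lemma face_dim_face:
  assumes "y \<in> face x"
  shows "face_dim y = face_dim x"
proof -
  have "r \<in> \<int> \<longleftrightarrow> \<lceil>r\<rceil> = \<lfloor>r\<rfloor>" for r :: real
    using ceiling_eq_floor_plus_1[of r] by (cases "r \<in> \<int>") (auto elim: Ints_cases)
  then have "direction y = direction x"
    using assms by (auto simp: direction_def face_def)
  then show ?thesis
    by (simp add: face_dim_def)
qed

text \<open>The linear part of the symmetry maps a basis of the direction space of x to a spanning
  set of the new one. The reverse inequality comes from the inverse affine map.\<close>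

lemma face_dim_affine_act_le:
  assumes x: "x \<in> V" and g: "g \<in> carrier G" and l: "l \<in> V" "integral_on_N l"
  shows "face_dim (act g x + l) \<le> face_dim x"
proof -
  obtain C where C: "C \<subseteq> direction x" "\<not> real_fun.dependent C" "direction x \<subseteq> real_fun.span C" "card C = real_fun.dim (direction x)"
    using real_fun.basis_exists[of "direction x"] by blast
  have finC: "finite C"
    using real_fun.independent_span_bound[OF finite_coords C(2)] C(1) direction_span by blast
  have "direction (act g x + l) \<subseteq> real_fun.span (act g ` C)"
  proof
    fix u assume u: "u \<in> direction (act g x + l)"
    then have uV: "u \<in> V"
      by (simp add: direction_def)
    define w where "w = act (inv g) u"
    have gw: "act g w = u"
      using g uV by (simp add: w_def act_act act_one)
    have "w \<in> direction x"
      unfolding direction_def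
    proof (intro CollectI conjI ballI impI)
      show "w \<in> V"
        using g uV by (simp add: w_def act_V)
      fix f assume f: "f \<in> Phi" and xf: "x f \<in> \<int>"
      let ?f = "g \<otimes> f \<otimes> inv g"
      have f': "?f \<in> Phi"
        using Phi_conj[of "inv g" f] g f by simp
      have fN: "f \<in> carrier G"
        using Phi_in_N[OF f] by simp
      have back_conj: "inv g \<otimes> ?f \<otimes> g = f"
        using g fN by (simp add: m_assoc) (simp flip: m_assoc)
      have "(act g x + l) ?f = x f + l ?f"
        using Phi_in_N[OF f'] by (simp add: act_apply back_conj)
      then have "(act g x + l) ?f \<in> \<int>"
        using xf l(2) Phi_in_N[OF f'] by (simp add: integral_on_N_def)
      then have "u ?f = 0"
        using u f' by (simp add: direction_def)
      then show "w f = 0"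
        using Phi_in_N[OF f] g by (simp add: w_def act_apply)
    qed
    then have "w \<in> real_fun.span C"
      using C(3) by blast
    then obtain q where q: "w = (\<Sum>v\<in>C. (\<lambda>a. q v * v a))"
      unfolding real_fun.span_finite[OF finC] by blast
    have "u = (\<Sum>v\<in>C. (\<lambda>a. q v * act g v a))"
      unfolding gw[symmetric] q by (auto simp: act_def fun_eq_iff sum_fun_apply)
    also have "\<dots> \<in> real_fun.span (act g ` C)"
      by (intro real_fun.span_sum real_fun.span_scale real_fun.span_base) auto
    finally show "u \<in> real_fun.span (act g ` C)" .
  qed
  then have "real_fun.dim (direction (act g x + l)) \<le> card (act g ` C)"
    using finC by (intro real_fun.dim_le_card) auto
  also have "\<dots> \<le> card C"
    using finC by (rule card_image_le)
  finally show ?thesis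
    using C(4) by (simp add: face_dim_def)
qed

lemma face_dim_affine_act:
  assumes x: "x \<in> V" and g: "g \<in> carrier G" and l: "l \<in> V" "integral_on_N l"
  shows "face_dim (act g x + l) = face_dim x"
proof (rule antisym[OF face_dim_affine_act_le[OF assms]])
  define l' where "l' = 0 - act (inv g) l"
  have l': "l' \<in> V"
    unfolding l'_def using g l by (intro V_diff V_zero act_V) auto
  have il': "integral_on_N l'"
    unfolding l'_def using g by (intro integral_diff integral_act l) (auto simp: integral_on_N_def)
  have "act (inv g) (act g x + l) + l' = x"
    using g x by (simp add: act_add act_inv_act l'_def)
  then show "face_dim x \<le> face_dim (act g x + l)"
    using face_dim_affine_act_le[of "act g x + l" "inv g" l'] x g l l' il' by (simp add: V_add act_V)
qed

text \<open>The gauge is the maximum of the linear forms \<open>h\<close> for which \<open>h \<le> 1\<close> are the inequalities that cut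
  out the closed face, with origin at \<open>x\<close>.\<close>
lemma face_chart:
  assumes x: "x \<in> V"
  obtains \<psi> where "bij_betw \<psi> (disc (face_dim x)) (closed_face x)"
    "\<forall>u\<in>disc (face_dim x). \<psi> u \<in> face x \<longleftrightarrow> (\<Sum>i<face_dim x. (u i)\<^sup>2) < 1"
    "\<forall>a. continuous_on (disc (face_dim x)) (\<lambda>u. \<psi> u a)"
proof -
  define m where "m = face_dim x"
  obtain b where b: "\<And>l. l < m \<Longrightarrow> b l \<in> direction x"
    and bij: "bij_betw (\<lambda>t a. \<Sum>l<m. t l * b l a) {t. \<forall>i\<ge>m. t i = 0} (direction x)"
    using function_space_basis[OF subspace_direction direction_span finite_coords, of x]
    unfolding m_def face_dim_def by blast
  define F where "F t a = (\<Sum>l<m. t l * b l a)" for t a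
  have bijF: "bij_betw F {t. \<forall>i\<ge>m. t i = 0} (direction x)"
    using bij unfolding F_def[abs_def] .
  have F_scale: "F (\<lambda>i. c * t i) a = c * F t a" for c t a
    by (simp add: F_def sum_distrib_left mult.assoc)
  have F_cont: "continuous_on A (\<lambda>t. F t a)" for A a
    unfolding F_def by (intro continuous_intros)
  have FV: "F t \<in> direction x" if "\<forall>i\<ge>m. t i = 0" for t
    using bijF that by (auto simp: bij_betw_def)
  \<comment> \<open>Forms integral at x hold automatically on the direction space. Each remaining
    form gives two inequalities, with \<open>True\<close> for the upper bound and
    \<open>False\<close> for the lower one; the denominators in h normalize both to h <= 1.\<close>
  define I where "I = {f\<in>Phi. x f \<notin> \<int>} \<times> (UNIV :: bool set)"
  define h where "h z t = (if snd z then F t (fst z) / (of_int \<lceil>x (fst z)\<rceil> - x (fst z))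
      else - F t (fst z) / (x (fst z) - of_int \<lfloor>x (fst z)\<rfloor>))" for z t
  \<comment> \<open>\<open>None\<close> stands for the zero form, which keeps the maximum defined
    when I is empty, as at a vertex.\<close>
  define J where "J = insert None (Some ` I)"
  define g where "g t = Max ((\<lambda>z. case z of None \<Rightarrow> 0 | Some z \<Rightarrow> h z t) ` J)" for t
  have finJ: "finite J" "J \<noteq> {}"
    using finite_Phi by (auto simp: J_def I_def)
  have finite_image: "finite ((\<lambda>z. case z of None \<Rightarrow> 0 | Some z \<Rightarrow> h z t) ` J)" for t
    using finJ by simp
  have ne_image: "(\<lambda>z. case z of None \<Rightarrow> 0 | Some z \<Rightarrow> h z t) ` J \<noteq> {}" for t
    using finJ by simp
  have g_le: "g t \<le> 1 \<longleftrightarrow> (\<forall>z\<in>I. h z t \<le> 1)" and g_less: "g t < 1 \<longleftrightarrow> (\<forall>z\<in>I. h z t < 1)"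
    and g_le0: "g t \<le> 0 \<longleftrightarrow> (\<forall>z\<in>I. h z t \<le> 0)" for t
    unfolding g_def Max_le_iff[OF finite_image ne_image] Max_less_iff[OF finite_image ne_image]
    by (auto simp: J_def)
  have h_scale: "h z (\<lambda>i. c * t i) = c * h z t" for z c t
    unfolding h_def F_scale by simp
  have pos: "of_int \<lceil>x f\<rceil> - x f > 0" "x f - of_int \<lfloor>x f\<rfloor> > 0" if "x f \<notin> \<int>" for f
  proof -
    have "x f \<noteq> of_int \<lceil>x f\<rceil>" "x f \<noteq> of_int \<lfloor>x f\<rfloor>"
      using that by (metis Ints_of_int)+
    then show "of_int \<lceil>x f\<rceil> - x f > 0" "x f - of_int \<lfloor>x f\<rfloor> > 0"
      using le_of_int_ceiling[of "x f"] of_int_floor_le[of "x f"] by linarith+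
  qed
  have I_iff: "(\<forall>z\<in>I. h z t \<le> 1) \<longleftrightarrow> (\<forall>f\<in>Phi. x f \<notin> \<int> \<longrightarrow> of_int \<lfloor>x f\<rfloor> \<le> x f + F t f \<and> x f + F t f \<le> of_int \<lceil>x f\<rceil>)"
    "(\<forall>z\<in>I. h z t < 1) \<longleftrightarrow> (\<forall>f\<in>Phi. x f \<notin> \<int> \<longrightarrow> of_int \<lfloor>x f\<rfloor> < x f + F t f \<and> x f + F t f < of_int \<lceil>x f\<rceil>)"
    "(\<forall>z\<in>I. h z t \<le> 0) \<longleftrightarrow> (\<forall>f\<in>Phi. x f \<notin> \<int> \<longrightarrow> F t f = 0)" for t
  proof -
    have all: "(\<forall>z\<in>I. Q z) \<longleftrightarrow> (\<forall>f\<in>Phi. x f \<notin> \<int> \<longrightarrow> Q (f, False) \<and> Q (f, True))" for Q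
      by (auto simp: I_def) (metis (full_types))
    have "h (f, True) t \<le> 1 \<longleftrightarrow> x f + F t f \<le> of_int \<lceil>x f\<rceil>" "h (f, False) t \<le> 1 \<longleftrightarrow> of_int \<lfloor>x f\<rfloor> \<le> x f + F t f"
       "h (f, True) t < 1 \<longleftrightarrow> x f + F t f < of_int \<lceil>x f\<rceil>" "h (f, False) t < 1 \<longleftrightarrow> of_int \<lfloor>x f\<rfloor> < x f + F t f"
       "h (f, True) t \<le> 0 \<longleftrightarrow> F t f \<le> 0" "h (f, False) t \<le> 0 \<longleftrightarrow> F t f \<ge> 0" if "x f \<notin> \<int>" for f
      using pos[OF that] by (auto simp: h_def pos_divide_le_eq pos_divide_less_eq pos_le_divide_eq pos_less_divide_eq
          divide_le_0_iff zero_le_divide_iff)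
    then show "(\<forall>z\<in>I. h z t \<le> 1) \<longleftrightarrow> (\<forall>f\<in>Phi. x f \<notin> \<int> \<longrightarrow> of_int \<lfloor>x f\<rfloor> \<le> x f + F t f \<and> x f + F t f \<le> of_int \<lceil>x f\<rceil>)"
      "(\<forall>z\<in>I. h z t < 1) \<longleftrightarrow> (\<forall>f\<in>Phi. x f \<notin> \<int> \<longrightarrow> of_int \<lfloor>x f\<rfloor> < x f + F t f \<and> x f + F t f < of_int \<lceil>x f\<rceil>)"
      "(\<forall>z\<in>I. h z t \<le> 0) \<longleftrightarrow> (\<forall>f\<in>Phi. x f \<notin> \<int> \<longrightarrow> F t f = 0)"
      unfolding all by (auto intro: antisym)
  qed
  have tight: "F t f = 0" if "\<forall>i\<ge>m. t i = 0" "f \<in> Phi" "x f \<in> \<int>" for t f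
    using FV[OF that(1)] that(2,3) by (simp add: direction_def)
  have in_closed: "x + F t \<in> closed_face x \<longleftrightarrow> g t \<le> 1" if t: "\<forall>i\<ge>m. t i = 0" for t
  proof -
    have "x + F t \<in> V"
      using x FV[OF t] direction_V by (intro V_add) auto
    moreover have "of_int \<lfloor>x f\<rfloor> \<le> (x + F t) f \<and> (x + F t) f \<le> of_int \<lceil>x f\<rceil>" if "f \<in> Phi" "x f \<in> \<int>" for f
      using tight[OF t that] by simp
    ultimately show ?thesis
      unfolding g_le I_iff closed_face_def by auto
  qed
  have in_open: "x + F t \<in> face x \<longleftrightarrow> g t < 1" if t: "\<forall>i\<ge>m. t i = 0" for t
  proof -
    have "x + F t \<in> V"
      using x FV[OF t] direction_V by (intro V_add) auto
    moreover have "\<lfloor>x f + F t f\<rfloor> = \<lfloor>x f\<rfloor> \<and> \<lceil>x f + F t f\<rceil> = \<lceil>x f\<rceil> \<longleftrightarrow>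
      (x f \<notin> \<int> \<longrightarrow> of_int \<lfloor>x f\<rfloor> < x f + F t f \<and> x f + F t f < of_int \<lceil>x f\<rceil>)" if f: "f \<in> Phi" for f
    proof (cases "x f \<in> \<int>")
      case True
      then show ?thesis
        using tight[OF t f] by simp
    next
      case False
      then show ?thesis
        unfolding ceiling_eq_floor_plus_1[OF False] floor_eq_iff ceiling_eq_iff by auto
    qed
    ultimately show ?thesis
      unfolding g_less I_iff face_def by simp
  qed
  have g_cont: "continuous_on UNIV g"
    unfolding g_def
  proof (rule continuous_on_Max_finite[OF finJ])
    fix z assume "z \<in> J"
    show "continuous_on UNIV (\<lambda>t. case z of None \<Rightarrow> 0 | Some z \<Rightarrow> h z t)"
    proof (cases z)
      case (Some w)
      have "continuous_on UNIV (h w)"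
        unfolding h_def[abs_def] divide_inverse by (cases "snd w") (auto intro!: continuous_intros F_cont)
      then show ?thesis
        using Some by simp
    qed simp
  qed
  have g_scale: "g (\<lambda>i. c * t i) = c * g t" if "c \<ge> 0" for c t
  proof -
    have "c * g t = Max ((\<lambda>r. c * r) ` (\<lambda>z. case z of None \<Rightarrow> 0 | Some z \<Rightarrow> h z t) ` J)"
      unfolding g_def using that by (intro mono_Max_commute finite_image ne_image monoI mult_left_mono)
    also have "(\<lambda>r. c * r) ` (\<lambda>z. case z of None \<Rightarrow> 0 | Some z \<Rightarrow> h z t) ` J =
       (\<lambda>z. case z of None \<Rightarrow> 0 | Some z \<Rightarrow> h z (\<lambda>i. c * t i)) ` J"
      unfolding image_image by (rule image_cong) (auto simp: h_scale split: option.split)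
    finally show ?thesis
      by (simp add: g_def)
  qed
  \<comment> \<open>A nonpositive gauge forces both signs of every nonintegral form to be
    nonpositive, so all forms vanish on F t. Since \<open>Phi\<close> contains the generators S,
    this gives F t = 0 and then t = 0.\<close>
  have g_pos: "g t > 0" if t: "\<And>i. i \<ge> m \<Longrightarrow> t i = 0" and ne: "\<exists>i. t i \<noteq> 0" for t
  proof (rule ccontr)
    have t': "\<forall>i\<ge>m. t i = 0"
      using t by blast
    assume "\<not> g t > 0"
    then have "F t f = 0" if "f \<in> Phi" for f
      using g_le0[of t] I_iff(3)[of t] tight[OF t' that] that by force
    then have "F t = 0"
      using FV[OF t'] direction_V S_Phi by (intro V_eq_on_S V_zero) auto
    moreover have "F (\<lambda>i. 0) = 0"
      by (simp add: F_def fun_eq_iff)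
    ultimately have "t = (\<lambda>i. 0)"
      using bijF t' by (intro inj_onD[of F "{t. \<forall>i\<ge>m. t i = 0}"]) (auto simp: bij_betw_def)
    then show False
      using ne by simp
  qed
  obtain r where r: "continuous_on (disc m) r"
    "bij_betw r (disc m) {t. (\<forall>i\<ge>m. t i = 0) \<and> g t \<le> 1}"
    "\<forall>u\<in>disc m. g (r u) < 1 \<longleftrightarrow> (\<Sum>i<m. (u i)\<^sup>2) < 1"
    by (rule radial_disc_map[OF g_cont g_scale g_pos])
  have bij2: "bij_betw (\<lambda>t. x + F t) {t. (\<forall>i\<ge>m. t i = 0) \<and> g t \<le> 1} (closed_face x)"
  proof (rule bij_betw_imageI)
    show "inj_on (\<lambda>t. x + F t) {t. (\<forall>i\<ge>m. t i = 0) \<and> g t \<le> 1}"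
      using bijF by (auto simp: bij_betw_def inj_on_def)
    show "(\<lambda>t. x + F t) ` {t. (\<forall>i\<ge>m. t i = 0) \<and> g t \<le> 1} = closed_face x"
    proof (intro subset_antisym subsetI)
      fix y assume "y \<in> (\<lambda>t. x + F t) ` {t. (\<forall>i\<ge>m. t i = 0) \<and> g t \<le> 1}"
      then show "y \<in> closed_face x"
        using in_closed by auto
    next
      fix y assume y: "y \<in> closed_face x"
      then obtain t where t: "\<forall>i\<ge>m. t i = 0" "y - x = F t"
        using closed_face_direction[OF x y] bijF unfolding bij_betw_def by (metis (mono_tags, lifting) imageE mem_Collect_eq)
      then have yt: "y = x + F t"
        by (auto simp: fun_eq_iff algebra_simps)
      then show "y \<in> (\<lambda>t. x + F t) ` {t. (\<forall>i\<ge>m. t i = 0) \<and> g t \<le> 1}"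
        using in_closed[OF t(1)] y t(1) by blast
    qed
  qed
  define \<psi> where "\<psi> u = x + F (r u)" for u
  show ?thesis
  proof (rule that[of \<psi>, folded m_def])
    show "bij_betw \<psi> (disc m) (closed_face x)"
      using bij_betw_trans[OF r(2) bij2] by (simp add: \<psi>_def[abs_def] o_def)
    show "\<forall>u\<in>disc m. \<psi> u \<in> face x \<longleftrightarrow> (\<Sum>i<m. (u i)\<^sup>2) < 1"
    proof
      fix u assume u: "u \<in> disc m"
      have "\<forall>i\<ge>m. r u i = 0"
        using r(2) u by (auto simp: bij_betw_def)
      then show "\<psi> u \<in> face x \<longleftrightarrow> (\<Sum>i<m. (u i)\<^sup>2) < 1"
        unfolding \<psi>_def using in_open r(3) u by simp
    qed
    show "\<forall>a. continuous_on (disc m) (\<lambda>u. \<psi> u a)"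
    proof
      fix a
      have "continuous_on (disc m) (\<lambda>u. F (r u) a)"
        by (rule continuous_on_compose2[OF F_cont[of UNIV] r(1)]) simp
      then show "continuous_on (disc m) (\<lambda>u. \<psi> u a)"
        by (simp add: \<psi>_def continuous_on_add continuous_on_const)
    qed
  qed
qed

end

section \<open>The cell structure\<close>

lemma topspace_open_disc: "topspace (open_disc m) = {u \<in> disc m. (\<Sum>i<m. (u i)\<^sup>2) < 1}"
  by (auto simp: open_disc_eq closed_disc_eq)

lemma disc_boundary_eq: "disc_boundary m = {u \<in> disc m. (\<Sum>i<m. (u i)\<^sup>2) = 1}"
  by (auto simp: disc_boundary_def disc_def topspace_Euclidean_space)

context lattice_extension
begin

lemma orbit_in_cell:
  assumes "standard_form \<rho> g x"
  shows "Some (rep_orbit G \<rho>) \<in> cell \<rho> g x"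
proof -
  have "deform \<rho> g (x - x) = \<rho>"
    using deform_zero[OF standard_formD(1)[OF assms]] by simp
  then show ?thesis
    unfolding cell_def using face_refl[OF standard_formD(2)[OF assms]]
    by (intro image_eqI[of _ _ x]) simp_all
qed

text \<open>A cell is a mere set with many presentations, so its dimension must be shown independent
  of the chosen one: any two base points are related by an affine symmetry and a move within a
  face.\<close>

lemma cell_face_dim:
  fixes \<rho> \<rho>' :: "'a \<Rightarrow> complex^'n^'n"
  assumes sf: "standard_form \<rho> g x" and sf': "standard_form \<rho>' g' x'" and eq: "cell \<rho> g x = cell \<rho>' g' x'"
  shows "face_dim x = face_dim x'"
proof -
  have "Some (rep_orbit G \<rho>) \<in> cell \<rho>' g' x'"
    using orbit_in_cell[OF sf] eq by simp
  then obtain y where y: "y \<in> face x'" "rep_orbit G \<rho> = rep_orbit G (deform \<rho>' g' (y - x'))"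
    by (auto simp: cell_def)
  obtain \<gamma> l where "\<gamma> \<in> carrier G" "l \<in> V" "integral_on_N l" "y = act \<gamma> x + l"
    by (rule standard_form_orbit_eq[OF sf deform_standard_form[OF sf' face_closed_face[OF y(1)]] y(2)])
  then have "face_dim y = face_dim x"
    using face_dim_affine_act[OF standard_formD(2)[OF sf]] by simp
  then show ?thesis
    using face_dim_face[OF y(1)] by simp
qed

definition chart :: "('a \<Rightarrow> real) \<Rightarrow> ((nat \<Rightarrow> real) \<Rightarrow> 'a \<Rightarrow> real) \<Rightarrow> bool" where
  "chart x \<psi> \<longleftrightarrow> bij_betw \<psi> (disc (face_dim x)) (closed_face x) \<and>
    (\<forall>u\<in>disc (face_dim x). \<psi> u \<in> face x \<longleftrightarrow> (\<Sum>i<face_dim x. (u i)\<^sup>2) < 1) \<and>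
    (\<forall>a. continuous_on (disc (face_dim x)) (\<lambda>u. \<psi> u a))"

text \<open>This is the characteristic map on the whole closed disc; \<open>irr_plus_proj\<close>
  sends the twists that become reducible to the base point.\<close>

definition attaching_map ::
  "('a \<Rightarrow> complex^'n^'n) \<Rightarrow> ('n \<Rightarrow> 'a) \<Rightarrow> ('a \<Rightarrow> real) \<Rightarrow> ((nat \<Rightarrow> real) \<Rightarrow> 'a \<Rightarrow> real) \<Rightarrow>
    (nat \<Rightarrow> real) \<Rightarrow> ('a \<Rightarrow> complex^'n^'n) set option" where
  "attaching_map \<rho> g x \<psi> u = irr_plus_proj G (deform \<rho> g (\<psi> u - x))"

lemma continuous_attaching_map:
  fixes \<rho> :: "'a \<Rightarrow> complex^'n^'n"
  assumes sf: "standard_form \<rho> g x" and c: "chart x \<psi>"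
  shows "continuous_map (closed_disc (face_dim x)) (Irr_plus_top G) (attaching_map \<rho> g x \<psi>)"
proof -
  let ?D = "disc (face_dim x)"
  have bij: "bij_betw \<psi> ?D (closed_face x)" and cont: "\<And>a. continuous_on ?D (\<lambda>u. \<psi> u a)"
    using c by (auto simp: chart_def)
  have "continuous_map (closed_disc (face_dim x)) (Hom_top G) (\<lambda>u. deform \<rho> g (\<psi> u - x))"
  proof (rule continuous_map_into_Hom_top)
    fix u assume "u \<in> topspace (closed_disc (face_dim x))"
    then have "\<psi> u \<in> closed_face x"
      using bij by (auto simp: closed_disc_eq bij_betw_def)
    then show "deform \<rho> g (\<psi> u - x) \<in> Hom_U G"
      using deform_standard_form[OF sf] standard_formD(1) by blast
  next
    fix \<gamma> assume \<gamma>: "\<gamma> \<in> carrier G"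
    have act: "continuous_on ?D (\<lambda>u. act (g j) (\<psi> u - x) a)" for j a
      by (cases "a \<in> N") (auto simp: act_def intro!: continuous_intros cont)
    have "continuous_on ?D (\<lambda>u. \<chi> i j. \<rho> \<gamma> $ i $ j * circ (transfer \<gamma> (act (g j) (\<psi> u - x))))"
      unfolding transfer_def divide_inverse by (intro continuous_intros act)
    then show "continuous_map (closed_disc (face_dim x)) euclidean (\<lambda>u. deform \<rho> g (\<psi> u - x) \<gamma>)"
      using \<gamma> by (simp add: deform_def closed_disc_eq)
  qed
  from continuous_map_compose[OF this continuous_map_irr_plus_proj] show ?thesis
    by (simp add: o_def attaching_map_def[abs_def])
qed

lemma attaching_map_open_disc:
  fixes \<rho> :: "'a \<Rightarrow> complex^'n^'n"
  assumes irr: "irreducible_form \<rho> g x" and c: "chart x \<psi>"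
  shows "inj_on (attaching_map \<rho> g x \<psi>) (topspace (open_disc (face_dim x)))"
    and "attaching_map \<rho> g x \<psi> ` topspace (open_disc (face_dim x)) = cell \<rho> g x"
proof -
  have sf: "standard_form \<rho> g x" and nr: "\<not> reducible_rep G \<rho>"
    using irr by (auto simp: irreducible_form_def)
  let ?O = "topspace (open_disc (face_dim x))"
  have bij: "bij_betw \<psi> (disc (face_dim x)) (closed_face x)"
    and face: "\<forall>u\<in>disc (face_dim x). \<psi> u \<in> face x \<longleftrightarrow> (\<Sum>i<face_dim x. (u i)\<^sup>2) < 1"
    using c by (auto simp: chart_def)
  have O_disc: "?O \<subseteq> disc (face_dim x)"
    by (auto simp: topspace_open_disc)
  have "\<psi> ` ?O = face x"
  proof (intro subset_antisym subsetI)
    fix y assume "y \<in> \<psi> ` ?O"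
    then show "y \<in> face x"
      using face by (auto simp: topspace_open_disc)
  next
    fix y assume y: "y \<in> face x"
    then have "y \<in> \<psi> ` disc (face_dim x)"
      using bij face_closed_face by (simp add: bij_betw_def)
    then obtain u where u: "u \<in> disc (face_dim x)" "y = \<psi> u"
      by blast
    then have "u \<in> ?O"
      using face y by (simp add: topspace_open_disc)
    then show "y \<in> \<psi> ` ?O"
      using u by blast
  qed
  moreover have proj: "irr_plus_proj G (deform \<rho> g (y - x)) = Some (rep_orbit G (deform \<rho> g (y - x)))" if "y \<in> face x" for y
    using deform_irreducible[OF sf nr that] by (simp add: irr_plus_proj_def)
  ultimately show "attaching_map \<rho> g x \<psi> ` ?O = cell \<rho> g x"
    unfolding cell_def by (force simp: attaching_map_def)
  show "inj_on (attaching_map \<rho> g x \<psi>) ?O"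
  proof (rule inj_onI)
    fix u v assume u: "u \<in> ?O" and v: "v \<in> ?O" and eq: "attaching_map \<rho> g x \<psi> u = attaching_map \<rho> g x \<psi> v"
    have fu: "\<psi> u \<in> face x" and fv: "\<psi> v \<in> face x"
      using u v \<open>\<psi> ` ?O = face x\<close> by blast+
    then have "rep_orbit G (deform \<rho> g (\<psi> u - x)) = rep_orbit G (deform \<rho> g (\<psi> v - x))"
      using eq by (simp only: attaching_map_def proj option.inject)
    then have "\<psi> u = \<psi> v"
      by (rule face_orbit_injective[OF sf fu fv])
    then show "u = v"
      using bij u v O_disc by (auto simp: bij_betw_def dest: inj_onD)
  qed
qed

text \<open>A boundary point lies on a face of smaller dimension, so an irreducible twist there
  starts a cell of smaller dimension. In the reducible case positivity of the dimension is recorded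
  because the base point is a 0-cell.\<close>

lemma attaching_map_boundary:
  fixes \<rho> :: "'a \<Rightarrow> complex^'n^'n"
  assumes irr: "irreducible_form \<rho> g x" and c: "chart x \<psi>" and u: "u \<in> disc_boundary (face_dim x)"
  obtains "attaching_map \<rho> g x \<psi> u = None" "0 < face_dim x"
  | \<sigma> y where "irreducible_form \<sigma> g y" "attaching_map \<rho> g x \<psi> u \<in> cell \<sigma> g y" "face_dim y < face_dim x"
proof -
  have sf: "standard_form \<rho> g x"
    using irr by (auto simp: irreducible_form_def)
  let ?y = "\<psi> u"
  have ud: "u \<in> disc (face_dim x)" "\<not> (\<Sum>i<face_dim x. (u i)\<^sup>2) < 1"
    using u by (auto simp: disc_boundary_eq)
  have y: "?y \<in> closed_face x" "?y \<notin> face x"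
    using c ud by (auto simp: chart_def bij_betw_def)
  have less: "face_dim ?y < face_dim x"
    using standard_formD(2)[OF sf] y by (rule face_dim_less)
  let ?\<sigma> = "deform \<rho> g (?y - x)"
  have sf': "standard_form ?\<sigma> g ?y"
    using sf y(1) by (rule deform_standard_form)
  show ?thesis
  proof (cases "reducible_rep G ?\<sigma>")
    case True
    then show ?thesis
      using less by (intro that(1)) (auto simp: attaching_map_def irr_plus_proj_def)
  next
    case False
    then have "attaching_map \<rho> g x \<psi> u = Some (rep_orbit G ?\<sigma>)"
      by (simp add: attaching_map_def irr_plus_proj_def)
    then show ?thesis
      using False sf' orbit_in_cell[OF sf'] less by (intro that(2)[of ?\<sigma> ?y]) (auto simp: irreducible_form_def)
  qed
qed

lemma Union_cells:
  "insert None (\<Union>cells) = topspace (Irr_plus_top G :: ('a \<Rightarrow> complex^'n^'n) set option topology)"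
proof (intro subset_antisym subsetI)
  fix q :: "('a \<Rightarrow> complex^'n^'n) set option"
  assume "q \<in> insert None (\<Union>cells)"
  then consider "q = None" | "q \<in> \<Union>cells"
    by blast
  then show "q \<in> topspace (Irr_plus_top G)"
  proof cases
    case 2
    then obtain \<rho> :: "'a \<Rightarrow> complex^'n^'n" and g x where irr: "irreducible_form \<rho> g x" and q: "q \<in> cell \<rho> g x"
      by (auto simp: cells_def)
    then obtain y where y: "y \<in> face x" "q = Some (rep_orbit G (deform \<rho> g (y - x)))"
      by (auto simp: cell_def)
    have "standard_form \<rho> g x" "\<not> reducible_rep G \<rho>"
      using irr by (auto simp: irreducible_form_def)
    then have "q = irr_plus_proj G (deform \<rho> g (y - x))" "deform \<rho> g (y - x) \<in> Hom_U G"
      using deform_irreducible[of \<rho> g x y] deform_standard_form[of \<rho> g x y] y face_closed_face standard_formD(1)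
      by (auto simp: irr_plus_proj_def)
    then show ?thesis
      by (auto simp: topspace_Irr_plus_top)
  qed (simp add: topspace_Irr_plus_top)
next
  fix q :: "('a \<Rightarrow> complex^'n^'n) set option"
  assume "q \<in> topspace (Irr_plus_top G)"
  then consider "q = None" | \<rho> where "\<rho> \<in> Hom_U G" "\<not> reducible_rep G \<rho>" "q = Some (rep_orbit G \<rho>)"
    by (auto simp: topspace_Irr_plus_top irr_plus_proj_def split: if_splits)
  then show "q \<in> insert None (\<Union>cells)"
  proof cases
    case 2
    obtain U g x where U: "U \<in> unitary_group" and sf: "standard_form (conj_rep G U \<rho>) g x"
      by (rule irreducible_standard_form[OF 2(1,2)])
    have "irreducible_form (conj_rep G U \<rho>) g x"
      using sf 2(2) by (simp add: irreducible_form_def reducible_rep_conj_rep[OF U])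
    moreover have "q \<in> cell (conj_rep G U \<rho>) g x"
      using orbit_in_cell[OF sf] 2(3) by (simp add: rep_orbit_conj_rep[OF U])
    ultimately show ?thesis
      by (auto simp: cells_def)
  qed simp
qed

theorem CW_Irr_plus_top:
  "CW_complex_dim_le (Irr_plus_top G :: ('a \<Rightarrow> complex^'n^'n) set option topology) k"
proof -
  have "\<forall>e\<in>cells. \<exists>d :: ('a \<Rightarrow> complex^'n^'n) \<times> ('n \<Rightarrow> 'a) \<times> ('a \<Rightarrow> real) \<times> ((nat \<Rightarrow> real) \<Rightarrow> 'a \<Rightarrow> real).
      e = cell (fst d) (fst (snd d)) (fst (snd (snd d))) \<and>
      irreducible_form (fst d) (fst (snd d)) (fst (snd (snd d))) \<and> chart (fst (snd (snd d))) (snd (snd (snd d)))"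
  proof
    fix e :: "('a \<Rightarrow> complex^'n^'n) set option set" assume "e \<in> cells"
    then obtain \<rho> :: "'a \<Rightarrow> complex^'n^'n" and g x where e: "e = cell \<rho> g x" "irreducible_form \<rho> g x"
      by (auto simp: cells_def)
    then have "x \<in> V"
      by (auto simp: irreducible_form_def standard_form_def)
    then obtain \<psi> where "chart x \<psi>"
      unfolding chart_def using face_chart by metis
    then show "\<exists>d :: ('a \<Rightarrow> complex^'n^'n) \<times> ('n \<Rightarrow> 'a) \<times> ('a \<Rightarrow> real) \<times> ((nat \<Rightarrow> real) \<Rightarrow> 'a \<Rightarrow> real).
      e = cell (fst d) (fst (snd d)) (fst (snd (snd d))) \<and>
      irreducible_form (fst d) (fst (snd d)) (fst (snd (snd d))) \<and> chart (fst (snd (snd d))) (snd (snd (snd d)))"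
      using e by (intro exI[of _ "(\<rho>, g, x, \<psi>)"]) simp
  qed
  \<comment> \<open>Presentations and charts are not unique, so one of each is fixed per
    cell.\<close>
  from bchoice[OF this] obtain D :: "('a \<Rightarrow> complex^'n^'n) set option set \<Rightarrow>
      ('a \<Rightarrow> complex^'n^'n) \<times> ('n \<Rightarrow> 'a) \<times> ('a \<Rightarrow> real) \<times> ((nat \<Rightarrow> real) \<Rightarrow> 'a \<Rightarrow> real)" where
    D: "\<forall>e\<in>cells. e = cell (fst (D e)) (fst (snd (D e))) (fst (snd (snd (D e)))) \<and>
      irreducible_form (fst (D e)) (fst (snd (D e))) (fst (snd (snd (D e)))) \<and>
      chart (fst (snd (snd (D e)))) (snd (snd (snd (D e))))"
    by blast
  define rep where "rep e = fst (D e)" for e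
  define frm where "frm e = fst (snd (D e))" for e
  define pt where "pt e = fst (snd (snd (D e)))" for e
  define prm where "prm e = snd (snd (snd (D e)))" for e
  have data: "cell (rep e) (frm e) (pt e) = e" "irreducible_form (rep e) (frm e) (pt e)" "chart (pt e) (prm e)"
    if "e \<in> cells" for e
    using D that by (auto simp: rep_def frm_def pt_def prm_def)
  have sf: "standard_form (rep e) (frm e) (pt e)" if "e \<in> cells" for e
    using data(2)[OF that] by (simp add: irreducible_form_def)
  have nonempty: "e \<noteq> {}" and no_None: "None \<notin> e" if "e \<in> cells" for e :: "('a \<Rightarrow> complex^'n^'n) set option set"
  proof -
    show "e \<noteq> {}"
      using orbit_in_cell[OF sf[OF that]] data(1)[OF that] by auto
    show "None \<notin> e"
      using data(1)[OF that] by (auto simp: cell_def)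
  qed
  \<comment> \<open>The singleton of the base point is the extra 0-cell; it is not in
    \<open>cells\<close>, whose members never contain \<open>None\<close>.\<close>
  define dm where "dm e = (if e = {None} then 0 else face_dim (pt e))" for e
  define chr where "chr e = (if e = {None} then \<lambda>_. None else attaching_map (rep e) (frm e) (pt e) (prm e))" for e
  have dm: "dm e = face_dim (pt e)" and chr: "chr e = attaching_map (rep e) (frm e) (pt e) (prm e)" if "e \<in> cells" for e
    using no_None[OF that] by (auto simp: dm_def chr_def)
  \<comment> \<open>A boundary cell arrives with a presentation of its own, whereas
    \<open>dm\<close> uses the fixed one; \<open>cell_face_dim\<close> reconciles them.\<close>
  have dm_cell: "dm (cell \<rho> g x) = face_dim x" "cell \<rho> g x \<in> cells"
    if "irreducible_form \<rho> g x" for \<rho> :: "'a \<Rightarrow> complex^'n^'n" and g x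
  proof -
    show in_cells: "cell \<rho> g x \<in> cells"
      using that by (auto simp: cells_def)
    show "dm (cell \<rho> g x) = face_dim x"
      unfolding dm[OF in_cells] using that
      by (intro cell_face_dim[OF sf[OF in_cells] _ data(1)[OF in_cells]]) (simp add: irreducible_form_def)
  qed
  show ?thesis
  proof (rule CW_complex_dim_leI_finite[where cells = "insert {None} cells" and dm = dm and chr = chr])
    show "Hausdorff_space (Irr_plus_top G :: ('a \<Rightarrow> complex^'n^'n) set option topology)"
      by (rule Hausdorff_Irr_plus_top[OF is_group])
    show "finite (insert {None} cells :: ('a \<Rightarrow> complex^'n^'n) set option set set)"
      using finite_cells by simp
    show "\<Union>(insert {None} cells) = topspace (Irr_plus_top G :: ('a \<Rightarrow> complex^'n^'n) set option topology)"
      using Union_cells by auto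
    show "{} \<notin> (insert {None} cells :: ('a \<Rightarrow> complex^'n^'n) set option set set)"
      using nonempty by auto
    have "e = e'" if e: "e \<in> cells" and e': "e' \<in> cells" and c: "c \<in> e" "c \<in> e'"
      for e e' :: "('a \<Rightarrow> complex^'n^'n) set option set" and c
      using cells_disjoint[OF sf[OF e] sf[OF e'], of c] data(1)[OF e] data(1)[OF e'] c by simp
    then show "pairwise disjnt (insert {None} cells :: ('a \<Rightarrow> complex^'n^'n) set option set set)"
      using no_None by (fastforce simp: pairwise_def disjnt_def)
    fix e :: "('a \<Rightarrow> complex^'n^'n) set option set"
    assume "e \<in> insert {None} cells"
    then have e: "e \<in> cells" if "e \<noteq> {None}"
      using that by blast
    show "dm e \<le> k"
      using face_dim_le by (simp add: dm_def)
    show "continuous_map (closed_disc (dm e)) (Irr_plus_top G) (chr e)"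
    proof (cases "e = {None}")
      case True
      then show ?thesis
        by (simp add: chr_def topspace_Irr_plus_top)
    next
      case False
      note 2 = e[OF False]
      show ?thesis
        unfolding dm[OF 2] chr[OF 2] by (intro continuous_attaching_map sf data 2)
    qed
    have disc0: "topspace (open_disc 0) = {\<lambda>i. 0}"
      by (auto simp: topspace_open_disc disc_def)
    show "inj_on (chr e) (topspace (open_disc (dm e)))"
    proof (cases "e = {None}")
      case True
      then show ?thesis
        by (simp add: dm_def disc0)
    next
      case False
      note 2 = e[OF False]
      show ?thesis
        unfolding dm[OF 2] chr[OF 2] by (intro attaching_map_open_disc data 2)
    qed
    show "chr e ` topspace (open_disc (dm e)) = e"
    proof (cases "e = {None}")
      case True
      then show ?thesis
        by (simp add: dm_def chr_def disc0)
    next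
      case False
      note 2 = e[OF False]
      show ?thesis
        unfolding dm[OF 2] chr[OF 2] using attaching_map_open_disc(2)[OF data(2,3)[OF 2]] data(1)[OF 2] by simp
    qed
    show "chr e ` disc_boundary (dm e) \<subseteq> \<Union>{e' \<in> insert {None} cells. dm e' < dm e}"
    proof (cases "e = {None}")
      case True
      then show ?thesis
        by (simp add: dm_def disc_boundary_def)
    next
      case False
      note 2 = e[OF False]
      show ?thesis
        unfolding dm[OF 2] chr[OF 2]
      proof (rule image_subsetI)
        fix u assume u: "u \<in> disc_boundary (face_dim (pt e))"
        show "attaching_map (rep e) (frm e) (pt e) (prm e) u \<in> \<Union>{e' \<in> insert {None} cells. dm e' < face_dim (pt e)}"
        proof (rule attaching_map_boundary[OF data(2,3)[OF 2] u])
          assume "attaching_map (rep e) (frm e) (pt e) (prm e) u = None" "0 < face_dim (pt e)"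
          then show ?thesis
            by (intro UnionI[of "{None}"]) (auto simp: dm_def)
        next
          fix \<sigma> y assume *: "irreducible_form \<sigma> (frm e) y" "attaching_map (rep e) (frm e) (pt e) (prm e) u \<in> cell \<sigma> (frm e) y"
            "face_dim y < face_dim (pt e)"
          show ?thesis
            using dm_cell[OF *(1)] *(2,3) by (intro UnionI[of "cell \<sigma> (frm e) y"]) auto
        qed
      qed
    qed
  qed
qed

end

theorem theorem1p3:
  fixes G :: "('g, 'b) monoid_scheme" and k :: nat
  assumes "group G"
    and "virtually_Zpow G k"
  shows "CW_complex_dim_le (Irr_plus_top G :: ('g \<Rightarrow> complex^'n::finite^'n) set option topology) k"
proof -
  obtain N S p where "lattice_extension G N S k p"
    by (rule virtually_Zpow_lattice_extension[OF assms])
  then show ?thesis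
    by (rule lattice_extension.CW_Irr_plus_top)
qed

end
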